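(* Let $0<s<1$ and let $n\ge 2$ be an integer. Let $u:\mathbb{R}^n\times\mathbb{R}\to\mathbb{R}$ belong to $$\mathcal{L}^{2s,s}(\mathbb{R}^n\times\mathbb{R})=\left\{u \in L^1_{\rm loc}(\mathbb{R}^n\times\mathbb{R}) \;\middle|\; \int_{-\infty}^{+\infty}\int_{\mathbb{R}^n}\frac{|u(x,t)|}{1+|x|^{n+2+2s}+|t|^{\frac n2+1+s}}\,dx\,dt<\infty\right\},$$ and suppose that $u$ is a solution of $(\partial_t-\Delta)^s u=0$ in $\mathbb{R}^n\times\mathbb{R}$ in the sense of distributions, i.e. $$\int_{-\infty}^{+\infty}\int_{\mathbb{R}^n}u(x,t)\,\overline{(\partial_t-\Delta)^s_{\rm right}\varphi(x,t)}\,dx\,dt=0\qquad\text{for every }\varphi\in\mathcal{S}(\mathbb{R}^n\times\mathbb{R}).$$ In the case $\frac12<s<1$, assume additionally that for some $0\le\gamma\le 1$, either $$\liminf_{|x|\to\infty}\frac{u(x,t)}{|x|^\gamma}\ge 0\quad\text{for every }t\in\mathbb{R},\qquad\text{or}\qquad \limsup_{|x|\to\infty}\frac{u(x,t)}{|x|^\gamma}\le 0\quad\text{for every }t\in\mathbb{R}.$$ Then $u$ must be a constant (i.e. $u$ is equal almost everywhere to a constant).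
   Context: $\mathcal{S}(\mathbb{R}^n\times\mathbb{R})$ is the space of (complex-valued) Schwartz functions. For $\varphi\in\mathcal{S}(\mathbb{R}^n\times\mathbb{R})$, the right fractional operator is $$(\partial_t-\Delta)^s_{\rm right}\varphi(x,t):=C_{n,s}\int_t^{+\infty}\int_{\mathbb{R}^n}\frac{\varphi(x,t)-\varphi(y,\tau)}{(\tau-t)^{\frac n2+1+s}}\,e^{-\frac{|x-y|^2}{4(\tau-t)}}\,dy\,d\tau,\qquad C_{n,s}=\frac{1}{(4\pi)^{n/2}|\Gamma(-s)|},$$ where the integral in $y$ is taken in the Cauchy principal value sense. Equivalently, without principal value, $$(\partial_t-\Delta)^s_{\rm right}\varphi(x,t)=\frac{C_{n,s}}{2}\int_0^{+\infty}\int_{\mathbb{R}^n}\frac{2\varphi(x,t)-\varphi(x+y,t+\tau)-\varphi(x-y,t+\tau)}{\tau^{\frac n2+1+s}}\,e^{-\frac{|y|^2}{4\tau}}\,dy\,d\tau .$$ *)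

theory Defs
  imports "HOL-Analysis.Analysis"
begin

fun iter_partial :: "'a::euclidean_space list \<Rightarrow> ('a \<Rightarrow> complex) \<Rightarrow> 'a \<Rightarrow> complex" where
  "iter_partial [] f = f"
| "iter_partial (b # bs) f = (\<lambda>z. frechet_derivative (iter_partial bs f) (at z) b)"

text \<open>
  Lists of basis vectors play the role of multi-indices. Since every iterated partial derivative
  is required to be (totally) differentiable at every point, the functions below are exactly
  the smooth ones all of whose derivatives decay faster than any power.
\<close>

definition schwartz :: "('a::euclidean_space \<Rightarrow> complex) set" where
  "schwartz = {f. \<forall>bs. set bs \<subseteq> Basis \<longrightarrow>
     (\<forall>z. iter_partial bs f differentiable (at z)) \<and>
     (\<forall>k::nat. \<exists>C::real. \<forall>z. norm z ^ k * norm (iter_partial bs f z) \<le> C)}"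

definition pv_integral :: "'a::euclidean_space \<Rightarrow> ('a \<Rightarrow> complex) \<Rightarrow> complex" where
  "pv_integral x f = Lim (at_right (0::real)) (\<lambda>\<epsilon>. LINT y:- ball x \<epsilon>|lborel. f y)"

definition frac_heat_const :: "nat \<Rightarrow> real \<Rightarrow> real" where
  "frac_heat_const n s = 1 / ((4 * pi) powr (real n / 2) * \<bar>Gamma (- s)\<bar>)"

definition frac_heat_right ::
    "real \<Rightarrow> ((real ^ 'n::finite) \<times> real \<Rightarrow> complex) \<Rightarrow> (real ^ 'n) \<times> real \<Rightarrow> complex" where
  "frac_heat_right s \<phi> = (\<lambda>(x, t).
     complex_of_real (frac_heat_const CARD('n) s) *
     (LINT \<tau>:{t<..}|lborel.
        pv_integral x (\<lambda>y.
          (\<phi> (x, t) - \<phi> (y, \<tau>)) / complex_of_real ((\<tau> - t) powr (real CARD('n) / 2 + 1 + s)) *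
          complex_of_real (exp (- (norm (x - y))\<^sup>2 / (4 * (\<tau> - t)))))))"

definition L1_loc :: "('a::euclidean_space \<Rightarrow> real) set" where
  "L1_loc = {u. \<forall>K. compact K \<longrightarrow> set_integrable lebesgue K u}"

definition L_frac_heat :: "real \<Rightarrow> ((real ^ 'n::finite) \<times> real \<Rightarrow> real) set" where
  "L_frac_heat s = {u \<in> L1_loc. integrable lebesgue (\<lambda>(x, t).
     \<bar>u (x, t)\<bar> / (1 + norm x powr (real CARD('n) + 2 + 2 * s)
                      + \<bar>t\<bar> powr (real CARD('n) / 2 + 1 + s)))}"

definition frac_heat_distr_solution ::
    "real \<Rightarrow> ((real ^ 'n::finite) \<times> real \<Rightarrow> real) \<Rightarrow> bool" where
  "frac_heat_distr_solution s u \<longleftrightarrow>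
     (\<forall>\<phi>\<in>schwartz. (LINT z|lebesgue. complex_of_real (u z) * cnj (frac_heat_right s \<phi> z)) = 0)"

end

theory Submission
  imports Defs "HOL-Probability.Sinc_Integral"
begin

text \<open>
  No Fourier analysis is needed. Put $d = n/2$ and $p = d + 1 + s$. For a profile $A$ vanishing on
  $(-\infty, 0]$ and $r = t_0 - t$, the semigroup property of the heat kernel shows that the right
  operator maps $r^{-d} e^{-|x-x_0|^2/4r} A(r)$ to a constant multiple of
  $r^{-d} e^{-|x-x_0|^2/4r} D^s A(r)$, where $D^s$ is the one-dimensional Marchaud derivative. The
  profile $A_T(r) = r^{s-1} e^{-T/r}$ satisfies $D^s A_T = c\, T^s r^{-1-s} e^{-T/r}$. Hence, after
  testing with $e^{-\epsilon r} (A_{T_1} - A_{T_2})$ and letting $\epsilon \to 0$, the mean value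
  $M(x_0, t_0) = T^s \int u(x,t)\, r^{-p} e^{-(|x-x_0|^2/4 + T)/r}\, dx\, dt$ does not depend on
  $T > 0$.

  As $T \to \infty$, the first difference of the kernel in $t_0$ and the second differences in $x_0$
  (already the first ones if $s \le 1/2$) tend to zero against $u$, so $M$ is an affine function
  of $x_0$. As $T \to 0$ the kernels form an approximate identity, so $u = M / c_0$ almost
  everywhere. The growth condition excludes a nonzero linear part.
\<close>

section \<open>A space of Schwartz functions built from heat kernels\<close>


text \<open>Up to a constant, the mean value with parameter T is the Poisson integral of the
  degenerate parabolic extension problem attached to (d_t - Delta)^s, taken at height 2 * sqrt T.
  Its independence of T says that the extension of a solution does not depend on the height. The
  extension has a second formal representation, in which the kernel r^(s-1) e^(-T/r) acts on (d_t -
  Delta)^s u; this is the origin of A_T. That representation is unusable for a single T: for u = 1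
  it would give 0, while the Poisson integral is a nonzero constant. The cause is that A_T is not
  integrable at infinity. The damping e^(-epsilon r), which makes the test functions Schwartz in
  time, does not commute with D^s, and for a single profile the pairing of the commutator with u
  need not tend to 0. In the difference of two profiles the leading terms at infinity cancel,
  leaving the integrable order r^(s-2), and then the commutator is dominated uniformly in
  epsilon.\<close>

definition heat_E :: "'a::euclidean_space \<Rightarrow> real \<Rightarrow> real \<Rightarrow> real \<Rightarrow> real \<Rightarrow> 'a \<times> real \<Rightarrow> real" where
  "heat_E x0 t0 e a T = (\<lambda>(x, t). if t < t0
     then (t0 - t) powr a * exp (- (((norm (x - x0))\<^sup>2 / 4 + T) / (t0 - t)) - e * (t0 - t)) else 0)"

section \<open>Powers against exponentials\<close>

lemma exp_neg_times_powr_bounded: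
  fixes a :: real
  shows "\<exists>C\<ge>0. \<forall>q\<ge>0. (1 + q) powr a * exp (- q) \<le> C"
proof -
  obtain k :: nat where k: "a \<le> real k" using real_arch_simple by blast
  have "(1 + q) powr a * exp (- q) \<le> fact k * exp 1" if q: "q \<ge> 0" for q :: real
  proof -
    have "(1 + q) powr a \<le> (1 + q) powr real k" using q k by (intro powr_mono) auto
    also have "\<dots> = (1 + q) ^ k" using q by (simp add: powr_realpow)
    also have "\<dots> \<le> fact k * exp (1 + q)"
    proof -
      have "(1 + q) ^ k /\<^sub>R fact k \<le> (\<Sum>i. (1 + q) ^ i /\<^sub>R fact i)"
        using q by (intro sum_le_suminf[of _ "{k}", simplified] summable_exp_generic) auto
      then have "(1 + q) ^ k /\<^sub>R fact k \<le> exp (1 + q)" by (simp add: exp_def)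
      then show ?thesis by (simp add: field_simps)
    qed
    finally have "(1 + q) powr a * exp (- q) \<le> fact k * exp (1 + q) * exp (- q)"
      by (intro mult_right_mono) auto
    also have "\<dots> = fact k * exp 1" by (simp flip: exp_add)
    finally show ?thesis .
  qed
  then show ?thesis by (intro exI[of _ "fact k * exp 1"]) auto
qed

text \<open>Divided by (v + r) powr (- p), the left side depends on q = v/r only and is at most (1 +
  q) powr (p + a) * exp (- q). With v = |x - x0|^2/4 + T and r = t0 - t this trades the kernel for a
  power of a squared parabolic distance; the factor (v/r) powr a absorbs what derivatives of the
  kernel produce.\<close>

lemma powr_times_exp_neg_inverse_le:
  fixes a p :: real
  assumes "a \<ge> 0"
  shows "\<exists>C\<ge>0. \<forall>v>0. \<forall>r>0. (v / r) powr a * (r powr (- p) * exp (- (v / r))) \<le> C * (v + r) powr (- p)"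
proof -
  obtain C where C: "C \<ge> 0" "\<And>q. q \<ge> 0 \<Longrightarrow> (1 + q) powr (p + a) * exp (- q) \<le> C"
    using exp_neg_times_powr_bounded by blast
  have "(v / r) powr a * (r powr (- p) * exp (- (v / r))) \<le> C * (v + r) powr (- p)"
    if "v > 0" "r > 0" for v r :: real
  proof -
    have 1: "1 + v / r = (v + r) / r" using that by (simp add: field_simps)
    have "(v / r) powr a * (r powr (- p) * exp (- (v / r)))
        \<le> (1 + v / r) powr a * (r powr (- p) * exp (- (v / r)))"
      using that assms by (intro mult_right_mono powr_mono2) auto
    also have "\<dots> = (v + r) powr (- p) * ((1 + v / r) powr (p + a) * exp (- (v / r)))"
      using that unfolding powr_add 1 by (simp add: powr_divide powr_minus field_simps)
    also have "\<dots> \<le> (v + r) powr (- p) * C"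
      using that C(2)[of "v / r"] by (intro mult_left_mono) auto
    finally show ?thesis by (simp add: mult.commute)
  qed
  then show ?thesis using C(1) by blast
qed

lemma powr_times_exp_neg_bounded:
  fixes a c :: real
  assumes "a \<ge> 0" "c > 0"
  shows "\<exists>C\<ge>0. \<forall>q>0. q powr a * exp (- (c * q)) \<le> C"
proof -
  obtain C where C: "C \<ge> 0" "\<And>q. q \<ge> 0 \<Longrightarrow> (1 + q) powr a * exp (- q) \<le> C"
    using exp_neg_times_powr_bounded by blast
  have "q powr a * exp (- (c * q)) \<le> c powr (- a) * C" if q: "q > 0" for q
  proof -
    have "q powr a * exp (- (c * q)) = c powr (- a) * ((c * q) powr a * exp (- (c * q)))"
      using q assms by (simp add: powr_mult powr_minus field_simps)
    also have "\<dots> \<le> c powr (- a) * ((1 + c * q) powr a * exp (- (c * q)))"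
      using q assms by (intro mult_left_mono mult_right_mono powr_mono2) auto
    also have "\<dots> \<le> c powr (- a) * C" using q assms by (intro mult_left_mono C(2)) auto
    finally show ?thesis .
  qed
  then show ?thesis using C(1) by (intro exI[of _ "c powr (- a) * C"]) auto
qed

lemma powr_exp_exp_bounded:
  fixes a T e :: real
  assumes "T > 0" "e \<ge> 0" "a \<le> 0 \<or> e > 0"
  shows "\<exists>C\<ge>0. \<forall>r>0. r powr a * exp (- T / r - e * r) \<le> C"
proof (cases "a \<le> 0")
  case True
  obtain C where C: "C \<ge> 0" "\<And>q. q > 0 \<Longrightarrow> q powr (- a) * exp (- (T * q)) \<le> C"
    using powr_times_exp_neg_bounded[of "- a" T] True assms by auto
  have "r powr a * exp (- T / r - e * r) \<le> C" if r: "r > 0" for r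
  proof -
    have "r powr a * exp (- T / r - e * r) \<le> (1 / r) powr (- a) * exp (- (T * (1 / r)))"
      using r assms by (intro mult_mono) (auto simp: powr_divide powr_minus)
    also have "\<dots> \<le> C" using r by (intro C(2)) simp
    finally show ?thesis .
  qed
  then show ?thesis using C(1) by blast
next
  case False
  obtain C where C: "C \<ge> 0" "\<And>q. q > 0 \<Longrightarrow> q powr a * exp (- (e * q)) \<le> C"
    using powr_times_exp_neg_bounded[of a e] False assms by auto
  have "r powr a * exp (- T / r - e * r) \<le> C" if r: "r > 0" for r
  proof -
    have "r powr a * exp (- T / r - e * r) \<le> r powr a * exp (- (e * r))"
      using r assms by (intro mult_left_mono) auto
    also have "\<dots> \<le> C" by (rule C(2)[OF r])
    finally show ?thesis .
  qed
  then show ?thesis using C(1) by blast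
qed

section \<open>Smoothness of the kernel across the final time\<close>

lemma heat_E_nonneg [simp]: "heat_E x0 t0 e a T z \<ge> 0"
  by (auto simp: heat_E_def split: prod.splits)

lemma heat_E_powr:
  "t < t0 \<Longrightarrow> heat_E x0 t0 e (a + b) T (x, t) = (t0 - t) powr b * heat_E x0 t0 e a T (x, t)"
  by (simp add: heat_E_def powr_add)

text \<open>Meant for differentiability at t = t0, where the kernel is glued to 0: quadratic
  flatness kills the difference quotient. Since r < 1 gives r powr a <= r powr (- |a|), the single
  exponent - |a| - 2 covers both signs of a.\<close>

lemma heat_E_le_square:
  assumes "T > 0" "e \<ge> 0"
  shows "\<exists>C\<ge>0. \<forall>x t. t > t0 - 1 \<longrightarrow> heat_E x0 t0 e a T (x, t) \<le> C * (t0 - t)\<^sup>2"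
proof -
  obtain C where C: "C \<ge> 0" "\<And>r. r > 0 \<Longrightarrow> r powr (- \<bar>a\<bar> - 2) * exp (- T / r - e * r) \<le> C"
    using powr_exp_exp_bounded[OF assms, of "- \<bar>a\<bar> - 2"] by force
  have "heat_E x0 t0 e a T (x, t) \<le> C * (t0 - t)\<^sup>2" if t: "t > t0 - 1" for x t
  proof (cases "t < t0")
    case True
    define r where "r = t0 - t"
    have r: "0 < r" "r < 1" using t True by (auto simp: r_def)
    have "heat_E x0 t0 e a T (x, t) = r powr a * exp (- (((norm (x - x0))\<^sup>2 / 4 + T) / r) - e * r)"
      using True by (simp add: heat_E_def r_def)
    also have "\<dots> \<le> r powr (- \<bar>a\<bar>) * exp (- T / r - e * r)"
      using r by (intro mult_mono powr_mono') (auto simp: field_simps)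
    also have "\<dots> = (r powr (- \<bar>a\<bar> - 2) * exp (- T / r - e * r)) * r\<^sup>2"
      using r by (simp add: powr_diff field_simps)
    also have "\<dots> \<le> C * r\<^sup>2" using r C(2)[of r] by (intro mult_right_mono) auto
    finally show ?thesis by (simp add: r_def)
  qed (use C in \<open>auto simp: heat_E_def\<close>)
  then show ?thesis using C(1) by blast
qed

text \<open>The derivative is again built from kernels, with exponents a, a - 1 and a - 2, so
  differentiation can be iterated within one family. Written through \<open>heat_E\<close>, the
  formula also covers t >= t0, where all these kernels vanish.\<close>

lemma has_derivative_heat_E:
  assumes "T > 0" "e \<ge> 0"
  shows "(heat_E x0 t0 e a T has_derivative (\<lambda>h.
           - ((x - x0) \<bullet> fst h) / 2 * heat_E x0 t0 e (a - 1) T (x, t)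
           - snd h * (a * heat_E x0 t0 e (a - 1) T (x, t)
               + ((norm (x - x0))\<^sup>2 / 4 + T) * heat_E x0 t0 e (a - 2) T (x, t)
               - e * heat_E x0 t0 e a T (x, t)))) (at (x, t))"
proof (cases "t < t0")
  case True
  define S where "S = {z::'a \<times> real. snd z < t0}"
  have "open S" unfolding S_def by (intro open_Collect_less continuous_intros)
  let ?g = "\<lambda>z. exp (a * ln (t0 - snd z)
      - (((fst z - x0) \<bullet> (fst z - x0)) / 4 + T) / (t0 - snd z) - e * (t0 - snd z))"
  let ?D = "\<lambda>h. - ((x - x0) \<bullet> fst h) / 2 * heat_E x0 t0 e (a - 1) T (x, t)
           - snd h * (a * heat_E x0 t0 e (a - 1) T (x, t)
               + ((norm (x - x0))\<^sup>2 / 4 + T) * heat_E x0 t0 e (a - 2) T (x, t)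
               - e * heat_E x0 t0 e a T (x, t))"
  define r where "r = t0 - t"
  define v where "v = ((x - x0) \<bullet> (x - x0)) / 4 + T"
  have r: "r > 0" using True by (simp add: r_def)
  have H: "heat_E x0 t0 e a T (x, t) = ?g (x, t)"
    using True by (simp add: heat_E_def powr_def power2_norm_eq_inner flip: exp_add)
  have H1: "heat_E x0 t0 e (a - 1) T (x, t) = heat_E x0 t0 e a T (x, t) / r"
    using True heat_E_powr[of t t0 x0 e a "- 1" T x] by (simp add: r_def powr_minus field_simps)
  have H2: "heat_E x0 t0 e (a - 2) T (x, t) = heat_E x0 t0 e a T (x, t) / r\<^sup>2"
    using True heat_E_powr[of t t0 x0 e a "- 2" T x] by (simp add: r_def powr_minus field_simps)
  have "((\<lambda>z. a * ln (t0 - snd z)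
      - (((fst z - x0) \<bullet> (fst z - x0)) / 4 + T) / (t0 - snd z) - e * (t0 - snd z)) has_derivative
      (\<lambda>h. a * (- snd h / r) - (((x - x0) \<bullet> fst h) / 2 * r + v * snd h) / r\<^sup>2 + e * snd h)) (at (x, t))"
  proof -
    have d1: "((\<lambda>z. t0 - snd z) has_derivative (\<lambda>h. - snd h)) (at (x, t))"
      by (rule has_derivative_eq_rhs, (rule derivative_intros)+) auto
    have d2: "((\<lambda>z. ((fst z - x0) \<bullet> (fst z - x0)) / 4 + T) has_derivative
        (\<lambda>h. ((x - x0) \<bullet> fst h) / 2)) (at (x, t))"
      by (rule has_derivative_eq_rhs, (rule derivative_intros | simp)+)
         (auto simp: inner_commute fun_eq_iff)
    have d3: "((\<lambda>z. ln (t0 - snd z)) has_derivative (\<lambda>h. - snd h / r)) (at (x, t))"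
      by (rule has_derivative_eq_rhs, rule has_derivative_ln[OF _ d1])
         (use r in \<open>auto simp: r_def field_simps fun_eq_iff\<close>)
    have d4: "((\<lambda>z. (((fst z - x0) \<bullet> (fst z - x0)) / 4 + T) / (t0 - snd z)) has_derivative
        (\<lambda>h. (((x - x0) \<bullet> fst h) / 2 * r + v * snd h) / r\<^sup>2)) (at (x, t))"
      by (rule has_derivative_eq_rhs, rule has_derivative_divide'[OF d2 d1])
         (use r in \<open>auto simp: r_def v_def fun_eq_iff power2_eq_square\<close>)
    show ?thesis
      by (rule has_derivative_eq_rhs, rule has_derivative_diff[OF has_derivative_diff[OF
            has_derivative_mult_right[OF d3] d4] has_derivative_mult_right[OF d1]])
         simp
  qed
  then have "(?g has_derivative (\<lambda>h. heat_E x0 t0 e a T (x, t) *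
      (a * (- snd h / r) - (((x - x0) \<bullet> fst h) / 2 * r + v * snd h) / r\<^sup>2 + e * snd h))) (at (x, t))"
    unfolding H by (rule derivative_eq_intros) (simp add: mult.commute)
  also have "(\<lambda>h. heat_E x0 t0 e a T (x, t) *
      (a * (- snd h / r) - (((x - x0) \<bullet> fst h) / 2 * r + v * snd h) / r\<^sup>2 + e * snd h)) = ?D"
    unfolding H1 H2 power2_norm_eq_inner v_def[symmetric] using r
    by (simp add: fun_eq_iff field_simps power2_eq_square)
  finally have "(?g has_derivative ?D) (at (x, t))" .
  moreover have "?g z = heat_E x0 t0 e a T z" if "z \<in> S" for z
    using that by (cases z) (auto simp: S_def heat_E_def powr_def power2_norm_eq_inner simp flip: exp_add)
  ultimately show ?thesis
    using has_derivative_transform_within_open[of ?g ?D "(x,t)" UNIV S] \<open>open S\<close> True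
    by (auto simp: S_def)
next
  case False
  \<comment> \<open>For t >= t0 a nearby point either has time at least t0, where the kernel is 0,
    or has a time t' with t0 - t' <= |t' - t|, so that the flatness at t0 is quadratic in the
    distance to (x, t).\<close>
  obtain C where C: "C \<ge> 0" "\<And>x t. t > t0 - 1 \<Longrightarrow> heat_E x0 t0 e a T (x, t) \<le> C * (t0 - t)\<^sup>2"
    using heat_E_le_square[OF assms] by blast
  have z: "heat_E x0 t0 e b T (x, t) = 0" for b using False by (simp add: heat_E_def)
  have "(heat_E x0 t0 e a T has_derivative (\<lambda>h. 0)) (at (x, t))"
    unfolding has_derivative_within z add_0 diff_0_right
  proof (intro conjI)
    have "((\<lambda>y. C * norm (y - (x,t))) \<longlongrightarrow> C * norm ((x,t) - (x,t))) (at (x,t))"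
      by (intro tendsto_intros)
    then have lim: "((\<lambda>y. C * norm (y - (x,t))) \<longlongrightarrow> 0) (at (x,t))" by simp
    show "((\<lambda>y. (1 / norm (y - (x, t))) *\<^sub>R (heat_E x0 t0 e a T y)) \<longlongrightarrow> 0) (at (x, t))"
    proof (rule Lim_null_comparison[OF _ lim])
      show "\<forall>\<^sub>F y in at (x, t). norm ((1 / norm (y - (x, t))) *\<^sub>R (heat_E x0 t0 e a T y))
          \<le> C * norm (y - (x, t))"
        unfolding eventually_at
      proof (intro exI[of _ 1] conjI ballI impI)
        fix y assume y: "y \<noteq> (x,t) \<and> dist y (x,t) < 1"
        obtain x' t' where y': "y = (x', t')" by (cases y)
        have le: "\<bar>t' - t\<bar> \<le> norm (y - (x,t))"
          unfolding y' using norm_snd_le[of "t' - t" "x' - x"] by simp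
        have "heat_E x0 t0 e a T y \<le> C * (norm (y - (x,t)))\<^sup>2"
        proof (cases "t' < t0")
          case True
          have "\<bar>t0 - t'\<bar> \<le> norm (y - (x,t))" using True False le by linarith
          moreover have "t' > t0 - 1" using y le False by (auto simp: dist_norm)
          ultimately have "heat_E x0 t0 e a T y \<le> C * \<bar>t0 - t'\<bar>\<^sup>2" using C(2)[of t' x'] y' by auto
          also have "\<dots> \<le> C * (norm (y - (x,t)))\<^sup>2"
            using \<open>\<bar>t0 - t'\<bar> \<le> _\<close> C(1) by (intro mult_left_mono power_mono) auto
          finally show ?thesis .
        qed (use C y' in \<open>auto simp: heat_E_def\<close>)
        then show "norm ((1 / norm (y - (x, t))) *\<^sub>R (heat_E x0 t0 e a T y)) \<le> C * norm (y - (x, t))"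
          using y by (simp add: field_simps power2_eq_square)
      qed auto
    qed
  qed auto
  then show ?thesis by (simp add: z)
qed

text \<open>Polynomials in x - x0 times kernels of arbitrary exponent a. This is closed under
  differentiation; powers of t0 - t are absorbed into a, and T > 0 in \<open>base\<close> makes
  every member flat at t = t0.\<close>

inductive_set heat_span :: "'a::euclidean_space \<Rightarrow> real \<Rightarrow> real \<Rightarrow> ('a \<times> real \<Rightarrow> real) set"
  for x0 t0 e where
  base: "T > 0 \<Longrightarrow> heat_E x0 t0 e a T \<in> heat_span x0 t0 e"
| inner: "f \<in> heat_span x0 t0 e \<Longrightarrow> (\<lambda>z. ((fst z - x0) \<bullet> b) * f z) \<in> heat_span x0 t0 e"
| add: "f \<in> heat_span x0 t0 e \<Longrightarrow> g \<in> heat_span x0 t0 e \<Longrightarrow> (\<lambda>z. f z + g z) \<in> heat_span x0 t0 e"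
| scale: "f \<in> heat_span x0 t0 e \<Longrightarrow> (\<lambda>z. c * f z) \<in> heat_span x0 t0 e"

lemma heat_span_sum:
  assumes "finite I" "\<And>i. i \<in> I \<Longrightarrow> f i \<in> heat_span x0 t0 e"
  shows "(\<lambda>z. \<Sum>i\<in>I. f i z) \<in> heat_span x0 t0 e"
  using assms
proof (induction I rule: finite_induct)
  case empty
  show ?case using heat_span.scale[OF heat_span.base[of 1 x0 t0 e 0], of 0] by simp
next
  case (insert i I)
  then show ?case by (simp add: heat_span.add)
qed

lemma heat_span_norm:
  assumes "f \<in> heat_span x0 t0 e"
  shows "(\<lambda>z. (norm (fst z - x0))\<^sup>2 * f z) \<in> heat_span x0 t0 e"
proof -
  have "(\<lambda>z. \<Sum>b\<in>Basis. ((fst z - x0) \<bullet> b) * (((fst z - x0) \<bullet> b) * f z)) \<in> heat_span x0 t0 e"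
    by (intro heat_span_sum heat_span.inner assms) auto
  also have "(\<lambda>z. \<Sum>b\<in>Basis. ((fst z - x0) \<bullet> b) * (((fst z - x0) \<bullet> b) * f z))
      = (\<lambda>z. (norm (fst z - x0))\<^sup>2 * f z)"
    by (simp add: fun_eq_iff power2_norm_eq_inner euclidean_inner[of "_ - x0" "_ - x0"]
        sum_distrib_right mult.assoc)
  finally show ?thesis .
qed

lemma heat_span_time:
  assumes "f \<in> heat_span x0 t0 e"
  shows "(\<lambda>z. (t0 - snd z) * f z) \<in> heat_span x0 t0 e"
  using assms
proof induction
  case (base T a)
  have "(\<lambda>z. (t0 - snd z) * heat_E x0 t0 e a T z) = heat_E x0 t0 e (a + 1) T"
    by (auto simp: fun_eq_iff heat_E_def powr_add)
  then show ?case using heat_span.base[OF base] by simp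
next
  case (inner f b)
  then show ?case using heat_span.inner[OF inner.IH, of b] by (simp add: ac_simps)
next
  case (add f g)
  then show ?case using heat_span.add[OF add.IH] by (simp add: algebra_simps)
next
  case (scale f c)
  then show ?case using heat_span.scale[OF scale.IH, of c] by (simp add: ac_simps)
qed

lemma heat_span_has_derivative:
  assumes "f \<in> heat_span x0 t0 e" "e \<ge> 0"
  shows "\<exists>F. (\<forall>z. (f has_derivative F z) (at z)) \<and> (\<forall>h. (\<lambda>z. F z h) \<in> heat_span x0 t0 e)"
  using assms(1)
proof induction
  case (base T a)
  let ?E = "\<lambda>a. heat_E x0 t0 e a T"
  let ?F = "\<lambda>z h. - ((fst z - x0) \<bullet> fst h) / 2 * ?E (a - 1) z
       - snd h * (a * ?E (a - 1) z + ((norm (fst z - x0))\<^sup>2 / 4 + T) * ?E (a - 2) z - e * ?E a z)"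
  have "(\<lambda>z. ?F z h) \<in> heat_span x0 t0 e" for h
  proof -
    have "(\<lambda>z. (- 1 / 2) * (((fst z - x0) \<bullet> fst h) * ?E (a - 1) z) +
        (- snd h) * (a * ?E (a - 1) z + ((1 / 4) * ((norm (fst z - x0))\<^sup>2 * ?E (a - 2) z) +
        (T * ?E (a - 2) z + (- e) * ?E a z)))) \<in> heat_span x0 t0 e"
      by (intro heat_span.add heat_span.scale heat_span_norm heat_span.inner heat_span.base base)
    also have "(\<lambda>z. (- 1 / 2) * (((fst z - x0) \<bullet> fst h) * ?E (a - 1) z) +
        (- snd h) * (a * ?E (a - 1) z + ((1 / 4) * ((norm (fst z - x0))\<^sup>2 * ?E (a - 2) z) +
        (T * ?E (a - 2) z + (- e) * ?E a z)))) = (\<lambda>z. ?F z h)"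
      by (simp add: fun_eq_iff field_simps)
    finally show ?thesis .
  qed
  moreover have "(?E a has_derivative ?F z) (at z)" for z
    using has_derivative_heat_E[OF base assms(2), of x0 t0 a "fst z" "snd z"] by simp
  ultimately show ?case by (intro exI[of _ ?F]) auto
next
  case (inner f b)
  then obtain F where F: "\<And>z. (f has_derivative F z) (at z)" "\<And>h. (\<lambda>z. F z h) \<in> heat_span x0 t0 e"
    by blast
  have "((\<lambda>z. ((fst z - x0) \<bullet> b) * f z) has_derivative
      (\<lambda>h. (fst h \<bullet> b) * f z + ((fst z - x0) \<bullet> b) * F z h)) (at z)" for z
    by (rule derivative_eq_intros F refl)+ (simp add: algebra_simps)
  moreover have "(\<lambda>z. (fst h \<bullet> b) * f z + ((fst z - x0) \<bullet> b) * F z h) \<in> heat_span x0 t0 e" for h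
    by (intro heat_span.add heat_span.scale heat_span.inner F inner)
  ultimately show ?case
    by (intro exI[of _ "\<lambda>z h. (fst h \<bullet> b) * f z + ((fst z - x0) \<bullet> b) * F z h"]) auto
next
  case (add f g)
  then obtain F G where F: "\<And>z. (f has_derivative F z) (at z)" "\<And>h. (\<lambda>z. F z h) \<in> heat_span x0 t0 e"
     and G: "\<And>z. (g has_derivative G z) (at z)" "\<And>h. (\<lambda>z. G z h) \<in> heat_span x0 t0 e"
    by blast
  show ?case
    using F G by (intro exI[of _ "\<lambda>z h. F z h + G z h"] conjI allI has_derivative_add heat_span.add)
next
  case (scale f c)
  then obtain F where F: "\<And>z. (f has_derivative F z) (at z)" "\<And>h. (\<lambda>z. F z h) \<in> heat_span x0 t0 e"
    by blast
  then show ?case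
    by (intro exI[of _ "\<lambda>z h. c * F z h"] conjI allI has_derivative_mult_right heat_span.scale)
qed


text \<open>The Gaussian alone controls y = |x - x0| only while r stays bounded; large r is paid for
  by the damping. One half of e * r, together with T, bounds r powr a. The other half is
  \<open>p\<close>, and \<open>q\<close> is the Gaussian exponent. Since y^2 = 4 * r * q, powers of
  1 + y are controlled by powers of 1 + p and 1 + q.\<close>

lemma heat_E_rapid_decay:
  assumes "T > 0" "e > 0"
  shows "\<exists>C. \<forall>z. (1 + norm (fst z - x0)) ^ k * heat_E x0 t0 e a T z \<le> C"
proof -
  obtain C where C: "C \<ge> 0" "\<And>q. q \<ge> 0 \<Longrightarrow> (1 + q) powr (real k) * exp (- q) \<le> C"
    using exp_neg_times_powr_bounded[of "real k"] by blast
  obtain D where D: "D \<ge> 0" "\<forall>r>0. r powr a * exp (- T / r - e / 2 * r) \<le> D"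
    using powr_exp_exp_bounded[of T "e / 2" a] assms by auto
  define c where "c = 8 * (1 + 2 / e)"
  have c: "c \<ge> 0" using assms by (simp add: c_def)
  have "(1 + norm (fst z - x0)) ^ k * heat_E x0 t0 e a T z \<le> c ^ k * C * C * D" for z
  proof (cases "snd z < t0")
    case True
    define r y where "r = t0 - snd z" and "y = norm (fst z - x0)"
    have r: "r > 0" and y: "y \<ge> 0" using True by (auto simp: r_def y_def)
    define q p where "q = y\<^sup>2 / (4 * r)" and "p = e / 2 * r"
    have q: "q \<ge> 0" and p: "p \<ge> 0" using r assms by (auto simp: q_def p_def)
    have "1 + y \<le> 8 * ((1 + r) * (1 + q))"
    proof -
      have "4 * r * q = y\<^sup>2" using r by (simp add: q_def)
      moreover have "y \<le> 1 + y\<^sup>2"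
        using zero_le_power2[of "y - 1"] y by (simp add: power2_eq_square algebra_simps)
      ultimately show ?thesis using r q y by (simp add: algebra_simps)
    qed
    also have "\<dots> \<le> 8 * ((1 + 2 / e) * (1 + p) * (1 + q))"
      using r q assms by (intro mult_left_mono mult_right_mono) (auto simp: p_def field_simps)
    finally have "(1 + y) ^ k \<le> (c * (1 + p) * (1 + q)) ^ k"
      unfolding c_def mult.assoc using y by (intro power_mono) auto
    then have 1: "(1 + y) ^ k \<le> c ^ k * (1 + p) powr k * (1 + q) powr k"
      using p q by (simp add: power_mult_distrib powr_realpow)
    have E: "heat_E x0 t0 e a T z = r powr a * exp (- T / r - e / 2 * r) * exp (- p) * exp (- q)"
      using True r by (cases z)
        (simp add: heat_E_def r_def q_def p_def y_def add_divide_distrib diff_divide_distrib flip: exp_add)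
    have "(1 + y) ^ k * heat_E x0 t0 e a T z \<le> (c ^ k * (1 + p) powr k * (1 + q) powr k) *
        (r powr a * exp (- T / r - e / 2 * r) * exp (- p) * exp (- q))"
      unfolding E using 1 by (intro mult_right_mono) auto
    also have "\<dots> = c ^ k * ((1 + p) powr k * exp (- p)) * ((1 + q) powr k * exp (- q)) *
        (r powr a * exp (- T / r - e / 2 * r))" by (simp only: mult_ac)
    also have "\<dots> \<le> c ^ k * C * C * D"
      using C(2)[OF p] C(2)[OF q] D(2) r c C(1) by (intro mult_mono) auto
    finally show ?thesis by (simp add: y_def)
  qed (use C D c in \<open>auto simp: heat_E_def split: prod.splits\<close>)
  then show ?thesis by blast
qed

text \<open>A factor (x - x0) . b costs one power of 1 + |x - x0|, hence an induction over the span
  for all k simultaneously.\<close>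

lemma heat_span_rapid_decay:
  assumes "f \<in> heat_span x0 t0 e" "e > 0"
  shows "\<exists>C. \<forall>z. (1 + norm (fst z - x0)) ^ k * \<bar>f z\<bar> \<le> C"
  using assms(1)
proof (induction arbitrary: k)
  case (base T a)
  then show ?case using heat_E_rapid_decay[OF base assms(2)] by simp
next
  case (inner f b)
  obtain C where C: "\<And>z. (1 + norm (fst z - x0)) ^ Suc k * \<bar>f z\<bar> \<le> C" using inner.IH by blast
  have "(1 + norm (fst z - x0)) ^ k * \<bar>((fst z - x0) \<bullet> b) * f z\<bar> \<le> norm b * C" for z
  proof -
    have "\<bar>(fst z - x0) \<bullet> b\<bar> \<le> norm (fst z - x0) * norm b" by (rule Cauchy_Schwarz_ineq2)
    also have "\<dots> \<le> (1 + norm (fst z - x0)) * norm b" by (intro mult_right_mono) auto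
    finally have "(1 + norm (fst z - x0)) ^ k * (\<bar>(fst z - x0) \<bullet> b\<bar> * \<bar>f z\<bar>) \<le>
        (1 + norm (fst z - x0)) ^ k * ((1 + norm (fst z - x0)) * norm b * \<bar>f z\<bar>)"
      by (intro mult_left_mono mult_right_mono) auto
    also have "\<dots> = norm b * ((1 + norm (fst z - x0)) ^ Suc k * \<bar>f z\<bar>)" by simp
    also have "\<dots> \<le> norm b * C" using C by (intro mult_left_mono) auto
    finally show ?thesis by (simp add: abs_mult)
  qed
  then show ?case by blast
next
  case (add f g)
  obtain C where C: "\<And>z. (1 + norm (fst z - x0)) ^ k * \<bar>f z\<bar> \<le> C" using add.IH by blast
  obtain D where D: "\<And>z. (1 + norm (fst z - x0)) ^ k * \<bar>g z\<bar> \<le> D" using add.IH by blast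
  have "(1 + norm (fst z - x0)) ^ k * \<bar>f z + g z\<bar> \<le> C + D" for z
  proof -
    have "(1 + norm (fst z - x0)) ^ k * \<bar>f z + g z\<bar>
        \<le> (1 + norm (fst z - x0)) ^ k * (\<bar>f z\<bar> + \<bar>g z\<bar>)"
      by (intro mult_left_mono) auto
    also have "\<dots> \<le> C + D" using C[of z] D[of z] by (simp add: distrib_left)
    finally show ?thesis .
  qed
  then show ?case by blast
next
  case (scale f c)
  obtain C where C: "\<And>z. (1 + norm (fst z - x0)) ^ k * \<bar>f z\<bar> \<le> C" using scale.IH by blast
  have "(1 + norm (fst z - x0)) ^ k * \<bar>c * f z\<bar> \<le> \<bar>c\<bar> * C" for z
    using mult_left_mono[OF C[of z], of "\<bar>c\<bar>"] by (simp add: abs_mult ac_simps)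
  then show ?case by blast
qed

text \<open>Even powers are convenient because |z|^2 is at most the polynomial w = c + 2 |x - x0|^2
  + 2 (t0 - t)^2, and multiplication by w stays in the span. One more factor |z|^2 is thus the
  previous case for another member, which is why f varies in the induction.\<close>

lemma heat_span_decay_even:
  assumes "f \<in> heat_span x0 t0 e" "e > 0"
  shows "\<exists>C. \<forall>z. ((norm z)\<^sup>2) ^ k * \<bar>f z\<bar> \<le> C"
  using assms(1)
proof (induction k arbitrary: f)
  case 0
  then show ?case using heat_span_rapid_decay[OF 0 assms(2), of 0] by simp
next
  case (Suc k)
  define c where "c = 2 * (norm x0)\<^sup>2 + 2 * t0\<^sup>2"
  let ?g = "\<lambda>z. c * f z + (2 * ((norm (fst z - x0))\<^sup>2 * f z) + 2 * ((t0 - snd z) * ((t0 - snd z) * f z)))"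
  have "?g \<in> heat_span x0 t0 e"
    by (intro heat_span.add heat_span.scale heat_span_norm heat_span_time Suc.prems)
  then obtain C where C: "\<And>z. ((norm z)\<^sup>2) ^ k * \<bar>?g z\<bar> \<le> C" using Suc.IH by blast
  have "((norm z)\<^sup>2) ^ Suc k * \<bar>f z\<bar> \<le> C" for z
  proof -
    have sq: "(a + b)\<^sup>2 \<le> 2 * a\<^sup>2 + 2 * b\<^sup>2" for a b :: real
      using zero_le_power2[of "a - b"] by (simp add: power2_eq_square algebra_simps)
    have "(norm (fst z))\<^sup>2 \<le> (norm (fst z - x0) + norm x0)\<^sup>2"
      using norm_triangle_ineq[of "fst z - x0" x0] by (intro power_mono) auto
    also have "\<dots> \<le> 2 * (norm (fst z - x0))\<^sup>2 + 2 * (norm x0)\<^sup>2" by (rule sq)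
    finally have 1: "(norm (fst z))\<^sup>2 \<le> 2 * (norm (fst z - x0))\<^sup>2 + 2 * (norm x0)\<^sup>2" .
    have 2: "(snd z)\<^sup>2 \<le> 2 * (t0 - snd z)\<^sup>2 + 2 * t0\<^sup>2"
      using sq[of "snd z - t0" t0] by (simp add: power2_commute)
    have 3: "(norm z)\<^sup>2 = (norm (fst z))\<^sup>2 + (snd z)\<^sup>2"
      by (simp add: norm_prod_def)
    define w where "w = c + 2 * (norm (fst z - x0))\<^sup>2 + 2 * (t0 - snd z)\<^sup>2"
    have w: "w \<ge> 0" "(norm z)\<^sup>2 \<le> w" using 1 2 3 by (auto simp: w_def c_def)
    have g: "?g z = w * f z" by (simp add: w_def algebra_simps power2_eq_square)
    have "((norm z)\<^sup>2) ^ Suc k * \<bar>f z\<bar> = ((norm z)\<^sup>2) ^ k * ((norm z)\<^sup>2 * \<bar>f z\<bar>)" by simp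
    also have "\<dots> \<le> ((norm z)\<^sup>2) ^ k * (w * \<bar>f z\<bar>)" using w by (intro mult_left_mono mult_right_mono) auto
    also have "\<dots> \<le> C" using C[of z] w unfolding g by (simp add: abs_mult)
    finally show ?thesis .
  qed
  then show ?case by blast
qed

lemma heat_span_decay:
  assumes "f \<in> heat_span x0 t0 e" "e > 0"
  shows "\<exists>C. \<forall>z. norm z ^ k * \<bar>f z\<bar> \<le> C"
proof -
  obtain C where C: "\<And>z. ((norm z)\<^sup>2) ^ k * \<bar>f z\<bar> \<le> C" using heat_span_decay_even[OF assms] by blast
  obtain D where D: "\<And>z. ((norm z)\<^sup>2) ^ 0 * \<bar>f z\<bar> \<le> D" using heat_span_decay_even[OF assms] by blast
  have "norm z ^ k * \<bar>f z\<bar> \<le> C + D" for z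
  proof -
    have "norm z ^ k \<le> ((norm z)\<^sup>2) ^ k + 1"
    proof (cases "norm z \<le> 1")
      case True
      then have "norm z ^ k \<le> 1" by (simp add: power_le_one)
      then show ?thesis by (simp add: add_increasing)
    next
      case False
      then have "norm z ^ k \<le> ((norm z)\<^sup>2) ^ k"
        by (intro power_mono) (auto simp: power2_eq_square mult_le_cancel_left1)
      then show ?thesis by simp
    qed
    then have "norm z ^ k * \<bar>f z\<bar> \<le> (((norm z)\<^sup>2) ^ k + 1) * \<bar>f z\<bar>" by (intro mult_right_mono) auto
    also have "\<dots> \<le> C + D" using C[of z] D[of z] by (simp add: distrib_right)
    finally show ?thesis .
  qed
  then show ?thesis by blast
qed

lemma iter_partial_heat_span:
  fixes f :: "'a::euclidean_space \<times> real \<Rightarrow> real"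
  assumes "f \<in> heat_span x0 t0 e" "e \<ge> 0"
  shows "\<exists>g\<in>heat_span x0 t0 e. iter_partial bs (\<lambda>z. complex_of_real (f z)) = (\<lambda>z. complex_of_real (g z))"
proof (induction bs)
  case Nil
  then show ?case using assms by auto
next
  case (Cons b bs)
  then obtain g where g: "g \<in> heat_span x0 t0 e"
    "iter_partial bs (\<lambda>z. complex_of_real (f z)) = (\<lambda>z. complex_of_real (g z))" by blast
  obtain F where F: "\<And>z. (g has_derivative F z) (at z)" "\<And>h. (\<lambda>z. F z h) \<in> heat_span x0 t0 e"
    using heat_span_has_derivative[OF g(1) assms(2)] by blast
  have "((\<lambda>z. complex_of_real (g z)) has_derivative (\<lambda>h. complex_of_real (F z h))) (at z)" for z
    using bounded_linear.has_derivative[OF bounded_linear_of_real F(1)] .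
  then have "frechet_derivative (\<lambda>z. complex_of_real (g z)) (at z) = (\<lambda>h. complex_of_real (F z h))" for z
    using frechet_derivative_at by metis
  then show ?case using F(2)[of b] g(2) by auto
qed

lemma heat_span_schwartz:
  fixes f :: "'a::euclidean_space \<times> real \<Rightarrow> real"
  assumes "f \<in> heat_span x0 t0 e" "e > 0"
  shows "(\<lambda>z. complex_of_real (f z)) \<in> schwartz"
  unfolding schwartz_def
proof (intro CollectI allI impI)
  fix bs :: "('a \<times> real) list"
  obtain g where g: "g \<in> heat_span x0 t0 e"
    "iter_partial bs (\<lambda>z. complex_of_real (f z)) = (\<lambda>z. complex_of_real (g z))"
    using iter_partial_heat_span[OF assms(1)] assms(2) by (meson less_imp_le)
  obtain F where F: "\<And>z. (g has_derivative F z) (at z)"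
    using heat_span_has_derivative[OF g(1)] assms(2) by force
  have "(\<lambda>z. complex_of_real (g z)) differentiable (at z)" for z
    using bounded_linear.has_derivative[OF bounded_linear_of_real F(1)]
    unfolding differentiable_def by blast
  moreover have "\<exists>C. \<forall>z. norm z ^ k * norm (complex_of_real (g z)) \<le> C" for k
    using heat_span_decay[OF g(1) assms(2), of k] by simp
  ultimately show "(\<forall>z. iter_partial bs (\<lambda>z. complex_of_real (f z)) differentiable (at z)) \<and>
     (\<forall>k. \<exists>C. \<forall>z. norm z ^ k * norm (iter_partial bs (\<lambda>z. complex_of_real (f z)) z) \<le> C)"
    unfolding g(2) by blast
qed

section \<open>Gaussian integrals and the action of the fractional heat operator\<close>


text \<open>Classically pi^(n/2); carried along symbolically as a positive factor.\<close>

definition gauss_mass :: "'a::euclidean_space itself \<Rightarrow> real" where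
  "gauss_mass _ = (LINT y::'a|lborel. exp (- (norm y)\<^sup>2))"

text \<open>The Gaussian is a product over the coordinates, and in one dimension it lies below 1 /
  (1 + x^2).\<close>

lemma integrable_exp_neg_norm_square:
  "integrable lborel (\<lambda>y::'a::euclidean_space. exp (- (norm y)\<^sup>2))"
proof (rule integrableI_nonneg)
  have "integrable lborel (\<lambda>x::real. inverse (1 + x\<^sup>2))"
    using integrable_inverse_1_plus_square by (simp add: set_integrable_def einterval_def)
  then have 1: "integrable lborel (\<lambda>x::real. exp (- x\<^sup>2))"
  proof (rule Bochner_Integration.integrable_bound)
    show "AE x::real in lborel. norm (exp (- x\<^sup>2)) \<le> norm (inverse (1 + x\<^sup>2))"
    proof (rule AE_I2)
      fix x :: real
      have "1 + x\<^sup>2 \<le> exp (x\<^sup>2)" by (rule exp_ge_add_one_self)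
      moreover have "0 < 1 + x\<^sup>2" by (simp add: add_pos_nonneg)
      ultimately show "norm (exp (- x\<^sup>2)) \<le> norm (inverse (1 + x\<^sup>2))"
        by (simp add: exp_minus le_imp_inverse_le)
    qed
  qed auto
  have "(norm y)\<^sup>2 = (\<Sum>b\<in>Basis. (y \<bullet> b)\<^sup>2)" for y :: 'a
    unfolding power2_norm_eq_inner by (subst euclidean_inner) (simp add: power2_eq_square)
  then have eq: "exp (- (norm y)\<^sup>2) = (\<Prod>b\<in>Basis. exp (- (y \<bullet> b)\<^sup>2))" for y :: 'a
    by (simp add: sum_negf flip: exp_sum)
  have "(\<integral>\<^sup>+y. ennreal (exp (- (norm (y::'a))\<^sup>2)) \<partial>lborel)
      = (\<integral>\<^sup>+y. (\<Prod>b\<in>Basis. ennreal (exp (- ((y::'a) \<bullet> b)\<^sup>2))) \<partial>lborel)"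
    by (simp add: eq prod_ennreal)
  also have "\<dots> = (\<Prod>b\<in>(Basis::'a set). (\<integral>\<^sup>+x. ennreal (exp (- x\<^sup>2)) \<partial>lborel))"
    by (rule nn_integral_lborel_prod) auto
  also have "\<dots> < \<infinity>"
    using 1 by (simp add: less_top[symmetric] ennreal_prod_eq_top integrable_iff_bounded power_eq_top_ennreal)
  finally show "(\<integral>\<^sup>+y. ennreal (exp (- (norm (y::'a))\<^sup>2)) \<partial>lborel) < \<infinity>" .
qed auto

lemma gauss_mass_pos: "gauss_mass TYPE('a::euclidean_space) > 0"
proof -
  have "gauss_mass TYPE('a) \<ge> 0" by (simp add: gauss_mass_def)
  moreover have "gauss_mass TYPE('a) \<noteq> 0"
  proof
    assume "gauss_mass TYPE('a) = 0"
    then have "AE y::'a in lborel. exp (- (norm y)\<^sup>2) = 0"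
      unfolding gauss_mass_def
      using integral_nonneg_eq_0_iff_AE[OF integrable_exp_neg_norm_square[where 'a='a]] by simp
    then have "AE y::'a in lborel. False" by simp
    then show False by (simp add: AE_iff_null null_sets_def)
  qed
  ultimately show ?thesis by linarith
qed

lemma
  fixes f :: "'a::euclidean_space \<Rightarrow> real" and c :: real
  assumes "integrable lborel f" "c \<noteq> 0"
  shows integrable_lborel_affine: "integrable lborel (\<lambda>y. f (t + c *\<^sub>R y))"
    and integral_lborel_affine: "(LINT y|lborel. f y) = \<bar>c\<bar> ^ DIM('a) * (LINT y|lborel. f (t + c *\<^sub>R y))"
proof -
  have [measurable]: "f \<in> borel_measurable borel" using assms(1) by auto
  have "integrable (density (distr lborel borel (\<lambda>x. t + c *\<^sub>R x)) (\<lambda>_. ennreal (\<bar>c\<bar> ^ DIM('a)))) f"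
    using assms lborel_affine[OF assms(2), of t] by (simp add: ennreal_power)
  then have "integrable lborel (\<lambda>y. \<bar>c\<bar> ^ DIM('a) * f (t + c *\<^sub>R y))"
    by (simp add: integrable_density integrable_distr_eq)
  then show "integrable lborel (\<lambda>y. f (t + c *\<^sub>R y))" using assms(2) by simp
  have "(LINT y|lborel. f y) =
      (LINT y|density (distr lborel borel (\<lambda>x. t + c *\<^sub>R x)) (\<lambda>_. ennreal (\<bar>c\<bar> ^ DIM('a))). f y)"
    using lborel_affine[OF assms(2), of t] by (simp add: ennreal_power)
  also have "\<dots> = \<bar>c\<bar> ^ DIM('a) * (LINT y|lborel. f (t + c *\<^sub>R y))"
    by (simp add: integral_density integral_distr)
  finally show "(LINT y|lborel. f y) = \<bar>c\<bar> ^ DIM('a) * (LINT y|lborel. f (t + c *\<^sub>R y))" .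
qed

lemma
  fixes m :: "'a::euclidean_space"
  assumes "c > 0"
  shows integrable_gaussian: "integrable lborel (\<lambda>y. exp (- ((norm (y - m))\<^sup>2 / c)))"
    and integral_gaussian:
      "(LINT y|lborel. exp (- ((norm (y - m))\<^sup>2 / c))) = sqrt c ^ DIM('a) * gauss_mass TYPE('a)"
proof -
  define k where "k = 1 / sqrt c"
  have k: "k \<noteq> 0" using assms by (simp add: k_def)
  have *: "exp (- (norm (- k *\<^sub>R m + k *\<^sub>R y))\<^sup>2) = exp (- ((norm (y - m))\<^sup>2 / c))" for y :: 'a
  proof -
    have "- k *\<^sub>R m + k *\<^sub>R y = k *\<^sub>R (y - m)" by (simp add: algebra_simps)
    then show ?thesis using assms by (simp add: k_def power_mult_distrib power_divide)
  qed
  show "integrable lborel (\<lambda>y. exp (- ((norm (y - m))\<^sup>2 / c)))"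
    using integrable_lborel_affine[OF integrable_exp_neg_norm_square k, of "- k *\<^sub>R m"] unfolding * .
  have "gauss_mass TYPE('a) = \<bar>k\<bar> ^ DIM('a) * (LINT y|lborel. exp (- ((norm (y - m))\<^sup>2 / c)))"
    unfolding gauss_mass_def
    using integral_lborel_affine[OF integrable_exp_neg_norm_square k, of "- k *\<^sub>R m"] unfolding * .
  then show "(LINT y|lborel. exp (- ((norm (y - m))\<^sup>2 / c))) = sqrt c ^ DIM('a) * gauss_mass TYPE('a)"
    using assms by (simp add: k_def field_simps power_divide)
qed

text \<open>The exponent identity behind the semigroup property. Here a and e are the times of two
  heat kernels: their product, as a function of y, is a Gaussian of time a * e / (a + e) centred on
  the segment from x0 to x, times a Gaussian of time a + e in x - x0.\<close>

lemma complete_square_gaussian: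
  fixes x x0 y :: "'a::real_inner"
  assumes "a > 0" "e > 0"
  shows "(norm (y - x0))\<^sup>2 / (4 * a) + (norm (x - y))\<^sup>2 / (4 * e) =
    (norm (y - (x0 + (a / (a + e)) *\<^sub>R (x - x0))))\<^sup>2 / (4 * a * e / (a + e))
    + (norm (x - x0))\<^sup>2 / (4 * (a + e))"
proof -
  define u w where "u = y - x0" and "w = x - x0"
  define A B C where "A = u \<bullet> u" and "B = u \<bullet> w" and "C = w \<bullet> w"
  define r where "r = a + e"
  have r: "r > 0" using assms by (simp add: r_def)
  have 1: "(norm (x - y))\<^sup>2 = A - 2 * B + C"
  proof -
    have "x - y = w - u" by (simp add: u_def w_def)
    then show ?thesis
      by (simp add: A_def B_def C_def power2_norm_eq_inner inner_diff_left inner_diff_right inner_commute)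
  qed
  have 2: "(norm (y - (x0 + (a / r) *\<^sub>R (x - x0))))\<^sup>2 = A - 2 * (a / r) * B + (a / r)\<^sup>2 * C"
  proof -
    have "y - (x0 + (a / r) *\<^sub>R (x - x0)) = u - (a / r) *\<^sub>R w" by (simp add: u_def w_def)
    then have "(norm (y - (x0 + (a / r) *\<^sub>R (x - x0))))\<^sup>2
        = (u - (a / r) *\<^sub>R w) \<bullet> (u - (a / r) *\<^sub>R w)"
      by (simp only: power2_norm_eq_inner)
    also have "\<dots> = A - 2 * (a / r) * B + (a / r)\<^sup>2 * C"
      by (simp add: A_def B_def C_def inner_diff_left inner_diff_right inner_commute power2_eq_square)
    finally show ?thesis .
  qed
  have 3: "(norm (y - x0))\<^sup>2 = A" "(norm (x - x0))\<^sup>2 = C"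
    by (simp_all add: A_def C_def u_def w_def power2_norm_eq_inner)
  have "A / (4 * a) + (A - 2 * B + C) / (4 * e) =
     (A - 2 * (a / r) * B + (a / r)\<^sup>2 * C) / (4 * a * e / r) + C / (4 * r)"
  proof -
    have s: "e = r - a" "r - a \<noteq> 0" using assms by (simp_all add: r_def)
    show ?thesis using assms(1) r s(2) unfolding s(1)
      by (simp add: divide_simps power2_eq_square) (simp add: algebra_simps)
  qed
  then show ?thesis unfolding r_def[symmetric] 1 2 3 .
qed

lemma
  fixes x x0 :: "'a::euclidean_space"
  assumes "a > 0" "e > 0"
  shows integrable_gaussian_convolution: "integrable lborel
      (\<lambda>y. exp (- ((norm (y - x0))\<^sup>2 / (4 * a))) * exp (- ((norm (x - y))\<^sup>2 / (4 * e))))"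
    and integral_gaussian_convolution: "(LINT y|lborel.
        exp (- ((norm (y - x0))\<^sup>2 / (4 * a))) * exp (- ((norm (x - y))\<^sup>2 / (4 * e))))
      = sqrt (4 * a * e / (a + e)) ^ DIM('a) * gauss_mass TYPE('a)
        * exp (- ((norm (x - x0))\<^sup>2 / (4 * (a + e))))"
proof -
  have *: "exp (- ((norm (y - x0))\<^sup>2 / (4 * a))) * exp (- ((norm (x - y))\<^sup>2 / (4 * e))) =
      exp (- ((norm (y - (x0 + (a / (a + e)) *\<^sub>R (x - x0))))\<^sup>2 / (4 * a * e / (a + e))))
      * exp (- ((norm (x - x0))\<^sup>2 / (4 * (a + e))))" for y
    using complete_square_gaussian[OF assms, of y x0 x] by (simp only: mult_exp_exp) simp
  have c: "4 * a * e / (a + e) > 0" using assms by simp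
  show "integrable lborel
      (\<lambda>y. exp (- ((norm (y - x0))\<^sup>2 / (4 * a))) * exp (- ((norm (x - y))\<^sup>2 / (4 * e))))"
    unfolding * by (intro integrable_mult_left integrable_gaussian[OF c])
  show "(LINT y|lborel.
        exp (- ((norm (y - x0))\<^sup>2 / (4 * a))) * exp (- ((norm (x - y))\<^sup>2 / (4 * e))))
      = sqrt (4 * a * e / (a + e)) ^ DIM('a) * gauss_mass TYPE('a)
        * exp (- ((norm (x - x0))\<^sup>2 / (4 * (a + e))))"
    unfolding * integral_mult_left_zero integral_gaussian[OF c] ..
qed

text \<open>Dominated convergence: the removed balls shrink to a single point. For each fixed later
  time the inner integrands met below are absolutely integrable, so the principal value
  disappears.\<close>

lemma pv_integral_eq:
  fixes f :: "'a::euclidean_space \<Rightarrow> complex"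
  assumes f: "integrable lborel f"
  shows "pv_integral x f = (LINT y|lborel. f y)"
  unfolding pv_integral_def
proof (rule tendsto_Lim)
  have [measurable]: "f \<in> borel_measurable borel" using f by auto
  show "((\<lambda>\<epsilon>. LINT y:- ball x \<epsilon>|lborel. f y) \<longlongrightarrow> (LINT y|lborel. f y)) (at_right 0)"
    unfolding tendsto_at_iff_sequentially
  proof (intro allI impI)
    fix X :: "nat \<Rightarrow> real" assume X: "\<forall>i. X i \<in> {0<..} - {0}" "X \<longlonglongrightarrow> 0"
    have "(\<lambda>i. LINT y|lborel. indicator (- ball x (X i)) y *\<^sub>R f y) \<longlonglongrightarrow> (LINT y|lborel. f y)"
    proof (rule integral_dominated_convergence[where w = "\<lambda>y. norm (f y)"])
      show "AE y in lborel. (\<lambda>i. indicator (- ball x (X i)) y *\<^sub>R f y) \<longlonglongrightarrow> f y"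
      proof (rule AE_mp[OF AE_lborel_singleton[of x]], rule AE_I2, rule impI)
        fix y assume "y \<noteq> x"
        then have "\<forall>\<^sub>F i in sequentially. X i < dist x y"
          using order_tendstoD(2)[OF X(2), of "dist x y"] by (simp add: dist_commute)
        then have "\<forall>\<^sub>F i in sequentially. indicator (- ball x (X i)) y *\<^sub>R f y = f y"
          by eventually_elim auto
        then show "(\<lambda>i. indicator (- ball x (X i)) y *\<^sub>R f y) \<longlonglongrightarrow> f y"
          by (rule tendsto_eventually)
      qed
      show "AE y in lborel. norm (indicator (- ball x (X i)) y *\<^sub>R f y) \<le> norm (f y)" for i
        by (intro AE_I2) (auto simp: indicator_def)
    qed (use f in auto)
    then show "((\<lambda>\<epsilon>. LINT y:- ball x \<epsilon>|lborel. f y) \<circ> X) \<longlonglongrightarrow> (LINT y|lborel. f y)"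
      by (simp add: o_def set_lebesgue_integral_def)
  qed
qed simp


section \<open>The operator on a heat kernel times a function of time\<close>

lemma sqrt_power_eq_powr: "q > 0 \<Longrightarrow> sqrt q ^ n = q powr (real n / 2)"
  by (simp add: powr_half_sqrt[symmetric] powr_realpow[symmetric] powr_powr)

text \<open>The heat kernel without its factor (4 pi)^(-n/2). Values at r <= 0 carry no meaning;
  below they meet a zero factor or are excluded by a case distinction.\<close>

definition heat_profile :: "'a::euclidean_space \<Rightarrow> real \<Rightarrow> 'a \<Rightarrow> real" where
  "heat_profile x0 r x = r powr (- (real DIM('a) / 2)) * exp (- ((norm (x - x0))\<^sup>2 / (4 * r)))"

text \<open>At time lag b the Gaussian of the operator has time b and the test function has time r -
  b, so by the semigroup property the y-integral is a multiple of the profile at the total time r,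
  whatever b is. This factor leaves the integral over b. The Gaussian mass contributes b powr d and
  reduces the singularity b powr (d + 1 + s) to b powr (1 + s); what remains is a one-dimensional
  Marchaud derivative of A.\<close>

lemma frac_heat_right_gaussian:
  fixes x x0 :: "real ^ 'n::finite" and A :: "real \<Rightarrow> real" and s t0 :: real
  assumes A: "\<And>r. r \<le> 0 \<Longrightarrow> A r = 0"
  defines "f \<equiv> \<lambda>(x, t). heat_profile x0 (t0 - t) x * A (t0 - t)"
  shows "frac_heat_right s (\<lambda>z. complex_of_real (f z)) (x, t) = complex_of_real
     (frac_heat_const CARD('n) s * 2 ^ CARD('n) * gauss_mass TYPE(real ^ 'n) * heat_profile x0 (t0 - t) x *
      (LINT b:{0<..}|lborel. (A (t0 - t) - A (t0 - t - b)) / b powr (1 + s)))"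
proof -
  define d where "d = real CARD('n) / 2"
  define Z where "Z = gauss_mass TYPE(real ^ 'n)"
  define r where "r = t0 - t"
  define G where "G = heat_profile x0 r x"
  have sq: "sqrt q ^ DIM(real ^ 'n) = q powr d" if "q > 0" for q
    using sqrt_power_eq_powr[OF that, of "CARD('n)"] by (simp add: d_def)
  have two: "4 powr d = (2::real) ^ CARD('n)"
    using sqrt_power_eq_powr[of 4 "CARD('n)"] by (simp add: d_def)
  have inner: "pv_integral x (\<lambda>y. (complex_of_real (f (x, t)) - complex_of_real (f (y, w))) /
          complex_of_real ((w - t) powr (d + 1 + s)) *
          complex_of_real (exp (- (norm (x - y))\<^sup>2 / (4 * (w - t))))) =
      complex_of_real (2 ^ CARD('n) * Z * G * ((A r - A (r - (w - t))) / (w - t) powr (1 + s)))"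
    (is "pv_integral x ?h = _") if w: "w > t" for w
  proof -
    define b where "b = w - t"
    define a where "a = r - b"
    define S where "S = b powr (d + 1 + s)"
    define h where "h = (\<lambda>y. (f (x, t) - f (y, w)) / S * exp (- ((norm (x - y))\<^sup>2 / (4 * b))))"
    have b: "b > 0" using w by (simp add: b_def)
    have S: "b powr d / S = 1 / b powr (1 + s)" using b by (simp add: S_def powr_add)
    have f1: "f (x, t) = G * A r" by (simp add: f_def G_def r_def)
    have h: "?h = (\<lambda>y. complex_of_real (h y))" by (simp add: h_def S_def b_def fun_eq_iff)
    have i1: "integrable lborel (\<lambda>y. exp (- ((norm (x - y))\<^sup>2 / (4 * b))))"
      and I1: "(LINT y|lborel. exp (- ((norm (x - y))\<^sup>2 / (4 * b)))) = 4 powr d * b powr d * Z"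
      using integrable_gaussian[of "4 * b" x] integral_gaussian[of "4 * b" x] b sq[of "4 * b"]
      by (auto simp: norm_minus_commute Z_def powr_mult)
    have "integrable lborel h \<and>
      (LINT y|lborel. h y) = 4 powr d * Z * G * ((A r - A a) / b powr (1 + s))"
    proof (cases "a > 0")
      case True
      have r: "a + b = r" "r > 0" using True b by (auto simp: a_def)
      have f2: "f (y, w) = a powr (- d) * A a * exp (- ((norm (y - x0))\<^sup>2 / (4 * a)))" for y
        by (simp add: f_def a_def r_def b_def d_def heat_profile_def)
      have h_eq: "h = (\<lambda>y. (G * A r / S) * exp (- ((norm (x - y))\<^sup>2 / (4 * b))) -
          (a powr (- d) * A a / S) * (exp (- ((norm (y - x0))\<^sup>2 / (4 * a))) *
             exp (- ((norm (x - y))\<^sup>2 / (4 * b)))))"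
        by (simp add: h_def f1 f2 fun_eq_iff diff_divide_distrib left_diff_distrib)
      have i2: "integrable lborel (\<lambda>y. exp (- ((norm (y - x0))\<^sup>2 / (4 * a))) *
             exp (- ((norm (x - y))\<^sup>2 / (4 * b))))"
        by (rule integrable_gaussian_convolution[OF True b])
      \<comment> \<open>The Gaussian of time a * b / r has mass (4 * a * b / r) powr d * Z; its
        factor r powr (- d) completes the exponential in x - x0 to the profile
        \<open>G\<close>.\<close>
      have I2: "(LINT y|lborel. exp (- ((norm (y - x0))\<^sup>2 / (4 * a))) *
             exp (- ((norm (x - y))\<^sup>2 / (4 * b)))) = 4 powr d * a powr d * b powr d * Z * G"
      proof -
        have "4 * a * b / r > 0" using True b r by simp
        note sq[OF this]
        also have "(4 * a * b / r) powr d = 4 powr d * a powr d * b powr d * r powr (- d)"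
          using True b r by (simp add: powr_mult powr_divide powr_minus_divide)
        finally show ?thesis
          using integral_gaussian_convolution[OF True b, of x0 x] unfolding r(1) Z_def G_def
          by (simp add: heat_profile_def d_def)
      qed
      have "integrable lborel h"
        unfolding h_eq using i1 i2 by (intro Bochner_Integration.integrable_diff integrable_mult_right)
      moreover have "(LINT y|lborel. h y) = (G * A r / S) * (4 powr d * b powr d * Z) -
          (a powr (- d) * A a / S) * (4 powr d * a powr d * b powr d * Z * G)"
        unfolding h_eq
        by (subst Bochner_Integration.integral_diff)
           (use i1 i2 I1 I2 in \<open>auto intro!: integrable_mult_right\<close>)
      moreover have "\<dots> = 4 powr d * Z * G * ((A r - A a) * (b powr d / S))"
        using True b by (simp add: S_def powr_minus field_simps)
      ultimately show ?thesis unfolding S by simp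
    next
      case False
      \<comment> \<open>The point (y, w) now lies at or after t0, where f vanishes; the same formula
        holds with A a = 0.\<close>
      then have Aa: "A a = 0" using A by simp
      have f2: "f (y, w) = 0" for y
        using Aa by (simp add: f_def a_def r_def b_def)
      have h_eq: "h = (\<lambda>y. (G * A r / S) * exp (- ((norm (x - y))\<^sup>2 / (4 * b))))"
        by (simp add: h_def f1 f2 fun_eq_iff)
      have "(LINT y|lborel. h y) = (G * A r / S) * (4 powr d * b powr d * Z)"
        unfolding h_eq by (simp add: I1)
      moreover have "\<dots> = 4 powr d * Z * G * (A r * (b powr d / S))" by simp
      moreover have "integrable lborel h" unfolding h_eq by (intro integrable_mult_right i1)
      ultimately show ?thesis unfolding S Aa by simp
    qed
    then show ?thesis unfolding h
      by (subst pv_integral_eq) (auto simp: two a_def b_def)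
  qed
  have "(LINT w:{t<..}|lborel. pv_integral x (\<lambda>y. (complex_of_real (f (x, t)) - complex_of_real (f (y, w))) /
          complex_of_real ((w - t) powr (d + 1 + s)) *
          complex_of_real (exp (- (norm (x - y))\<^sup>2 / (4 * (w - t)))))) =
     (LINT w:{t<..}|lborel. complex_of_real
       (2 ^ CARD('n) * Z * G * ((A r - A (r - (w - t))) / (w - t) powr (1 + s))))"
    by (intro set_lebesgue_integral_cong allI impI inner) auto
  also have "\<dots> = (LINT w|lborel. complex_of_real
      (2 ^ CARD('n) * Z * G * (indicator {t<..} w * ((A r - A (r - (w - t))) / (w - t) powr (1 + s)))))"
    unfolding set_lebesgue_integral_def
    by (intro Bochner_Integration.integral_cong) (auto simp: indicator_def)
  also have "\<dots> = complex_of_real (2 ^ CARD('n) * Z * G *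
      (LINT w|lborel. indicator {t<..} w * ((A r - A (r - (w - t))) / (w - t) powr (1 + s))))"
    unfolding integral_complex_of_real integral_mult_right_zero ..
  also have "(LINT w|lborel. indicator {t<..} w * ((A r - A (r - (w - t))) / (w - t) powr (1 + s))) =
      (LINT b|lborel. indicator {t<..} (t + b) * ((A r - A (r - b)) / b powr (1 + s)))"
    by (subst lborel_integral_real_affine[of 1 _ t]) auto
  also have "\<dots> = (LINT b:{0<..}|lborel. (A r - A (r - b)) / b powr (1 + s))"
    unfolding set_lebesgue_integral_def
    by (intro Bochner_Integration.integral_cong) (auto simp: indicator_def)
  finally show ?thesis
    unfolding frac_heat_right_def prod.case d_def[symmetric] Z_def[symmetric] r_def[symmetric]
      G_def[symmetric]
    by (simp only: of_real_mult mult.assoc)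
qed

section \<open>The Marchaud derivative of the Levy density\<close>


lemma absolutely_integrable_on_iff_set_integrable_lborel:
  fixes f :: "'a::euclidean_space \<Rightarrow> real"
  assumes [measurable]: "f \<in> borel_measurable borel" "S \<in> sets borel"
  shows "f absolutely_integrable_on S \<longleftrightarrow> set_integrable lborel S f"
  by (simp add: set_integrable_def integrable_completion)

lemma
  fixes a c :: real
  assumes "a > - 1" "c \<ge> 0"
  shows set_integrable_powr_from_0: "set_integrable lborel {0..c} (\<lambda>x. x powr a)"
    and LBINT_powr_from_0: "(LINT x:{0..c}|lborel. x powr a) = c powr (a + 1) / (a + 1)"
proof -
  have h: "((\<lambda>x. x powr a) has_integral (c powr (a + 1) / (a + 1))) {0..c}"
    using assms by (rule has_integral_powr_from_0)
  then have "(\<lambda>x. x powr a) absolutely_integrable_on {0..c}"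
    by (intro nonnegative_absolutely_integrable_1) (auto simp: integrable_on_def)
  then show i: "set_integrable lborel {0..c} (\<lambda>x. x powr a)"
    by (subst (asm) absolutely_integrable_on_iff_set_integrable_lborel) auto
  show "(LINT x:{0..c}|lborel. x powr a) = c powr (a + 1) / (a + 1)"
    using set_borel_integral_eq_integral(2)[OF i] integral_unique[OF h] by simp
qed

lemma
  fixes a e :: real
  assumes "e < - 1" "a > 0"
  shows set_integrable_powr_to_inf: "set_integrable lborel {a..} (\<lambda>x. x powr e)"
    and LBINT_powr_to_inf: "(LINT x:{a..}|lborel. x powr e) = - (a powr (e + 1)) / (e + 1)"
proof -
  have h: "((\<lambda>x. x powr e) has_integral (- (a powr (e + 1)) / (e + 1))) {a..}"
    using assms by (rule has_integral_powr_to_inf)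
  then have "(\<lambda>x. x powr e) absolutely_integrable_on {a..}"
    by (intro nonnegative_absolutely_integrable_1) (auto simp: integrable_on_def)
  then show i: "set_integrable lborel {a..} (\<lambda>x. x powr e)"
    by (subst (asm) absolutely_integrable_on_iff_set_integrable_lborel) auto
  show "(LINT x:{a..}|lborel. x powr e) = - (a powr (e + 1)) / (e + 1)"
    using set_borel_integral_eq_integral(2)[OF i] integral_unique[OF h] by simp
qed

text \<open>Equal to Gamma (1 - s) / s = |Gamma (- s)|, the usual normalisation of the Marchaud
  derivative.\<close>

definition levy_const :: "real \<Rightarrow> real" where
  "levy_const s = (LINT w:{0<..}|lborel. (1 - exp (- w)) / w powr (1 + s))"

lemma set_integrable_levy:
  assumes "0 < s" "s < 1"
  shows "set_integrable lborel {0<..} (\<lambda>w::real. (1 - exp (- w)) / w powr (1 + s))"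
  unfolding set_integrable_def
proof (rule Bochner_Integration.integrable_bound)
  show "integrable lborel (\<lambda>w. indicator {0..1} w *\<^sub>R (w powr (- s)) +
      indicator {1..} w *\<^sub>R (w powr (- 1 - s)))"
    using set_integrable_powr_from_0[of "- s" 1] set_integrable_powr_to_inf[of "- 1 - s" 1] assms
    unfolding set_integrable_def by (intro Bochner_Integration.integrable_add) auto
  show "AE w in lborel. norm (indicator {0<..} w *\<^sub>R ((1 - exp (- w)) / w powr (1 + s)))
     \<le> norm (indicator {0..1} w *\<^sub>R (w powr (- s)) + indicator {1..} w *\<^sub>R (w powr (- 1 - s)))"
  proof (rule AE_I2)
    fix w :: real
    show "norm (indicator {0<..} w *\<^sub>R ((1 - exp (- w)) / w powr (1 + s)))
     \<le> norm (indicator {0..1} w *\<^sub>R (w powr (- s)) + indicator {1..} w *\<^sub>R (w powr (- 1 - s)))"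
    proof (cases "w > 0")
      case w: True
      have e: "0 \<le> 1 - exp (- w)" "1 - exp (- w) \<le> 1" "1 - exp (- w) \<le> w"
        using w exp_ge_add_one_self[of "- w"] by auto
      show ?thesis
      proof (cases "w \<le> 1")
        case True
        have "(1 - exp (- w)) / w powr (1 + s) \<le> w / w powr (1 + s)"
          using e w by (intro divide_right_mono) auto
        also have "\<dots> = w powr (- s)" using w by (simp add: powr_add powr_minus field_simps)
        finally have "(1 - exp (- w)) / w powr (1 + s) \<le> w powr (- s)" .
        \<comment> \<open>At w = 1 both indicators on the right are 1, and the claim becomes 1 - exp
          (- 1) <= 2.\<close>
        moreover have "- 1 \<le> exp (- 1 :: real)" by (rule order_trans[of _ 0]) auto
        ultimately show ?thesis using w e True by (simp add: indicator_def)
      next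
        case False
        have "(1 - exp (- w)) / w powr (1 + s) \<le> 1 / w powr (1 + s)"
          using e w by (intro divide_right_mono) auto
        also have "\<dots> = w powr (- 1 - s)"
          using w powr_minus_divide[of w "1 + s"] by simp
        finally show ?thesis using w e False by (simp add: indicator_def)
      qed
    qed auto
  qed
qed auto

lemma levy_const_pos:
  assumes "0 < s" "s < 1"
  shows "levy_const s > 0"
proof -
  let ?f = "\<lambda>w::real. indicator {0<..} w *\<^sub>R ((1 - exp (- w)) / w powr (1 + s))"
  have nn: "?f w \<ge> 0" for w by (auto simp: indicator_def)
  then have "levy_const s \<ge> 0"
    by (simp add: levy_const_def set_lebesgue_integral_def del: scaleR_conv_of_real real_scaleR_def)
  moreover have "levy_const s \<noteq> 0"
  proof
    assume "levy_const s = 0"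
    then have "AE w in lborel. ?f w = 0"
      using integral_nonneg_eq_0_iff_AE[OF set_integrable_levy[OF assms, unfolded set_integrable_def]] nn
      unfolding levy_const_def set_lebesgue_integral_def by blast
    then have "AE w in lborel. w \<notin> {0<..<1::real}"
      by eventually_elim (auto simp: indicator_def split: if_splits)
    then have "{0<..<1::real} \<in> null_sets lborel"
      by (subst (asm) AE_iff_null_sets[symmetric]) auto
    then show False by (auto simp: null_sets_def)
  qed
  ultimately show ?thesis by linarith
qed

lemma
  assumes s: "0 < s" "s < 1" and a: "a > 0"
  shows set_integrable_levy_scaled: "set_integrable lborel {0<..} (\<lambda>w. (1 - exp (- (a * w))) / w powr (1 + s))"
    and LBINT_levy_scaled: "(LINT w:{0<..}|lborel. (1 - exp (- (a * w))) / w powr (1 + s)) = a powr s * levy_const s"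
proof -
  let ?f = "\<lambda>w::real. indicator {0<..} w *\<^sub>R ((1 - exp (- w)) / w powr (1 + s))"
  have i: "integrable lborel ?f" using set_integrable_levy[OF s] by (simp add: set_integrable_def)
  have *: "?f (0 + a *\<^sub>R w) = a powr (- 1 - s) *
      (indicator {0<..} w *\<^sub>R ((1 - exp (- (a * w))) / w powr (1 + s)))" for w
    using a powr_minus_divide[of a "1 + s"]
    by (auto simp: indicator_def zero_less_mult_iff powr_mult)
  have a0: "a \<noteq> 0" "a powr (- 1 - s) \<noteq> 0" using a by auto
  show "set_integrable lborel {0<..} (\<lambda>w. (1 - exp (- (a * w))) / w powr (1 + s))"
  proof -
    have "integrable lborel (\<lambda>w. inverse (a powr (- 1 - s)) * ?f (0 + a *\<^sub>R w))"
      by (intro integrable_mult_right integrable_lborel_affine[OF i a0(1)])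
    moreover have "inverse (a powr (- 1 - s)) * ?f (0 + a *\<^sub>R w) =
        indicator {0<..} w *\<^sub>R ((1 - exp (- (a * w))) / w powr (1 + s))" for w
    proof -
      have "inverse c * (c * X) = X" if "c \<noteq> 0" for c X :: real using that by simp
      then show ?thesis unfolding * using a0(2) by blast
    qed
    ultimately show ?thesis unfolding set_integrable_def by (simp only:)
  qed
  have "levy_const s = a * a powr (- 1 - s) *
      (LINT w:{0<..}|lborel. (1 - exp (- (a * w))) / w powr (1 + s))"
    unfolding levy_const_def set_lebesgue_integral_def integral_lborel_affine[OF i a0(1), of 0] *
      integral_mult_right_zero
    using a by simp
  also have "a * a powr (- 1 - s) = a powr (- s)"
    using a by (simp add: powr_diff powr_minus field_simps)
  finally show "(LINT w:{0<..}|lborel. (1 - exp (- (a * w))) / w powr (1 + s)) = a powr s * levy_const s"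
    using a by (simp add: powr_minus field_simps)
qed

text \<open>The antiderivative \<open>F\<close> is elementary: it equals ((1 + w)^s - 1) * w^(-s) /
  s. It is at most w^(1-s) / s for w > 0, hence tends to 0 at 0, and it tends to 1/s at infinity.
  The form with (1 + w)/w = 1 + 1/w makes the derivative and the second limit immediate.\<close>

lemma
  assumes s: "0 < s" "s < 1"
  shows set_integrable_binomial_tail:
      "set_integrable lborel {0<..} (\<lambda>w::real. (1 - (1 + w) powr (s - 1)) / w powr (1 + s))"
    and LBINT_binomial_tail:
      "(LINT w:{0<..}|lborel. (1 - (1 + w) powr (s - 1)) / w powr (1 + s)) = 1 / s"
proof -
  define F where "F w = (((1 + w) / w) powr s - w powr (- s)) / s" for w :: real
  let ?f = "\<lambda>w::real. (1 - (1 + w) powr (s - 1)) / w powr (1 + s)"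
  have D: "DERIV F w :> ?f w" if w: "w > 0" for w
  proof -
    have d1: "DERIV (\<lambda>w. (1 + w) / w) w :> - (1 / w\<^sup>2)"
      by (rule DERIV_cong, (rule derivative_intros)+)
         (use w in \<open>auto simp: power2_eq_square field_simps\<close>)
    have d2: "DERIV (\<lambda>w. ((1 + w) / w) powr s) w :> s * ((1 + w) / w) powr (s - 1) * - (1 / w\<^sup>2)"
      using DERIV_fun_powr[OF d1, of s] w by simp
    have d3: "DERIV (\<lambda>w. w powr (- s)) w :> - s * w powr (- s - 1)"
      using DERIV_fun_powr[OF DERIV_ident, of w "- s"] w by simp
    have "DERIV F w :> (s * ((1 + w) / w) powr (s - 1) * - (1 / w\<^sup>2) - - s * w powr (- s - 1)) / s"
      unfolding F_def by (intro DERIV_cdivide DERIV_diff d2 d3)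
    also have "(s * ((1 + w) / w) powr (s - 1) * - (1 / w\<^sup>2) - - s * w powr (- s - 1)) / s
       = w powr (- s - 1) - ((1 + w) / w) powr (s - 1) / w\<^sup>2"
      using s by (simp add: field_simps)
    also have "\<dots> = ?f w"
    proof -
      have "w powr (s - 1) * w\<^sup>2 = w powr (1 + s)"
        using w by (simp add: powr_diff powr_add power2_eq_square)
      then have "((1 + w) / w) powr (s - 1) / w\<^sup>2 = (1 + w) powr (s - 1) / w powr (1 + s)"
        using w by (simp add: powr_divide)
      moreover have "w powr (- s - 1) = 1 / w powr (1 + s)"
      proof -
        have "- s - 1 = - (1 + s)" by simp
        then show ?thesis by (simp only: powr_minus_divide)
      qed
      ultimately show ?thesis by (simp add: diff_divide_distrib)
    qed
    finally show ?thesis .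
  qed
  have cont: "isCont ?f w" if "w > 0" for w
    using that by (intro continuous_intros) auto
  have nn: "?f w \<ge> 0" if "w > 0" for w
    using that s powr_mono[of "s - 1" 0 "1 + w"] by auto
  have lim0: "(F \<longlongrightarrow> 0) (at_right 0)"
  proof (rule Lim_null_comparison)
    show "\<forall>\<^sub>F w in at_right 0. norm (F w) \<le> w powr (1 - s) / s"
      unfolding eventually_at_right_field
    proof (intro exI[of _ 1] conjI allI impI)
      fix w :: real assume w: "0 < w"
      have "1 \<le> (1 + w) powr s" using w s by (simp add: ge_one_powr_ge_zero)
      moreover have "(1 + w) powr s \<le> (1 + w) powr 1" using w s by (intro powr_mono) auto
      ultimately have "0 \<le> (1 + w) powr s - 1" "(1 + w) powr s - 1 \<le> w" using w by auto
      moreover have "F w = ((1 + w) powr s - 1) * w powr (- s) / s"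
        using w by (simp add: F_def powr_divide powr_minus field_simps)
      moreover have "w powr (1 - s) = w * w powr (- s)" using w by (simp add: powr_diff powr_minus field_simps)
      ultimately show "norm (F w) \<le> w powr (1 - s) / s" using s
        by (simp add: divide_right_mono mult_right_mono)
    qed auto
    have "((\<lambda>w. w powr (1 - s) / s) \<longlongrightarrow> 0 powr (1 - s) / s) (at_right 0)"
      using s by (intro tendsto_divide tendsto_powr' tendsto_ident_at tendsto_const)
        (auto intro: eventually_mono[OF eventually_at_right_less[of 0]])
    then show "((\<lambda>w. w powr (1 - s) / s) \<longlongrightarrow> 0) (at_right 0)" by simp
  qed
  have liminf: "(F \<longlongrightarrow> 1 / s) at_top"
  proof -
    have "((\<lambda>w::real. 1 + 1 / w) \<longlongrightarrow> 1 + 0) at_top"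
      by (intro tendsto_intros tendsto_divide_0[OF tendsto_const] filterlim_at_top_imp_at_infinity filterlim_ident)
    then have l1: "((\<lambda>w. (1 + 1 / w) powr s) \<longlongrightarrow> 1 powr s) at_top"
      by (intro tendsto_powr tendsto_const) auto
    have l2: "((\<lambda>w::real. w powr (- s)) \<longlongrightarrow> 0) at_top"
      using s by (intro tendsto_neg_powr filterlim_ident) auto
    have "((\<lambda>w. ((1 + 1 / w) powr s - w powr (- s)) / s) \<longlongrightarrow> (1 powr s - 0) / s) at_top"
      using s by (intro tendsto_divide tendsto_diff l1 l2 tendsto_const) auto
    then have "((\<lambda>w. ((1 + 1 / w) powr s - w powr (- s)) / s) \<longlongrightarrow> 1 / s) at_top" by simp
    then show ?thesis
    proof (rule Lim_transform_eventually)
      show "\<forall>\<^sub>F w in at_top. ((1 + 1 / w) powr s - w powr (- s)) / s = F w"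
        using eventually_gt_at_top[of 0] by eventually_elim (simp add: F_def field_simps)
    qed
  qed
  have e: "einterval 0 \<infinity> = {0::real<..}" by (auto simp: einterval_def)
  have 0: "(0::ereal) < \<infinity>" by simp
  have l0: "((F \<circ> real_of_ereal) \<longlongrightarrow> 0) (at_right 0)"
    using lim0 by (simp add: zero_ereal_def ereal_tendsto_simps)
  have l1: "((F \<circ> real_of_ereal) \<longlongrightarrow> 1 / s) (at_left \<infinity>)"
    using liminf by (simp add: ereal_tendsto_simps)
  note FTC = interval_integral_FTC_nonneg[OF 0 _ _ _ l0 l1, of ?f]
  show "set_integrable lborel {0<..} ?f"
    using FTC(1) D cont nn unfolding e by (auto simp: zero_ereal_def)
  show "(LINT w:{0<..}|lborel. ?f w) = 1 / s"
    using FTC(2) D cont nn by (auto simp: zero_ereal_def interval_lebesgue_integral_def e[unfolded zero_ereal_def])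
qed


text \<open>The profile A_T: formally an inverse Gamma density of shape - s and scale T, hence not
  integrable at infinity. The exponential is flat at r = 0, so the cut there is smooth.\<close>

definition levy_density :: "real \<Rightarrow> real \<Rightarrow> real \<Rightarrow> real" where
  "levy_density s T r = (if r > 0 then r powr (s - 1) * exp (- (T / r)) else 0)"

text \<open>The substitution y = r * w / (1 + w) gives r - y = r / (1 + w), so that T / (r - y) = a
  * (1 + w) with a = T/r is affine in w. The integrand becomes a multiple of ((1 + w)^(s-1) -
  e^(-a*w)) / w^(1+s). Adding and subtracting 1 splits it into the Levy integral and the binomial
  tail, each convergent at w = 0.\<close>

lemma marchaud_levy_density_inner:
  assumes s: "0 < s" "s < 1" and T: "T > 0" and r: "r > 0"
  shows "set_integrable lborel {0<..<r}
      (\<lambda>y. (levy_density s T r - levy_density s T (r - y)) / y powr (1 + s))" (is ?th1)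
    and "(LINT y:{0<..<r}|lborel. (levy_density s T r - levy_density s T (r - y)) / y powr (1 + s))
      = exp (- (T / r)) / r * ((T / r) powr s * levy_const s - 1 / s)" (is ?th2)
proof -
  define a where "a = T / r"
  have a: "a > 0" using T r by (simp add: a_def)
  let ?h = "\<lambda>y. (levy_density s T r - levy_density s T (r - y)) / y powr (1 + s)"
  let ?g = "\<lambda>w. r * w / (1 + w)"
  let ?g' = "\<lambda>w. r / (1 + w)\<^sup>2"
  let ?k = "\<lambda>w. exp (- a) / r * ((1 - exp (- (a * w))) / w powr (1 + s) - (1 - (1 + w) powr (s - 1)) / w powr (1 + s))"
  have im: "?g ` {0<..} = {0<..<r}"
  proof (intro equalityI subsetI)
    fix y assume y: "y \<in> {0<..<r}"
    show "y \<in> ?g ` {0<..}"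
    proof (rule image_eqI[of _ _ "y / (r - y)"])
      show "y = ?g (y / (r - y))" using y by (simp add: field_simps)
      show "y / (r - y) \<in> {0<..}" using y by simp
    qed
  qed (use r in \<open>auto simp: field_simps\<close>)
  have inj: "inj_on ?g {0<..}"
    using r by (auto simp: inj_on_def field_simps)
  have der: "(?g has_field_derivative ?g' w) (at w within {0<..})" if "w \<in> {0<..}" for w
    by (rule DERIV_cong, (rule derivative_intros)+)
       (use that r in \<open>auto simp: power2_eq_square field_simps\<close>)
  have eq: "\<bar>?g' w\<bar> * ?h (?g w) = ?k w" if w: "w > 0" for w
  proof -
    have 1: "r - ?g w = r / (1 + w)" using w by (simp add: field_simps)
    have A2: "levy_density s T (r - ?g w) = (r / (1 + w)) powr (s - 1) * exp (- (T / (r / (1 + w))))"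
      unfolding 1 using w r by (simp add: levy_density_def)
    \<comment> \<open>Naming the powers and exponentials leaves an identity of rational functions in
      independent positive quantities.\<close>
    define q R P W e E where "q = 1 + w" and "R = r powr (s - 1)" and "P = q powr (s - 1)"
      and "W = w powr (1 + s)" and "e = exp (- a)" and "E = exp (- (a * w))"
    have pos: "q > 0" "R > 0" "P > 0" "W > 0" using w r by (auto simp: q_def R_def P_def W_def)
    have "(r / q) powr (s - 1) = R / P" using w r pos by (simp add: powr_divide R_def P_def)
    moreover have "exp (- (T / (r / q))) = e * E"
      using w r by (simp add: a_def q_def e_def E_def field_simps flip: exp_add)
    ultimately have A2': "levy_density s T (r - ?g w) = R / P * (e * E)"
      using A2 by (simp add: q_def)
    have A1: "levy_density s T r = R * e"
      using r by (simp add: levy_density_def a_def R_def e_def)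
    have "r powr (1 + s) = R * r\<^sup>2" "q powr (1 + s) = P * q\<^sup>2"
      using r pos(1) by (simp_all add: R_def P_def powr_diff powr_add power2_eq_square)
    then have gp: "?g w powr (1 + s) = R * r\<^sup>2 * W / (P * q\<^sup>2)"
      using w r pos(1) by (simp add: powr_divide powr_mult W_def flip: q_def)
    have "\<bar>?g' w\<bar> * ?h (?g w) = r / q\<^sup>2 * ((R * e - R / P * (e * E)) / (R * r\<^sup>2 * W / (P * q\<^sup>2)))"
      unfolding A1 A2' gp using r by (simp add: q_def)
    also have "\<dots> = e / r * ((1 - E) / W - (1 - P) / W)"
      using pos r by (simp add: divide_simps power2_eq_square) (simp add: algebra_simps)
    finally show ?thesis by (simp add: q_def P_def W_def e_def E_def)
  qed
  have k_int: "set_integrable lborel {0<..} ?k"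
    by (intro set_integrable_mult_right set_integral_diff(1) set_integrable_levy_scaled
        set_integrable_binomial_tail s a)
  have k_val: "(LINT w:{0<..}|lborel. ?k w) = exp (- a) / r * (a powr s * levy_const s - 1 / s)"
    using set_integrable_levy_scaled[OF s a] set_integrable_binomial_tail[OF s]
      LBINT_levy_scaled[OF s a] LBINT_binomial_tail[OF s]
    by (simp add: set_integral_diff(2))
  have [measurable]: "levy_density s T \<in> borel_measurable borel"
    unfolding levy_density_def by measurable
  \<comment> \<open>The change of variables theorem speaks of absolute integrability in the gauge
    sense; \<open>?k\<close> is carried over to that setting and the result is carried back to
    \<open>lborel\<close>.\<close>
  have "(\<lambda>w. \<bar>?g' w\<bar> * ?h (?g w)) absolutely_integrable_on {0<..} \<longleftrightarrow> ?k absolutely_integrable_on {0<..}"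
    by (rule set_integrable_cong) (simp_all only: greaterThan_iff eq)
  moreover have "?k absolutely_integrable_on {0<..}"
    using k_int by (subst absolutely_integrable_on_iff_set_integrable_lborel) auto
  moreover have "integral {0<..} (\<lambda>w. \<bar>?g' w\<bar> * ?h (?g w)) = integral {0<..} ?k"
    by (rule Henstock_Kurzweil_Integration.integral_cong) (simp only: greaterThan_iff eq)
  moreover have "integral {0<..} ?k = exp (- a) / r * (a powr s * levy_const s - 1 / s)"
    unfolding set_borel_integral_eq_integral(2)[OF k_int, symmetric] by (rule k_val)
  ultimately have *: "?h absolutely_integrable_on ?g ` {0<..} \<and>
      integral (?g ` {0<..}) ?h = exp (- a) / r * (a powr s * levy_const s - 1 / s)"
    using has_absolute_integral_change_of_variables_1'[OF _ der inj, of ?h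
        "exp (- a) / r * (a powr s * levy_const s - 1 / s)"] by auto
  then show th1: ?th1
    unfolding im by (subst (asm) absolutely_integrable_on_iff_set_integrable_lborel) auto
  show ?th2
    using set_borel_integral_eq_integral(2)[OF th1] * unfolding im a_def by simp
qed

text \<open>For y >= r the shifted density is 0, so this range contributes A_T(r) * r^(-s) / s. That
  is exactly the term 1/s missing from the range y < r, and only the Levy term survives.\<close>

lemma
  assumes s: "0 < s" "s < 1" and T: "T > 0" and r: "r > 0"
  shows set_integrable_marchaud_levy_density: "set_integrable lborel {0<..}
      (\<lambda>y. (levy_density s T r - levy_density s T (r - y)) / y powr (1 + s))" (is ?th1)
    and LBINT_marchaud_levy_density:
      "(LINT y:{0<..}|lborel. (levy_density s T r - levy_density s T (r - y)) / y powr (1 + s))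
      = levy_const s * (T powr s * r powr (- 1 - s) * exp (- (T / r)))" (is ?th2)
proof -
  let ?h = "\<lambda>y. (levy_density s T r - levy_density s T (r - y)) / y powr (1 + s)"
  note inner = marchaud_levy_density_inner[OF s T r]
  let ?c = "levy_density s T r"
  have h: "?h y = ?c * y powr (- 1 - s)" if "y \<in> {r..}" for y
    using that r powr_minus_divide[of y "1 + s"] by (simp add: levy_density_def)
  have i: "set_integrable lborel {r..} (\<lambda>y. ?c * y powr (- 1 - s))"
    using s r by (intro set_integrable_mult_right set_integrable_powr_to_inf) auto
  have outer1: "set_integrable lborel {r..} ?h"
    by (rule iffD2[OF set_integrable_cong i]) (use h in auto)
  have outer2: "(LINT y:{r..}|lborel. ?h y) = ?c * (r powr (- s) / s)"
  proof -
    have "(LINT y:{r..}|lborel. ?h y) = (LINT y:{r..}|lborel. ?c * y powr (- 1 - s))"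
      by (rule set_lebesgue_integral_cong) (use h in auto)
    also have "\<dots> = ?c * (r powr (- s) / s)"
      using LBINT_powr_to_inf[of "- 1 - s" r] s r by simp
    finally show ?thesis .
  qed
  have U: "{0<..} = {0<..<r} \<union> {r..}" using r by auto
  show ?th1 unfolding U using inner(1) outer1 by (intro set_integrable_Un) auto
  have "(LINT y:{0<..}|lborel. ?h y) = exp (- (T / r)) / r * ((T / r) powr s * levy_const s - 1 / s)
      + ?c * (r powr (- s) / s)"
    unfolding U by (subst set_integral_Un) (use inner outer1 outer2 in auto)
  also have "?c * (r powr (- s) / s) = exp (- (T / r)) / r * (1 / s)"
    using r s by (simp add: levy_density_def powr_diff powr_minus field_simps)
  also have "exp (- (T / r)) / r * ((T / r) powr s * levy_const s - 1 / s) + exp (- (T / r)) / r * (1 / s)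
      = exp (- (T / r)) / r * ((T / r) powr s * levy_const s)"
    by (simp add: algebra_simps)
  also have "\<dots> = levy_const s * (T powr s * r powr (- 1 - s) * exp (- (T / r)))"
    using r T powr_minus_divide[of r "1 + s"] by (simp add: powr_divide powr_add)
  finally show ?th2 .
qed

section \<open>Damping\<close>


lemma borel_measurable_levy_density [measurable]: "levy_density s T \<in> borel_measurable borel"
  unfolding levy_density_def by measurable

lemma set_integrable_powr_exp_neg_inverse:
  fixes b T :: real
  assumes "b < - 1" "T > 0"
  shows "set_integrable lborel {0<..} (\<lambda>r. r powr b * exp (- (T / r)))"
proof -
  obtain C where C: "C \<ge> 0" "\<And>r. r > 0 \<Longrightarrow> r powr b * exp (- (T / r)) \<le> C"
    using powr_exp_exp_bounded[of T 0 b] assms by auto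
  have "integrable lborel (\<lambda>r. C * indicator {0..1} r + indicator {1..} r *\<^sub>R r powr b)"
    using set_integrable_powr_to_inf[of b 1] assms
    by (intro Bochner_Integration.integrable_add) (auto simp: set_integrable_def)
  then show ?thesis
    unfolding set_integrable_def
  proof (rule Bochner_Integration.integrable_bound)
    show "AE r in lborel. norm (indicator {0<..} r *\<^sub>R (r powr b * exp (- (T / r))))
        \<le> norm (C * indicator {0..1} r + indicator {1..} r *\<^sub>R r powr b)"
    proof (rule AE_I2)
      fix r :: real
      show "norm (indicator {0<..} r *\<^sub>R (r powr b * exp (- (T / r))))
        \<le> norm (C * indicator {0..1} r + indicator {1..} r *\<^sub>R r powr b)"
      proof (cases "r > 0")
        case r: True
        define X where "X = r powr b * exp (- (T / r))"
        have "X \<le> r powr b * 1" unfolding X_def using r assms by (intro mult_left_mono) auto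
        moreover have "0 \<le> X" "X \<le> C" using C r by (auto simp: X_def)
        ultimately show ?thesis using r C unfolding X_def[symmetric]
          by (auto simp: indicator_def)
      qed auto
    qed
  qed auto
qed

definition levy_diff :: "real \<Rightarrow> real \<Rightarrow> real \<Rightarrow> real \<Rightarrow> real" where
  "levy_diff s T1 T2 r = levy_density s T1 r - levy_density s T2 r"

text \<open>The commutator, up to sign, of the Marchaud derivative with multiplication by exp (- (e
  * r)), applied to \<open>levy_diff\<close>. It isolates what the damping spoils in the exact
  formula.\<close>

definition damping_error :: "real \<Rightarrow> real \<Rightarrow> real \<Rightarrow> real \<Rightarrow> real \<Rightarrow> real" where
  "damping_error s T1 T2 e r = (LINT y:{0<..}|lborel.
     levy_diff s T1 T2 (r - y) * (exp (- (e * (r - y))) - exp (- (e * r))) / y powr (1 + s))"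

lemma borel_measurable_levy_diff [measurable]: "levy_diff s T1 T2 \<in> borel_measurable borel"
  unfolding levy_diff_def by measurable

lemma borel_measurable_damping_error [measurable]: "damping_error s T1 T2 e \<in> borel_measurable borel"
  unfolding damping_error_def set_lebesgue_integral_def by measurable

lemma levy_diff_eq_0 [simp]: "r \<le> 0 \<Longrightarrow> levy_diff s T1 T2 r = 0"
  by (simp add: levy_diff_def levy_density_def)

text \<open>The common leading term r^(s-1) at infinity cancels because 1 - exp (- c/r) <= c/r. The
  remaining r^(s-2) is integrable at infinity when s < 1, whereas r^(s-1) is not when s > 0.\<close>

lemma abs_levy_diff_le:
  assumes "T1 < T2" "r > 0"
  shows "\<bar>levy_diff s T1 T2 r\<bar> \<le> (T2 - T1) * (r powr (s - 2) * exp (- (T1 / r)))"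
proof -
  have "levy_diff s T1 T2 r = r powr (s - 1) * (exp (- (T1 / r)) * (1 - exp (- ((T2 - T1) / r))))"
    using assms by (simp add: levy_diff_def levy_density_def right_diff_distrib diff_divide_distrib flip: exp_add)
  moreover have "0 \<le> 1 - exp (- ((T2 - T1) / r))" using assms by simp
  moreover have "1 - exp (- ((T2 - T1) / r)) \<le> (T2 - T1) / r"
    using exp_ge_add_one_self[of "- ((T2 - T1) / r)"] by simp
  ultimately have "levy_diff s T1 T2 r \<ge> 0"
      "levy_diff s T1 T2 r \<le> r powr (s - 1) * (exp (- (T1 / r)) * ((T2 - T1) / r))"
    by (simp_all only: mult_left_mono powr_ge_zero exp_ge_zero mult_nonneg_nonneg)
  then have "\<bar>levy_diff s T1 T2 r\<bar> \<le> r powr (s - 1) * (exp (- (T1 / r)) * ((T2 - T1) / r))" by simp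
  also have "\<dots> = (T2 - T1) * (r powr (s - 2) * exp (- (T1 / r)))"
    using assms by (simp add: powr_diff power2_eq_square)
  finally show ?thesis .
qed

text \<open>All three bounds are free of e. The bound y/x, which comes from q * exp (- q) <= 1 at q
  = e * x, tames the singularity y^(-1-s) for small y; the bound 1 serves for large y.\<close>

lemma exp_decrement_bounds:
  fixes e x y :: real
  assumes "e > 0" "x > 0" "y > 0"
  defines "m \<equiv> exp (- (e * x)) - exp (- (e * (x + y)))"
  shows "0 \<le> m" "m \<le> 1" "m \<le> y / x"
proof -
  have m: "m = exp (- (e * x)) * (1 - exp (- (e * y)))"
    by (simp add: m_def algebra_simps flip: exp_add)
  have 1: "0 \<le> 1 - exp (- (e * y))" using assms by simp
  have 2: "1 - exp (- (e * y)) \<le> e * y" using exp_ge_add_one_self[of "- (e * y)"] by simp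
  have "e * x \<le> exp (e * x)" using exp_ge_add_one_self[of "e * x"] by linarith
  then have 3: "exp (- (e * x)) * (e * x) \<le> 1" by (simp add: exp_minus field_simps)
  show "0 \<le> m" unfolding m using 1 by simp
  show "m \<le> 1" unfolding m using 1 assms by (intro mult_le_one) auto
  have "m \<le> exp (- (e * x)) * (e * y)" unfolding m using 2 by (intro mult_left_mono) auto
  also have "\<dots> = (exp (- (e * x)) * (e * x)) * (y / x)" using assms by simp
  also have "\<dots> \<le> 1 * (y / x)" using 3 assms by (intro mult_right_mono) auto
  finally show "m \<le> y / x" by simp
qed

text \<open>The majorant must be independent of e. The range 0 < y < r is split at r/2. Below it x =
  r - y is at least r/2, so \<open>a x\<close> is at most a multiple of 1/r and the decrement is at
  most 2 * y / r, which leaves a multiple of y^(-s) / r^2. Above it y^(-1-s) is at most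
  (r/2)^(-1-s), and \<open>a\<close> is integrable. Both parts integrate to multiples of
  r^(-1-s).\<close>

lemma damping_error_dominated:
  assumes s: "0 < s" "s < 1" and T: "0 < T1" "T1 < T2"
  shows "\<exists>g C. C \<ge> 0 \<and> (\<forall>r>0. integrable lborel (g r)
      \<and> (LINT y|lborel. g r y) \<le> C * (r powr (- 1 - s) * exp (- (T1 / 2 / r)))
      \<and> (\<forall>e>0. \<forall>y. \<bar>indicator {0<..} y *\<^sub>R (levy_diff s T1 T2 (r - y) *
            (exp (- (e * (r - y))) - exp (- (e * r))) / y powr (1 + s))\<bar> \<le> g r y))"
proof -
  \<comment> \<open>One half of T1 is spent on exp (- (T' / x)) <= exp (- (T' / r)), the factor that
    must survive the integration; the other half keeps \<open>a\<close> integrable at 0.\<close>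
  define T' where "T' = T1 / 2"
  define D where "D = T2 - T1"
  have T': "T' > 0" and D: "D > 0" using T by (auto simp: T'_def D_def)
  define a where "a x = indicator {0<..} x *\<^sub>R (x powr (s - 2) * exp (- (T' / x)))" for x :: real
  have a_int: "integrable lborel a"
    using set_integrable_powr_exp_neg_inverse[of "s - 2" T'] s T'
    unfolding a_def set_integrable_def by auto
  have a_nn: "a x \<ge> 0" for x by (simp add: a_def)
  obtain C1 where C1: "C1 \<ge> 0" "\<And>r. r > 0 \<Longrightarrow> r powr (s - 1) * exp (- (T' / r)) \<le> C1"
    using powr_exp_exp_bounded[of T' 0 "s - 1"] s T' by auto
  define I where "I = (LINT x|lborel. a x)"
  have I: "I \<ge> 0" unfolding I_def using a_nn by simp
  define g where "g r y = D * exp (- (T' / r)) *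
      (4 * C1 / r\<^sup>2 * (indicator {0..r} y *\<^sub>R y powr (- s)) + (r / 2) powr (- 1 - s) * a (r - y))" for r y :: real
  define C where "C = D * (4 * C1 / (1 - s) + 2 powr (1 + s) * I)"
  have C: "C \<ge> 0" using D C1 I s by (auto simp: C_def)
  have "integrable lborel (g r) \<and>
      (LINT y|lborel. g r y) \<le> C * (r powr (- 1 - s) * exp (- (T' / r)))"
    if r: "r > 0" for r
  proof -
    have i1: "integrable lborel (\<lambda>y. indicator {0..r} y *\<^sub>R y powr (- s))"
      using set_integrable_powr_from_0[of "- s" r] s r by (simp add: set_integrable_def)
    have I1: "(LINT y|lborel. indicator {0..r} y *\<^sub>R y powr (- s)) = r powr (1 - s) / (1 - s)"
      using LBINT_powr_from_0[of "- s" r] s r by (simp add: set_lebesgue_integral_def)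
    have i2: "integrable lborel (\<lambda>y. a (r - y))"
      using integrable_lborel_affine[OF a_int, of "- 1" r] by simp
    have I2: "(LINT y|lborel. a (r - y)) = I"
      using integral_lborel_affine[OF a_int, of "- 1" r] by (simp add: I_def)
    have gi: "integrable lborel (g r)"
      unfolding g_def by (intro integrable_mult_right Bochner_Integration.integrable_add i1 i2)
    have "(LINT y|lborel. g r y) = D * exp (- (T' / r)) *
        (4 * C1 / r\<^sup>2 * (r powr (1 - s) / (1 - s)) + (r / 2) powr (- 1 - s) * I)"
      unfolding g_def integral_mult_right_zero
      unfolding Bochner_Integration.integral_add[OF integrable_mult_right[OF i1] integrable_mult_right[OF i2]]
        integral_mult_right_zero I1 I2 ..
    also have "r powr (1 - s) / (1 - s) = r powr (- 1 - s) * r\<^sup>2 / (1 - s)"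
      using r by (simp add: powr_diff powr_minus power2_eq_square field_simps)
    also have "(r / 2) powr (- 1 - s) = r powr (- 1 - s) * 2 powr (1 + s)"
      using r powr_minus_divide[of "2::real" "1 + s"] by (simp add: powr_divide)
    also have "D * exp (- (T' / r)) * (4 * C1 / r\<^sup>2 * (r powr (- 1 - s) * r\<^sup>2 / (1 - s)) +
        r powr (- 1 - s) * 2 powr (1 + s) * I) = C * (r powr (- 1 - s) * exp (- (T' / r)))"
      using r by (simp add: C_def algebra_simps)
    finally show ?thesis using gi by simp
  qed
  moreover have "\<bar>indicator {0<..} y *\<^sub>R (levy_diff s T1 T2 (r - y) *
            (exp (- (e * (r - y))) - exp (- (e * r))) / y powr (1 + s))\<bar> \<le> g r y"
    if r: "r > 0" and e: "e > 0" for r e y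
  proof (cases "0 < y \<and> y < r")
    case True
    define x where "x = r - y"
    have x: "x > 0" "x \<le> r" "x + y = r" using True by (auto simp: x_def)
    define m where "m = exp (- (e * x)) - exp (- (e * r))"
    have m: "0 \<le> m" "m \<le> 1" "m \<le> y / x"
      using exp_decrement_bounds[OF e x(1), of y] True by (auto simp: m_def x(3))
    have "\<bar>levy_diff s T1 T2 x\<bar> \<le> D * (x powr (s - 2) * exp (- (T1 / x)))"
      unfolding D_def by (rule abs_levy_diff_le[OF T(2) x(1)])
    also have "exp (- (T1 / x)) = exp (- (T' / x)) * exp (- (T' / x))"
      by (simp add: T'_def flip: exp_add)
    also have "D * (x powr (s - 2) * (exp (- (T' / x)) * exp (- (T' / x)))) \<le>
        D * (x powr (s - 2) * (exp (- (T' / x)) * exp (- (T' / r))))"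
      using D x r T' by (intro mult_left_mono) (auto simp: frac_le)
    also have "\<dots> = D * exp (- (T' / r)) * a x" using x by (simp add: a_def)
    finally have A: "\<bar>levy_diff s T1 T2 x\<bar> \<le> D * exp (- (T' / r)) * a x" .
    have "a x * (m / y powr (1 + s)) \<le> 4 * C1 / r\<^sup>2 * y powr (- s) + (r / 2) powr (- 1 - s) * a x"
    proof (cases "y \<le> r / 2")
      case le: True
      then have x2: "x \<ge> r / 2" by (simp add: x_def)
      have "a x = (x powr (s - 1) * exp (- (T' / x))) / x"
        using x by (simp add: a_def powr_diff power2_eq_square)
      also have "\<dots> \<le> C1 / x" using C1(2)[OF x(1)] x by (intro divide_right_mono) auto
      also have "\<dots> \<le> C1 / (r / 2)" using C1 x2 r by (intro divide_left_mono) auto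
      finally have 1: "a x \<le> 2 * C1 / r" by (simp add: mult.commute)
      have "m \<le> y / (r / 2)" using m(3) True x2 r by (meson divide_left_mono half_gt_zero less_imp_le mult_pos_pos order_trans x(1))
      then have 2: "m / y powr (1 + s) \<le> (y / (r / 2)) / y powr (1 + s)"
        by (intro divide_right_mono) auto
      have "a x * (m / y powr (1 + s)) \<le> (2 * C1 / r) * ((y / (r / 2)) / y powr (1 + s))"
        using 1 2 C1 r m by (intro mult_mono) auto
      also have "\<dots> = 4 * C1 / r\<^sup>2 * y powr (- s)"
        using True by (simp add: powr_add powr_minus power2_eq_square field_simps)
      also have "\<dots> \<le> 4 * C1 / r\<^sup>2 * y powr (- s) + (r / 2) powr (- 1 - s) * a x" using a_nn by simp
      finally show ?thesis .
    next
      case False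
      have "m / y powr (1 + s) \<le> 1 / (r / 2) powr (1 + s)"
        using m False r s by (intro frac_le powr_mono2) auto
      also have "\<dots> = (r / 2) powr (- 1 - s)" using powr_minus_divide[of "r / 2" "1 + s"] by simp
      finally have "a x * (m / y powr (1 + s)) \<le> a x * (r / 2) powr (- 1 - s)"
        using a_nn by (intro mult_left_mono) auto
      moreover have "0 \<le> 4 * C1 / r\<^sup>2 * y powr (- s)" using C1 by simp
      ultimately show ?thesis by (simp add: mult.commute)
    qed
    then have "D * exp (- (T' / r)) * (a x * (m / y powr (1 + s))) \<le> g r y"
      unfolding g_def using True D by (intro mult_left_mono) (auto simp: x_def)
    moreover have "\<bar>levy_diff s T1 T2 x\<bar> * (m / y powr (1 + s)) \<le>
        D * exp (- (T' / r)) * a x * (m / y powr (1 + s))"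
      using A m by (intro mult_right_mono) auto
    ultimately show ?thesis
      using True m by (simp add: abs_mult x_def m_def mult.assoc)
  next
    case False
    have "g r y \<ge> 0" using D C1 a_nn by (auto simp: g_def intro!: mult_nonneg_nonneg add_nonneg_nonneg)
    then show ?thesis using False by (auto simp: indicator_def)
  qed
  ultimately show ?thesis using C unfolding T'_def by (intro exI[of _ g] exI[of _ C]) blast
qed

section \<open>Parabolic weights\<close>


lemma
  assumes s: "0 < s" "s < 1" and T: "0 < T1" "T1 < T2"
  shows set_integrable_damping_error: "\<And>e r. e > 0 \<Longrightarrow> r > 0 \<Longrightarrow> set_integrable lborel {0<..}
      (\<lambda>y. levy_diff s T1 T2 (r - y) * (exp (- (e * (r - y))) - exp (- (e * r))) / y powr (1 + s))"
    and abs_damping_error_le: "\<exists>C\<ge>0. \<forall>e>0. \<forall>r>0.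
      \<bar>damping_error s T1 T2 e r\<bar> \<le> C * (r powr (- 1 - s) * exp (- (T1 / 2 / r)))"
    and tendsto_damping_error: "\<And>r e. r > 0 \<Longrightarrow> e \<longlonglongrightarrow> 0 \<Longrightarrow> (\<And>i. e i > 0) \<Longrightarrow>
      (\<lambda>i::nat. damping_error s T1 T2 (e i) r) \<longlonglongrightarrow> 0"
proof -
  let ?f = "\<lambda>e r y. indicator {0<..} y *\<^sub>R (levy_diff s T1 T2 (r - y) *
            (exp (- (e * (r - y))) - exp (- (e * r))) / y powr (1 + s))"
  obtain g C where C: "C \<ge> 0" and g: "\<And>r. r > 0 \<Longrightarrow> integrable lborel (g r)"
    and gC: "\<And>r. r > 0 \<Longrightarrow> (LINT y|lborel. g r y) \<le> C * (r powr (- 1 - s) * exp (- (T1 / 2 / r)))"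
    and le: "\<And>r e y. r > 0 \<Longrightarrow> e > 0 \<Longrightarrow> \<bar>?f e r y\<bar> \<le> g r y"
    using damping_error_dominated[OF s T] by blast
  have i: "integrable lborel (?f e r)" if "e > 0" "r > 0" for e r
    by (rule Bochner_Integration.integrable_bound[OF g[OF that(2)]])
       (use le[OF that(2,1)] in \<open>auto intro!: AE_I2 order_trans[OF _ abs_ge_self]\<close>)
  show "set_integrable lborel {0<..}
      (\<lambda>y. levy_diff s T1 T2 (r - y) * (exp (- (e * (r - y))) - exp (- (e * r))) / y powr (1 + s))"
    if "e > 0" "r > 0" for e r
    using i[OF that] by (simp add: set_integrable_def)
  have "\<bar>damping_error s T1 T2 e r\<bar> \<le> C * (r powr (- 1 - s) * exp (- (T1 / 2 / r)))"
    if "e > 0" "r > 0" for e r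
  proof -
    have "\<bar>damping_error s T1 T2 e r\<bar> \<le> (LINT y|lborel. \<bar>?f e r y\<bar>)"
      unfolding damping_error_def set_lebesgue_integral_def by (rule integral_abs_bound)
    also have "\<dots> \<le> (LINT y|lborel. g r y)"
      by (intro integral_mono integrable_abs i g that le)
    also note gC[OF that(2)]
    finally show ?thesis .
  qed
  then show "\<exists>C\<ge>0. \<forall>e>0. \<forall>r>0.
      \<bar>damping_error s T1 T2 e r\<bar> \<le> C * (r powr (- 1 - s) * exp (- (T1 / 2 / r)))"
    using C by blast
  show "(\<lambda>i::nat. damping_error s T1 T2 (e i) r) \<longlonglongrightarrow> 0"
    if r: "r > 0" and e: "e \<longlonglongrightarrow> 0" "\<And>i. e i > 0" for e r
  proof -
    have "(\<lambda>i. LINT y|lborel. ?f (e i) r y) \<longlonglongrightarrow> (LINT y::real|lborel. 0)"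
    proof (rule integral_dominated_convergence[where w = "g r"])
      show "AE y in lborel. (\<lambda>i. ?f (e i) r y) \<longlonglongrightarrow> 0"
      proof (rule AE_I2)
        fix y :: real
        let ?c = "indicator {0<..} y * levy_diff s T1 T2 (r - y) / y powr (1 + s)"
        have "(\<lambda>i. ?c * (exp (- (e i * (r - y))) - exp (- (e i * r)))) \<longlonglongrightarrow>
            ?c * (exp (- (0 * (r - y))) - exp (- (0 * r)))"
          by (intro tendsto_intros e)
        then show "(\<lambda>i. ?f (e i) r y) \<longlonglongrightarrow> 0" by (simp add: mult.assoc)
      qed
      show "AE y in lborel. norm (?f (e i) r y) \<le> g r y" for i
        using le[OF r e(2)] by (intro AE_I2) (simp only: real_norm_def)
    qed (use g[OF r] in auto)
    then show ?thesis unfolding damping_error_def set_lebesgue_integral_def by simp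
  qed
qed

lemma LBINT_marchaud_damped:
  assumes s: "0 < s" "s < 1" and T: "0 < T1" "T1 < T2" and e: "e > 0" and r: "r > 0"
  shows "(LINT y:{0<..}|lborel. (exp (- (e * r)) * levy_diff s T1 T2 r -
            exp (- (e * (r - y))) * levy_diff s T1 T2 (r - y)) / y powr (1 + s))
    = exp (- (e * r)) * levy_const s * (T1 powr s * r powr (- 1 - s) * exp (- (T1 / r))
        - T2 powr s * r powr (- 1 - s) * exp (- (T2 / r))) - damping_error s T1 T2 e r"
proof -
  let ?h = "\<lambda>T y. (levy_density s T r - levy_density s T (r - y)) / y powr (1 + s)"
  let ?k = "\<lambda>y. levy_diff s T1 T2 (r - y) * (exp (- (e * (r - y))) - exp (- (e * r))) / y powr (1 + s)"
  have T2: "T2 > 0" using T by simp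
  note i1 = set_integrable_marchaud_levy_density[OF s T(1) r]
    and i2 = set_integrable_marchaud_levy_density[OF s T2 r]
  note I1 = LBINT_marchaud_levy_density[OF s T(1) r] and I2 = LBINT_marchaud_levy_density[OF s T2 r]
  note ik = set_integrable_damping_error[OF s T e r]
  note i12 = set_integral_diff(1)[OF i1 i2]
  note ih = set_integrable_mult_right[OF i12, of "exp (- (e * r))"]
  have "(exp (- (e * r)) * levy_diff s T1 T2 r -
            exp (- (e * (r - y))) * levy_diff s T1 T2 (r - y)) / y powr (1 + s)
     = exp (- (e * r)) * (?h T1 y - ?h T2 y) - ?k y" for y
    by (simp add: levy_diff_def diff_divide_distrib[symmetric]) (simp add: algebra_simps)
  then have "(LINT y:{0<..}|lborel. (exp (- (e * r)) * levy_diff s T1 T2 r -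
            exp (- (e * (r - y))) * levy_diff s T1 T2 (r - y)) / y powr (1 + s))
     = (LINT y:{0<..}|lborel. exp (- (e * r)) * (?h T1 y - ?h T2 y) - ?k y)"
    by (simp only:)
  also have "\<dots> = exp (- (e * r)) * ((LINT y:{0<..}|lborel. ?h T1 y) - (LINT y:{0<..}|lborel. ?h T2 y))
     - damping_error s T1 T2 e r"
    unfolding set_integral_diff(2)[OF ih ik] set_integral_mult_right set_integral_diff(2)[OF i1 i2]
      damping_error_def ..
  also have "\<dots> = exp (- (e * r)) * levy_const s * (T1 powr s * r powr (- 1 - s) * exp (- (T1 / r))
        - T2 powr s * r powr (- 1 - s) * exp (- (T2 / r))) - damping_error s T1 T2 e r"
    unfolding I1 I2 by (simp add: right_diff_distrib mult.assoc)
  finally show ?thesis .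
qed

text \<open>With p = n/2 + 1 + s this is the denominator in the class of u. The same p is the power
  of r in the mean value kernel, and this match is why the kernels can be integrated against
  u.\<close>

definition pweight :: "real \<Rightarrow> 'a::euclidean_space \<times> real \<Rightarrow> real" where
  "pweight p = (\<lambda>(x, t). 1 + norm x powr (2 * p) + \<bar>t\<bar> powr p)"

lemma pweight_ge_1: "pweight p z \<ge> 1"
  by (auto simp: pweight_def split: prod.splits)

lemma pweight_pos [simp]: "pweight p z > 0"
  using pweight_ge_1[of p z] by linarith

lemma borel_measurable_pweight [measurable]: "pweight p \<in> borel_measurable borel"
  unfolding pweight_def split_beta borel_prod[symmetric] by measurable

text \<open>L stands for a squared parabolic distance from (x, t) to the centre, bounded below by d.
  For centres in a fixed bounded set it controls 1, |x|^2 and |t| up to one factor k, hence the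
  weight up to 3 * (k * L) powr p.\<close>

lemma pweight_le:
  assumes p: "p > 0" and R: "R \<ge> 0" and d: "d > 0"
  shows "\<exists>C>0. \<forall>(x0::'a::euclidean_space) t0 x t L. norm x0 \<le> R \<longrightarrow> \<bar>t0\<bar> \<le> R \<longrightarrow> L \<ge> d \<longrightarrow>
     (norm (x - x0))\<^sup>2 / 4 \<le> L \<longrightarrow> \<bar>t0 - t\<bar> \<le> L \<longrightarrow> L powr (- p) \<le> C / pweight p (x, t)"
proof -
  \<comment> \<open>The summands come from 1 <= L/d, |x|^2 <= 8 * L + 2 * R^2 and |t| <= L + R,
    where the additive constants are multiplied by L/d.\<close>
  define k where "k = 1 / d + 2 * R\<^sup>2 / d + 8 + R / d + 1"
  have k: "k > 0" "1 / d \<le> k" "2 * R\<^sup>2 / d + 8 \<le> k" "R / d + 1 \<le> k"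
  proof -
    have "1 / d > 0" "2 * R\<^sup>2 / d \<ge> 0" "R / d \<ge> 0" using R d by auto
    then show "k > 0" "1 / d \<le> k" "2 * R\<^sup>2 / d + 8 \<le> k" "R / d + 1 \<le> k"
      unfolding k_def by linarith+
  qed
  have "L powr (- p) \<le> 3 * k powr p / pweight p (x, t)"
    if x0: "norm x0 \<le> R" and t0: "\<bar>t0\<bar> \<le> R" and L: "L \<ge> d" "(norm (x - x0))\<^sup>2 / 4 \<le> L" "\<bar>t0 - t\<bar> \<le> L"
    for x0 x :: 'a and t0 t L
  proof -
    have L0: "L > 0" using L d by linarith
    have dL: "1 \<le> L / d" using L d by simp
    have "1 \<le> (1 / d) * L" using dL by simp
    also have "\<dots> \<le> k * L" using k L0 by (intro mult_right_mono) auto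
    finally have 1: "1 \<le> (k * L) powr p" using p by (intro ge_one_powr_ge_zero) auto
    have "(norm x)\<^sup>2 \<le> (norm (x - x0) + R)\<^sup>2"
      using norm_triangle_sub[of x x0] x0 by (intro power_mono) auto
    also have "\<dots> \<le> 2 * (norm (x - x0))\<^sup>2 + 2 * R\<^sup>2"
      using zero_le_power2[of "norm (x - x0) - R"] by (simp add: power2_eq_square algebra_simps)
    also have "\<dots> \<le> 8 * L + 2 * R\<^sup>2 * (L / d)"
      using L(2) mult_left_mono[OF dL, of "2 * R\<^sup>2"] by simp
    also have "\<dots> = (2 * R\<^sup>2 / d + 8) * L" by (simp add: algebra_simps)
    also have "\<dots> \<le> k * L" using k L0 by (intro mult_right_mono) auto
    finally have "((norm x)\<^sup>2) powr p \<le> (k * L) powr p" using p by (intro powr_mono2) auto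
    moreover have "((norm x)\<^sup>2) powr p = norm x powr (2 * p)"
      by (cases "norm x = 0") (simp_all add: powr_powr flip: powr_numeral)
    ultimately have 2: "norm x powr (2 * p) \<le> (k * L) powr p" by simp
    have "\<bar>t\<bar> \<le> L + R" using L(3) t0 by linarith
    also have "\<dots> \<le> L + R * (L / d)" using mult_left_mono[OF dL, of R] R by simp
    also have "\<dots> = (R / d + 1) * L" by (simp add: algebra_simps)
    also have "\<dots> \<le> k * L" using k L0 by (intro mult_right_mono) auto
    finally have 3: "\<bar>t\<bar> powr p \<le> (k * L) powr p" using p by (intro powr_mono2) auto
    have "pweight p (x, t) \<le> 3 * (k * L) powr p"
      using 1 2 3 by (simp add: pweight_def)
    also have "\<dots> = 3 * k powr p * L powr p" using k L0 by (simp add: powr_mult)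
    finally have "L powr (- p) * pweight p (x, t) \<le> L powr (- p) * (3 * k powr p * L powr p)"
      by (intro mult_left_mono) auto
    also have "\<dots> = 3 * k powr p" using L0 by (simp add: powr_minus)
    finally show ?thesis by (simp add: pos_le_divide_eq)
  qed
  moreover have "3 * k powr p > 0" using k by simp
  ultimately show ?thesis by blast
qed

lemma heat_E_le_parabolic:
  assumes "p \<ge> 0"
  shows "\<exists>C\<ge>0. \<forall>(x0::'a::euclidean_space) t0 T x t. T > 0 \<longrightarrow> t < t0 \<longrightarrow>
    heat_E x0 t0 0 (- p) T (x, t) \<le> C * ((norm (x - x0))\<^sup>2 / 4 + T + (t0 - t)) powr (- p)"
proof -
  obtain C where C: "C \<ge> 0" "\<And>v r. v > 0 \<Longrightarrow> r > 0 \<Longrightarrow>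
      (v / r) powr 0 * (r powr (- p) * exp (- (v / r))) \<le> C * (v + r) powr (- p)"
    using powr_times_exp_neg_inverse_le[of 0 p] by force
  have "heat_E x0 t0 0 (- p) T (x, t) \<le> C * ((norm (x - x0))\<^sup>2 / 4 + T + (t0 - t)) powr (- p)"
    if "T > 0" "t < t0" for x0 x :: 'a and t0 T t
  proof -
    have v: "(norm (x - x0))\<^sup>2 / 4 + T > 0" using that by (simp add: add_nonneg_pos)
    \<comment> \<open>\<open>0 powr 0\<close> is 0, so the factor with exponent 0 equals 1 only
      because its base is nonzero.\<close>
    then have "(norm (x - x0))\<^sup>2 / 4 + T \<noteq> 0" by simp
    then show ?thesis using C(2)[OF v, of "t0 - t"] that by (simp add: heat_E_def)
  qed
  then show ?thesis using C(1) by blast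
qed

lemma heat_E_le_weight:
  assumes p: "p > 0" and R: "R \<ge> 0" and d: "d > 0"
  shows "\<exists>C>0. \<forall>(x0::'a::euclidean_space) t0 T x t. norm x0 \<le> R \<longrightarrow> \<bar>t0\<bar> \<le> R \<longrightarrow> T \<ge> d \<longrightarrow>
    heat_E x0 t0 0 (- p) T (x, t) \<le> C / pweight p (x, t)"
proof -
  obtain C where C: "C \<ge> 0" "\<And>(x0::'a) t0 T x t. T > 0 \<Longrightarrow> t < t0 \<Longrightarrow>
    heat_E x0 t0 0 (- p) T (x, t) \<le> C * ((norm (x - x0))\<^sup>2 / 4 + T + (t0 - t)) powr (- p)"
    using heat_E_le_parabolic[OF less_imp_le[OF p], where 'a = 'a] by blast
  obtain D where D: "D > 0" "\<And>(x0::'a) t0 x t L. norm x0 \<le> R \<Longrightarrow> \<bar>t0\<bar> \<le> R \<Longrightarrow> L \<ge> d \<Longrightarrow>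
     (norm (x - x0))\<^sup>2 / 4 \<le> L \<Longrightarrow> \<bar>t0 - t\<bar> \<le> L \<Longrightarrow> L powr (- p) \<le> D / pweight p (x, t)"
    using pweight_le[OF assms, where 'a = 'a] by blast
  have "heat_E x0 t0 0 (- p) T (x, t) \<le> (C * D + 1) / pweight p (x, t)"
    if x0: "norm x0 \<le> R" "\<bar>t0\<bar> \<le> R" "T \<ge> d" for x0 x :: 'a and t0 T t
  proof (cases "t < t0")
    case True
    let ?L = "(norm (x - x0))\<^sup>2 / 4 + T + (t0 - t)"
    have "heat_E x0 t0 0 (- p) T (x, t) \<le> C * ?L powr (- p)" using C(2) that d True by simp
    also have "\<dots> \<le> C * (D / pweight p (x, t))"
    proof (intro mult_left_mono D(2) C(1))
      have "0 \<le> (norm (x - x0))\<^sup>2 / 4" by simp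
      then show "d \<le> ?L" "(norm (x - x0))\<^sup>2 / 4 \<le> ?L" "\<bar>t0 - t\<bar> \<le> ?L"
        using that d True by linarith+
    qed (use that in auto)
    also have "\<dots> \<le> (C * D + 1) / pweight p (x, t)"
      by (simp add: divide_right_mono less_imp_le)
    finally show ?thesis .
  next
    case False
    then show ?thesis using C D by (simp add: heat_E_def less_imp_le)
  qed
  moreover have "C * D + 1 > 0" using C D by (simp add: add_nonneg_pos)
  ultimately show ?thesis by blast
qed

text \<open>Dominated convergence with the majorant C * |v| / W. Every limit taken below under the
  pairing with u is an instance with W = \<open>pweight p\<close>.\<close>

lemma
  fixes v W :: "'a::euclidean_space \<Rightarrow> real"
  assumes v [measurable]: "v \<in> borel_measurable borel" and int: "integrable lborel (\<lambda>z. \<bar>v z\<bar> / W z)"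
  shows integrable_mult_weighted: "\<And>q C. q \<in> borel_measurable borel \<Longrightarrow> (\<And>z. \<bar>q z\<bar> \<le> C / W z) \<Longrightarrow>
      integrable lborel (\<lambda>z. v z * q z)"
    and tendsto_integral_mult_weighted: "\<And>K q C. (\<And>i::nat. K i \<in> borel_measurable borel) \<Longrightarrow>
      q \<in> borel_measurable borel \<Longrightarrow> (\<And>i z. \<bar>K i z\<bar> \<le> C / W z) \<Longrightarrow>
      (AE z in lborel. (\<lambda>i. K i z) \<longlonglongrightarrow> q z) \<Longrightarrow>
      (\<lambda>i. LINT z|lborel. v z * K i z) \<longlonglongrightarrow> (LINT z|lborel. v z * q z)"
proof -
  have le: "norm (v z * k) \<le> C * (\<bar>v z\<bar> / W z)" if "\<bar>k\<bar> \<le> C / W z" for z k C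
    using mult_left_mono[OF that, of "\<bar>v z\<bar>"] by (simp add: abs_mult mult.commute)
  have i: "integrable lborel (\<lambda>z. C * (\<bar>v z\<bar> / W z))" for C by (intro integrable_mult_right int)
  show "integrable lborel (\<lambda>z. v z * q z)"
    if [measurable]: "q \<in> borel_measurable borel" and "\<And>z. \<bar>q z\<bar> \<le> C / W z" for q C
  proof (rule Bochner_Integration.integrable_bound[OF i[of C]])
    show "AE z in lborel. norm (v z * q z) \<le> norm (C * (\<bar>v z\<bar> / W z))"
      by (intro AE_I2 order_trans[OF le[OF that(2)]]) (simp only: real_norm_def abs_ge_self)
  qed measurable
  show "(\<lambda>i. LINT z|lborel. v z * K i z) \<longlonglongrightarrow> (LINT z|lborel. v z * q z)"
    if [measurable]: "\<And>i::nat. K i \<in> borel_measurable borel" "q \<in> borel_measurable borel"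
      and bound: "\<And>i z. \<bar>K i z\<bar> \<le> C / W z" and lim: "AE z in lborel. (\<lambda>i. K i z) \<longlonglongrightarrow> q z" for K q C
  proof (rule integral_dominated_convergence[OF _ _ i[of C]])
    show "AE z in lborel. (\<lambda>i. v z * K i z) \<longlonglongrightarrow> v z * q z"
      using lim by eventually_elim (rule tendsto_mult_left)
    show "AE z in lborel. norm (v z * K i z) \<le> C * (\<bar>v z\<bar> / W z)" for i
      by (intro AE_I2 le bound)
  qed measurable
qed

section \<open>Mean values over the parabolic past\<close>


lemma borel_measurable_heat_E [measurable]: "heat_E x0 t0 e a T \<in> borel_measurable borel"
  unfolding heat_E_def split_beta borel_prod[symmetric] by measurable

lemma borel_measurable_fst_borel [measurable]:
    "fst \<in> borel_measurable (borel :: ('a::euclidean_space \<times> 'b::euclidean_space) measure)"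
  and borel_measurable_snd_borel [measurable]:
    "snd \<in> borel_measurable (borel :: ('a::euclidean_space \<times> 'b::euclidean_space) measure)"
  by (intro borel_measurable_continuous_onI continuous_intros)+

lemma integrable_times_heat_E:
  fixes v :: "'a::euclidean_space \<times> real \<Rightarrow> real"
  assumes p: "p > 0" and v [measurable]: "v \<in> borel_measurable borel"
    and int: "integrable lborel (\<lambda>z. \<bar>v z\<bar> / pweight p z)" and T: "T > 0"
  shows "integrable lborel (\<lambda>z. v z * heat_E x0 t0 0 (- p) T z)"
proof -
  define R where "R = max (norm x0) \<bar>t0\<bar>"
  have R: "R \<ge> 0" "norm x0 \<le> R" "\<bar>t0\<bar> \<le> R" by (auto simp: R_def)
  obtain C where C: "C > 0" "\<And>x t. heat_E x0 t0 0 (- p) T (x, t) \<le> C / pweight p (x, t)"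
    using heat_E_le_weight[OF p R(1) T, where 'a = 'a] R(2,3) by blast
  have "\<bar>heat_E x0 t0 0 (- p) T z\<bar> \<le> C / pweight p z" for z
    using C(2)[of "fst z" "snd z"] by simp
  then show ?thesis by (intro integrable_mult_weighted[OF v int]) auto
qed

lemma borel_measurable_heat_profile [measurable]:
  "(\<lambda>z. heat_profile x0 (t0 - snd z) (fst z)) \<in> borel_measurable borel"
  unfolding heat_profile_def by measurable

lemma heat_profile_nonneg [simp]: "heat_profile x0 r x \<ge> 0"
  by (simp add: heat_profile_def)

lemma heat_E_eq_heat_profile:
  fixes x :: "'a::euclidean_space"
  assumes "t < t0"
  shows "heat_E x0 t0 e a T (x, t) = heat_profile x0 (t0 - t) x *
    ((t0 - t) powr (a + real DIM('a) / 2) * exp (- (T / (t0 - t))) * exp (- (e * (t0 - t))))"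
proof -
  define r where "r = t0 - t"
  have "heat_E x0 t0 e a T (x, t) = r powr a * exp (- (((norm (x - x0))\<^sup>2 / 4 + T) / r) - e * r)"
    using assms by (simp add: heat_E_def r_def)
  also have "r powr a = r powr (- (real DIM('a) / 2)) * r powr (a + real DIM('a) / 2)"
    by (simp flip: powr_add)
  also have "exp (- (((norm (x - x0))\<^sup>2 / 4 + T) / r) - e * r) =
      exp (- ((norm (x - x0))\<^sup>2 / (4 * r))) * (exp (- (T / r)) * exp (- (e * r)))"
    by (simp add: add_divide_distrib flip: exp_add)
  finally show ?thesis unfolding heat_profile_def r_def[symmetric] by (simp only: mult_ac)
qed

text \<open>The exponent s - 1 - d is the r^(s-1) of the density times the r^(-d) of the heat
  kernel. The right operator looks only at later times, so the image of a function vanishing after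
  t0 vanishes there too.\<close>

lemma frac_heat_right_damped:
  fixes x0 x :: "real ^ 'n::finite"
  assumes s: "0 < s" "s < 1" and T: "0 < T1" "T1 < T2" and e: "e > 0"
  defines "d \<equiv> real CARD('n) / 2"
  shows "frac_heat_right s (\<lambda>z. complex_of_real
      (heat_E x0 t0 e (s - 1 - d) T1 z - heat_E x0 t0 e (s - 1 - d) T2 z)) (x, t) =
    complex_of_real (frac_heat_const CARD('n) s * 2 ^ CARD('n) * gauss_mass TYPE(real ^ 'n) *
      (levy_const s * exp (- (e * (t0 - t))) *
        (T1 powr s * heat_E x0 t0 0 (- (d + 1 + s)) T1 (x, t) - T2 powr s * heat_E x0 t0 0 (- (d + 1 + s)) T2 (x, t))
       - (if t < t0 then heat_profile x0 (t0 - t) x * damping_error s T1 T2 e (t0 - t) else 0)))"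
proof -
  define A where "A r = exp (- (e * r)) * levy_diff s T1 T2 r" for r
  have A0: "A r = 0" if "r \<le> 0" for r using that by (simp add: A_def)
  have f: "heat_E x0 t0 e (s - 1 - d) T1 z - heat_E x0 t0 e (s - 1 - d) T2 z =
    (\<lambda>(x, t). heat_profile x0 (t0 - t) x * A (t0 - t)) z" for z
  proof (cases z)
    case (Pair x t)
    show ?thesis
    proof (cases "t < t0")
      case True
      show ?thesis unfolding Pair heat_E_eq_heat_profile[OF True]
        using True by (simp add: A_def levy_diff_def levy_density_def d_def algebra_simps)
    qed (simp add: Pair heat_E_def A_def)
  qed
  have K: "heat_E x0 t0 0 (- (d + 1 + s)) T (x, t) =
      heat_profile x0 (t0 - t) x * ((t0 - t) powr (- 1 - s) * exp (- (T / (t0 - t))))" if "t < t0" for T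
  proof -
    have "- (d + 1 + s) + real DIM(real ^ 'n) / 2 = - 1 - s" by (simp add: d_def)
    then show ?thesis unfolding heat_E_eq_heat_profile[OF that] by simp
  qed
  have "heat_profile x0 (t0 - t) x * (LINT y:{0<..}|lborel. (A (t0 - t) - A (t0 - t - y)) / y powr (1 + s)) =
      levy_const s * exp (- (e * (t0 - t))) *
        (T1 powr s * heat_E x0 t0 0 (- (d + 1 + s)) T1 (x, t) - T2 powr s * heat_E x0 t0 0 (- (d + 1 + s)) T2 (x, t))
       - (if t < t0 then heat_profile x0 (t0 - t) x * damping_error s T1 T2 e (t0 - t) else 0)"
  proof (cases "t < t0")
    case True
    then have r: "t0 - t > 0" by simp
    show ?thesis unfolding A_def LBINT_marchaud_damped[OF s T e r] K[OF True]
      using True by (simp add: algebra_simps)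
  next
    case False
    have "(LINT y:{0<..}|lborel. (A (t0 - t) - A (t0 - t - y)) / y powr (1 + s)) =
        (LINT y::real|lborel. (0::real))"
      unfolding set_lebesgue_integral_def
      by (intro Bochner_Integration.integral_cong) (use False in \<open>auto simp: A0 indicator_def\<close>)
    then show ?thesis using False by (simp add: heat_E_def)
  qed
  then show ?thesis
    unfolding f using frac_heat_right_gaussian[of A s x0 t0 x t, OF A0]
    by (simp add: mult.assoc)
qed

text \<open>The point is the passage to the limit e -> 0: the main part and the commutator both stay
  below a fixed multiple of 1 / \<open>pweight\<close>, and the commutator tends to 0 pointwise,
  while the pairing is 0 for every e.\<close>

lemma mean_value_identity:
  fixes u v :: "(real ^ 'n::finite) \<times> real \<Rightarrow> real"
  assumes s: "0 < s" "s < 1" and T: "0 < T1" "T1 < T2"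
    and u: "frac_heat_distr_solution s u" and um: "u \<in> borel_measurable lebesgue"
    and v [measurable]: "v \<in> borel_measurable borel" and uv: "AE z in lebesgue. u z = v z"
    and int: "integrable lborel (\<lambda>z. \<bar>v z\<bar> / pweight (real CARD('n) / 2 + 1 + s) z)"
  shows "T1 powr s * (LINT z|lborel. v z * heat_E x0 t0 0 (- (real CARD('n) / 2 + 1 + s)) T1 z) =
    T2 powr s * (LINT z|lborel. v z * heat_E x0 t0 0 (- (real CARD('n) / 2 + 1 + s)) T2 z)"
proof -
  define d where "d = real CARD('n) / 2"
  define p where "p = d + 1 + s"
  have p: "p > 0" using s by (simp add: p_def d_def add_nonneg_pos)
  define c where "c = frac_heat_const CARD('n) s * 2 ^ CARD('n) * gauss_mass TYPE(real ^ 'n)"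
  have c: "c \<noteq> 0"
  proof -
    \<comment> \<open>\<open>Gamma\<close> is 0 at its poles by convention, so the claim is that -
      s, which lies strictly between - 1 and 0, is not an integer.\<close>
    have "Gamma (- s) \<noteq> 0"
    proof
      assume "Gamma (- s) = 0"
      then obtain n where "- s = real_of_int n" by (auto simp: Gamma_eq_zero_iff nonpos_Ints_def)
      then have "real_of_int n < 0" "real_of_int (- 1) < real_of_int n" using s by auto
      then show False by (simp only: of_int_less_iff of_int_less_0_iff)
    qed
    then show ?thesis using gauss_mass_pos[where 'a = "real ^ 'n"] by (simp add: c_def frac_heat_const_def)
  qed
  let ?K = "heat_E x0 t0 0 (- p)"
  define F where "F e = (\<lambda>(x, t). c * (levy_const s * exp (- (e * (t0 - t))) *
        (T1 powr s * ?K T1 (x, t) - T2 powr s * ?K T2 (x, t))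
       - (if t < t0 then heat_profile x0 (t0 - t) x * damping_error s T1 T2 e (t0 - t) else 0)))" for e
  have F_meas [measurable]: "F e \<in> borel_measurable borel" for e
    unfolding F_def split_beta prod.collapse by measurable
  have F0: "(LINT z|lborel. v z * F e z) = 0" if e: "e > 0" for e
  proof -
    let ?\<phi> = "\<lambda>z. heat_E x0 t0 e (s - 1 - d) T1 z + (- 1) * heat_E x0 t0 e (s - 1 - d) T2 z"
    have "?\<phi> \<in> heat_span x0 t0 e" using T by (intro heat_span.add heat_span.scale heat_span.base) auto
    then have "(\<lambda>z. complex_of_real (?\<phi> z)) \<in> schwartz" using e by (rule heat_span_schwartz)
    then have "(LINT z|lebesgue. complex_of_real (u z) * cnj (frac_heat_right s (\<lambda>z. complex_of_real (?\<phi> z)) z)) = 0"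
      using u unfolding frac_heat_distr_solution_def by blast
    moreover have "frac_heat_right s (\<lambda>z. complex_of_real (?\<phi> z)) z = complex_of_real (F e z)" for z
      using frac_heat_right_damped[OF s T e, of x0 t0 "fst z" "snd z"]
      by (simp add: F_def c_def d_def p_def split_beta)
    ultimately have "(LINT z|lebesgue. complex_of_real (u z * F e z)) = 0" by simp
    then have "(LINT z|lebesgue. u z * F e z) = 0"
      unfolding integral_complex_of_real by simp
    moreover have "(LINT z|lebesgue. u z * F e z) = (LINT z|lebesgue. v z * F e z)"
    proof (rule integral_cong_AE)
      show "AE z in lebesgue. u z * F e z = v z * F e z" using uv by eventually_elim simp
      have "v \<in> borel_measurable lebesgue" using measurable_completion[of v lborel borel] by simp
      moreover have FM: "F e \<in> borel_measurable lebesgue" using measurable_completion[of "F e" lborel borel] by simp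
      ultimately show "(\<lambda>z. v z * F e z) \<in> borel_measurable lebesgue" by (rule borel_measurable_times)
      show "(\<lambda>z. u z * F e z) \<in> borel_measurable lebesgue" using um FM by (rule borel_measurable_times)
    qed
    moreover have "(LINT z|lebesgue. v z * F e z) = (LINT z|lborel. v z * F e z)"
      by (rule integral_completion) simp
    ultimately show ?thesis by simp
  qed
  define R where "R = max (norm x0) \<bar>t0\<bar>"
  have R: "R \<ge> 0" "norm x0 \<le> R" "\<bar>t0\<bar> \<le> R" by (auto simp: R_def)
  obtain C1 where C1: "C1 \<ge> 0" "\<And>e r. e > 0 \<Longrightarrow> r > 0 \<Longrightarrow>
      \<bar>damping_error s T1 T2 e r\<bar> \<le> C1 * (r powr (- 1 - s) * exp (- (T1 / 2 / r)))"
    using abs_damping_error_le[OF s T] by blast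
  \<comment> \<open>The bound on the commutator carries T1/2 in place of T1, so the weight estimate
    is taken for all T >= T1/2.\<close>
  have T': "T1 / 2 > 0" using T by simp
  obtain C2 where C2: "C2 > 0" "\<And>T x t. T \<ge> T1 / 2 \<Longrightarrow> ?K T (x, t) \<le> C2 / pweight p (x, t)"
    using heat_E_le_weight[OF p R(1) T', where 'a = "real ^ 'n"] R(2,3) by blast
  have G: "\<bar>F e (x, t)\<bar> \<le> \<bar>c\<bar> * (levy_const s * (T1 powr s + T2 powr s) + C1) * C2 / pweight p (x, t)"
    if e: "e > 0" for e x t
  proof (cases "t < t0")
    case True
    define r where "r = t0 - t"
    have r: "r > 0" using True by (simp add: r_def)
    define Q where "Q = C2 / pweight p (x, t)"
    let ?G = "heat_profile x0 r x"
    have k: "0 \<le> ?K T1 (x, t)" "?K T1 (x, t) \<le> Q" "0 \<le> ?K T2 (x, t)" "?K T2 (x, t) \<le> Q"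
      using C2(2) T by (auto simp: Q_def)
    have "\<bar>T1 powr s * ?K T1 (x, t) - T2 powr s * ?K T2 (x, t)\<bar> \<le> T1 powr s * ?K T1 (x, t) + T2 powr s * ?K T2 (x, t)"
      using k by (intro order_trans[OF abs_triangle_ineq4]) (simp add: abs_mult)
    also have "\<dots> \<le> T1 powr s * Q + T2 powr s * Q"
      using k by (intro add_mono mult_left_mono) auto
    finally have 1: "\<bar>T1 powr s * ?K T1 (x, t) - T2 powr s * ?K T2 (x, t)\<bar> \<le> (T1 powr s + T2 powr s) * Q"
      by (simp add: algebra_simps)
    have 2: "\<bar>levy_const s * exp (- (e * r)) * (T1 powr s * ?K T1 (x, t) - T2 powr s * ?K T2 (x, t))\<bar>
        \<le> levy_const s * 1 * ((T1 powr s + T2 powr s) * Q)"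
      unfolding abs_mult using 1 levy_const_pos[OF s] e r by (intro mult_mono) auto
    have "?G * \<bar>damping_error s T1 T2 e r\<bar> \<le> ?G * (C1 * (r powr (- 1 - s) * exp (- (T1 / 2 / r))))"
      using C1(2)[OF e r] by (intro mult_left_mono) auto
    also have "\<dots> = C1 * ?K (T1 / 2) (x, t)"
    proof -
      have "- p + real DIM(real ^ 'n) / 2 = - 1 - s" by (simp add: p_def d_def)
      then show ?thesis unfolding heat_E_eq_heat_profile[OF True] r_def by simp
    qed
    also have "\<dots> \<le> C1 * Q" using C1(1) C2(2)[of "T1 / 2" x t] unfolding Q_def by (intro mult_left_mono) auto
    finally have 3: "?G * \<bar>damping_error s T1 T2 e r\<bar> \<le> C1 * Q" .
    have "F e (x, t) = c * (levy_const s * exp (- (e * r)) * (T1 powr s * ?K T1 (x, t) - T2 powr s * ?K T2 (x, t))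
        - ?G * damping_error s T1 T2 e r)"
      using True by (simp add: F_def r_def)
    also have "\<bar>\<dots>\<bar> \<le> \<bar>c\<bar> * (levy_const s * 1 * ((T1 powr s + T2 powr s) * Q) + C1 * Q)"
      unfolding abs_mult[of c]
      using 2 3 by (intro mult_left_mono order_trans[OF abs_triangle_ineq4] add_mono) (auto simp: abs_mult)
    also have "\<dots> = \<bar>c\<bar> * (levy_const s * (T1 powr s + T2 powr s) + C1) * Q" by (simp add: algebra_simps)
    finally show ?thesis by (simp add: Q_def)
  next
    case False
    then have "F e (x, t) = 0" by (simp add: F_def heat_E_def)
    moreover have "0 \<le> \<bar>c\<bar> * (levy_const s * (T1 powr s + T2 powr s) + C1) * C2 / pweight p (x, t)"
      using C1(1) C2(1) levy_const_pos[OF s] pweight_pos[of p "(x, t)"]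
      by (intro divide_nonneg_pos mult_nonneg_nonneg add_nonneg_nonneg) auto
    ultimately show ?thesis by simp
  qed
  define B where "B = \<bar>c\<bar> * (levy_const s * (T1 powr s + T2 powr s) + C1) * C2"
  define e where "e i = 1 / real (Suc i)" for i
  have e: "e i > 0" for i by (simp add: e_def)
  have e0: "e \<longlonglongrightarrow> 0" unfolding e_def by (rule LIMSEQ_Suc[OF lim_1_over_n])
  have "(\<lambda>i. LINT z|lborel. v z * F (e i) z) \<longlonglongrightarrow>
      (LINT z|lborel. v z * (c * (levy_const s * (T1 powr s * ?K T1 z - T2 powr s * ?K T2 z))))"
  proof (rule tendsto_integral_mult_weighted[OF v int[folded d_def, folded p_def]])
    show "AE z in lborel. (\<lambda>i. F (e i) z) \<longlonglongrightarrow> c * (levy_const s * (T1 powr s * ?K T1 z - T2 powr s * ?K T2 z))"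
    proof (rule AE_I2)
      fix z :: "(real ^ 'n) \<times> real"
      obtain x t where z: "z = (x, t)" by (cases z)
      show "(\<lambda>i. F (e i) z) \<longlonglongrightarrow> c * (levy_const s * (T1 powr s * ?K T1 z - T2 powr s * ?K T2 z))"
      proof (cases "t < t0")
        case True
        have "(\<lambda>i. damping_error s T1 T2 (e i) (t0 - t)) \<longlonglongrightarrow> 0"
          using True e e0 by (intro tendsto_damping_error[OF s T]) auto
        then have "(\<lambda>i. c * (levy_const s * exp (- (e i * (t0 - t))) * (T1 powr s * ?K T1 z - T2 powr s * ?K T2 z)
            - heat_profile x0 (t0 - t) x * damping_error s T1 T2 (e i) (t0 - t))) \<longlonglongrightarrow>
          c * (levy_const s * exp (- (0 * (t0 - t))) * (T1 powr s * ?K T1 z - T2 powr s * ?K T2 z)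
            - heat_profile x0 (t0 - t) x * 0)"
          by (intro tendsto_intros e0)
        then show ?thesis using True by (simp add: F_def z)
      qed (simp add: F_def z heat_E_def)
    qed
    show "\<bar>F (e i) z\<bar> \<le> B / pweight p z" for i z
      using G[OF e, of i "fst z" "snd z"] by (simp add: B_def)
  qed measurable
  then have "(LINT z|lborel. v z * (c * (levy_const s * (T1 powr s * ?K T1 z - T2 powr s * ?K T2 z)))) = 0"
    unfolding F0[OF e] using LIMSEQ_unique tendsto_const by blast
  moreover have "v z * (c * (levy_const s * (T1 powr s * ?K T1 z - T2 powr s * ?K T2 z))) =
      (c * levy_const s) * (T1 powr s * (v z * ?K T1 z) - T2 powr s * (v z * ?K T2 z))" for z
    by (simp add: algebra_simps)
  moreover have iK: "integrable lborel (\<lambda>z. v z * ?K T z)" if "T > 0" for T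
    using integrable_times_heat_E[OF p v _ that] int by (simp add: p_def d_def)
  ultimately have "c * levy_const s * (T1 powr s * (LINT z|lborel. v z * ?K T1 z) -
      T2 powr s * (LINT z|lborel. v z * ?K T2 z)) = 0"
    using iK[of T1] iK[of T2] T by simp
  then show ?thesis using c levy_const_pos[OF s] by (simp add: p_def d_def)
qed

section \<open>Differences of mean values\<close>


text \<open>With v = |x - x0|^2/4 + T the left side is (v/r) powr k times the kernel of exponent -
  p: each extra 1/r produced by a derivative is matched by a factor v. Of the two bounds in the
  minimum, 1 / \<open>pweight\<close> is the integrable majorant and T powr (- p) gives pointwise
  decay as T grows.\<close>

lemma heat_E_decay_bound:
  assumes p: "p > 0" and R: "R \<ge> 0" and k: "k \<ge> 0"
  shows "\<exists>B\<ge>0. \<forall>(x0::'a::euclidean_space) t0 T x t. norm x0 \<le> R \<longrightarrow> \<bar>t0\<bar> \<le> R \<longrightarrow> T \<ge> 1 \<longrightarrow>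
    ((norm (x - x0))\<^sup>2 / 4 + T) powr k * heat_E x0 t0 0 (- p - k) T (x, t)
      \<le> B * min (1 / pweight p (x, t)) (T powr (- p))"
proof -
  obtain C where C: "C \<ge> 0" "\<And>v r. v > 0 \<Longrightarrow> r > 0 \<Longrightarrow>
      (v / r) powr k * (r powr (- p) * exp (- (v / r))) \<le> C * (v + r) powr (- p)"
    using powr_times_exp_neg_inverse_le[OF k, of p] by blast
  obtain D where D: "D > 0" "\<And>(x0::'a) t0 x t L. norm x0 \<le> R \<Longrightarrow> \<bar>t0\<bar> \<le> R \<Longrightarrow> L \<ge> 1 \<Longrightarrow>
     (norm (x - x0))\<^sup>2 / 4 \<le> L \<Longrightarrow> \<bar>t0 - t\<bar> \<le> L \<Longrightarrow> L powr (- p) \<le> D / pweight p (x, t)"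
    using pweight_le[OF p R zero_less_one, where 'a = 'a] by blast
  have "((norm (x - x0))\<^sup>2 / 4 + T) powr k * heat_E x0 t0 0 (- p - k) T (x, t)
      \<le> (C * (D + 1)) * min (1 / pweight p (x, t)) (T powr (- p))"
    if x0: "norm x0 \<le> R" "\<bar>t0\<bar> \<le> R" "T \<ge> 1" for x0 x :: 'a and t0 T t
  proof (cases "t < t0")
    case True
    define r v where "r = t0 - t" and "v = (norm (x - x0))\<^sup>2 / 4 + T"
    have n: "0 \<le> (norm (x - x0))\<^sup>2 / 4" by simp
    then have v: "v \<ge> T" "(norm (x - x0))\<^sup>2 / 4 \<le> v" "v > 0" using x0 unfolding v_def by linarith+
    have r: "r > 0" using True by (simp add: r_def)
    have "v powr k * heat_E x0 t0 0 (- p - k) T (x, t) = (v / r) powr k * (r powr (- p) * exp (- (v / r)))"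
      using True v r by (simp add: heat_E_def r_def[symmetric] v_def[symmetric] powr_diff powr_divide)
    also have "\<dots> \<le> C * (v + r) powr (- p)" using C(2)[OF v(3) r] .
    also have "\<dots> \<le> C * ((D + 1) * min (1 / pweight p (x, t)) (T powr (- p)))"
    proof (intro mult_left_mono C(1))
      have 1: "(v + r) powr (- p) \<le> D / pweight p (x, t)"
        using x0 v r by (intro D(2)[of x0 t0]) (auto simp: r_def)
      also have "\<dots> \<le> (D + 1) / pweight p (x, t)"
        by (intro divide_right_mono) (auto simp: less_imp_le)
      finally have 1: "(v + r) powr (- p) \<le> (D + 1) * (1 / pweight p (x, t))" by simp
      have "(v + r) powr (- p) \<le> T powr (- p)"
        using v r x0 p by (intro powr_mono2') auto
      also have "\<dots> \<le> (D + 1) * T powr (- p)" using D(1) by (simp add: mult_le_cancel_right1)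
      finally show "(v + r) powr (- p) \<le> (D + 1) * min (1 / pweight p (x, t)) (T powr (- p))"
        using 1 by (simp add: min_def)
    qed
    finally show ?thesis by (simp add: v_def mult.assoc)
  next
    case False
    then have "heat_E x0 t0 0 (- p - k) T (x, t) = 0" by (simp add: heat_E_def)
    moreover have "0 \<le> min (1 / pweight p (x, t)) (T powr (- p))"
      using pweight_pos[of p "(x, t)"] by (simp add: less_imp_le)
    ultimately show ?thesis using C(1) D(1) by simp
  qed
  moreover have "C * (D + 1) \<ge> 0" using C(1) D(1) by simp
  ultimately show ?thesis by blast
qed

section \<open>Dependence of the kernel on its centre\<close>

lemma heat_E_shift:
  "heat_E (x0 + h) (t0 + c) e a T (x, t) = heat_E x0 t0 e a T (x - h, t - c)"
  by (simp add: heat_E_def algebra_simps)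

lemma heat_E_eq_shift_origin: "heat_E (fst z0) (snd z0) e a T z = heat_E 0 0 e a T (z - z0)"
  by (cases z; cases z0) (simp add: heat_E_def)

lemma DERIV_heat_E_center:
  fixes x0 h x :: "'a::euclidean_space" and t0 c t :: real
  assumes "T > 0"
  defines "E \<equiv> \<lambda>b u. heat_E (x0 + u *\<^sub>R h) (t0 + u * c) 0 b T (x, t)"
  shows "DERIV (E a) u :> ((x - (x0 + u *\<^sub>R h)) \<bullet> h) / 2 * E (a - 1) u +
      c * (a * E (a - 1) u + ((norm (x - (x0 + u *\<^sub>R h)))\<^sup>2 / 4 + T) * E (a - 2) u)"
proof -
  let ?l = "\<lambda>u. (x - u *\<^sub>R h, t - u * c)"
  have l: "(?l has_derivative (\<lambda>\<delta>. (- (\<delta> *\<^sub>R h), - (\<delta> * c)))) (at u)"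
    by (rule has_derivative_eq_rhs, (rule derivative_intros)+) auto
  have EE: "E b u = heat_E x0 t0 0 b T (?l u)" for b u by (simp add: E_def heat_E_shift)
  have d: "x - u *\<^sub>R h - x0 = x - (x0 + u *\<^sub>R h)" by simp
  have "((\<lambda>u. heat_E x0 t0 0 a T (?l u)) has_derivative (\<lambda>\<delta>.
      - ((x - u *\<^sub>R h - x0) \<bullet> - (\<delta> *\<^sub>R h)) / 2 * heat_E x0 t0 0 (a - 1) T (?l u)
           - - (\<delta> * c) * (a * heat_E x0 t0 0 (a - 1) T (?l u)
               + ((norm (x - u *\<^sub>R h - x0))\<^sup>2 / 4 + T) * heat_E x0 t0 0 (a - 2) T (?l u)
               - 0 * heat_E x0 t0 0 a T (?l u)))) (at u)"
    using has_derivative_compose[OF l has_derivative_heat_E[OF assms(1) order_refl]] by simp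
  then show ?thesis
    unfolding has_field_derivative_def EE[abs_def] d
    by (rule has_derivative_eq_rhs) (simp add: fun_eq_iff algebra_simps)
qed

lemma inner_half_le:
  fixes y h :: "'a::real_inner"
  assumes "T \<ge> 0"
  shows "\<bar>y \<bullet> h\<bar> / 2 \<le> norm h * sqrt ((norm y)\<^sup>2 / 4 + T)"
proof -
  have "norm y / 2 = sqrt ((norm y)\<^sup>2 / 4)" by (simp add: real_sqrt_divide)
  also have "\<dots> \<le> sqrt ((norm y)\<^sup>2 / 4 + T)" using assms by simp
  finally have "norm h * (norm y / 2) \<le> norm h * sqrt ((norm y)\<^sup>2 / 4 + T)"
    by (intro mult_left_mono) auto
  then show ?thesis using Cauchy_Schwarz_ineq2[of y h] by (simp add: mult.commute)
qed

text \<open>Mean value theorem along a segment of centres. A time derivative produces 1/r and v/r^2,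
  both worth 1/v <= 1/T. A space derivative produces (x - x0) . h / (2 r), and |(x - x0) . h| / 2 <=
  |h| * sqrt v, so it is worth only v powr (- 1/2). The second difference in space thus gains as
  much as the first difference in time.\<close>

lemma heat_E_differences:
  fixes x0 h :: "'a::euclidean_space"
  assumes p: "p > 0"
  shows "\<exists>B\<ge>0. \<forall>T\<ge>1. \<forall>z.
      \<bar>heat_E x0 (t0 + c) 0 (- p) T z - heat_E x0 t0 0 (- p) T z\<bar>
        \<le> B * (T powr (- 1) * min (1 / pweight p z) (T powr (- p)))" (is ?th1)
    and "\<exists>B\<ge>0. \<forall>T\<ge>1. \<forall>z.
      \<bar>heat_E (x0 + h) t0 0 (- p) T z - heat_E x0 t0 0 (- p) T z\<bar>
        \<le> B * (T powr (- 1 / 2) * min (1 / pweight p z) (T powr (- p)))" (is ?th2)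
    and "\<exists>B\<ge>0. \<forall>T\<ge>1. \<forall>z.
      \<bar>heat_E (x0 + h) t0 0 (- p) T z - 2 * heat_E x0 t0 0 (- p) T z + heat_E (x0 - h) t0 0 (- p) T z\<bar>
        \<le> B * (T powr (- 1) * min (1 / pweight p z) (T powr (- p)))" (is ?th3)
proof -
  \<comment> \<open>R bounds every centre with segment parameter |u| <= 1, so one constant serves
    all intermediate points.\<close>
  define R where "R = norm x0 + norm h + \<bar>t0\<bar> + \<bar>c\<bar>"
  have R: "R \<ge> 0" by (simp add: R_def)
  have R1: "norm (x0 + u *\<^sub>R h) \<le> R" "\<bar>t0 + u * c\<bar> \<le> R" if "\<bar>u\<bar> \<le> 1" for u
  proof -
    have "\<bar>u\<bar> * norm h \<le> norm h" "\<bar>u * c\<bar> \<le> \<bar>c\<bar>"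
      using that by (auto simp: mult_left_le_one_le abs_mult)
    then show "norm (x0 + u *\<^sub>R h) \<le> R" "\<bar>t0 + u * c\<bar> \<le> R"
      using norm_triangle_ineq[of x0 "u *\<^sub>R h"] norm_ge_zero[of x0] norm_ge_zero[of h]
      unfolding R_def norm_scaleR by linarith+
  qed
  define m where "m T z = min (1 / pweight p z) (T powr (- p))" for T and z :: "'a \<times> real"
  have m: "m T z \<ge> 0" for T z using pweight_pos[of p z] by (simp add: m_def less_imp_le)
  obtain B1 where B1: "B1 \<ge> 0" "\<And>(x0::'a) t0 T x t. norm x0 \<le> R \<Longrightarrow> \<bar>t0\<bar> \<le> R \<Longrightarrow> T \<ge> 1 \<Longrightarrow>
    ((norm (x - x0))\<^sup>2 / 4 + T) powr 1 * heat_E x0 t0 0 (- p - 1) T (x, t) \<le> B1 * m T (x, t)"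
    using heat_E_decay_bound[OF p R, of 1, where 'a = 'a] unfolding m_def by force
  obtain B2 where B2: "B2 \<ge> 0" "\<And>(x0::'a) t0 T x t. norm x0 \<le> R \<Longrightarrow> \<bar>t0\<bar> \<le> R \<Longrightarrow> T \<ge> 1 \<Longrightarrow>
    ((norm (x - x0))\<^sup>2 / 4 + T) powr 2 * heat_E x0 t0 0 (- p - 2) T (x, t) \<le> B2 * m T (x, t)"
    using heat_E_decay_bound[OF p R, of 2, where 'a = 'a] unfolding m_def by force
  have bounds: "0 \<le> v" "T \<le> v" "v * heat_E y0 s0 0 (- p - 1) T (x, t) \<le> B1 * m T (x, t)"
      "heat_E y0 s0 0 (- p - 1) T (x, t) \<le> B1 * (T powr (- 1) * m T (x, t))"
      "v * heat_E y0 s0 0 (- p - 2) T (x, t) \<le> B2 * (T powr (- 1) * m T (x, t))"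
    if v: "v = (norm (x - y0))\<^sup>2 / 4 + T" and y0: "norm y0 \<le> R" "\<bar>s0\<bar> \<le> R" and T: "T \<ge> 1" for y0 s0 T x t v
  proof -
    have "0 \<le> (norm (x - y0))\<^sup>2 / 4" by simp
    then show vT: "T \<le> v" unfolding v by linarith
    then show v0: "0 \<le> v" using T by linarith
    have vp: "v > 0" using vT T by linarith
    have inv: "1 / v \<le> T powr (- 1)" using vT T by (simp add: powr_minus_divide frac_le)
    show 1: "v * heat_E y0 s0 0 (- p - 1) T (x, t) \<le> B1 * m T (x, t)"
      using B1(2)[OF y0 T, of x t] vp by (simp add: v)
    have 2: "v\<^sup>2 * heat_E y0 s0 0 (- p - 2) T (x, t) \<le> B2 * m T (x, t)"
      using B2(2)[OF y0 T, of x t] vp by (simp add: v)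
    have "heat_E y0 s0 0 (- p - 1) T (x, t) = (1 / v) * (v * heat_E y0 s0 0 (- p - 1) T (x, t))"
      using vp by simp
    also have "\<dots> \<le> T powr (- 1) * (B1 * m T (x, t))"
      by (rule mult_mono[OF inv 1]) (use v0 in auto)
    finally show "heat_E y0 s0 0 (- p - 1) T (x, t) \<le> B1 * (T powr (- 1) * m T (x, t))" by (simp only: mult_ac)
    have "v * heat_E y0 s0 0 (- p - 2) T (x, t) = (1 / v) * (v\<^sup>2 * heat_E y0 s0 0 (- p - 2) T (x, t))"
      using vp by (simp add: power2_eq_square)
    also have "\<dots> \<le> T powr (- 1) * (B2 * m T (x, t))"
      by (rule mult_mono[OF inv 2]) auto
    finally show "v * heat_E y0 s0 0 (- p - 2) T (x, t) \<le> B2 * (T powr (- 1) * m T (x, t))" by (simp only: mult_ac)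
  qed
  have "\<bar>heat_E x0 (t0 + c) 0 (- p) T z - heat_E x0 t0 0 (- p) T z\<bar>
      \<le> (\<bar>c\<bar> * (p * B1 + B2)) * (T powr (- 1) * m T z)" if T: "T \<ge> 1" for T z
  proof -
    obtain x t where z: "z = (x, t)" by (cases z)
    let ?E = "\<lambda>b u. heat_E x0 (t0 + u * c) 0 b T (x, t)"
    let ?v = "(norm (x - x0))\<^sup>2 / 4 + T"
    have D: "DERIV (?E (- p)) u :> c * ((- p) * ?E (- p - 1) u + ?v * ?E (- p - 2) u)" for u
      using DERIV_heat_E_center[of T x0 0 t0 c "- p" x t u] T by simp
    obtain u where u: "0 < u" "u < 1"
      "?E (- p) 1 - ?E (- p) 0 = (1 - 0) * (c * ((- p) * ?E (- p - 1) u + ?v * ?E (- p - 2) u))"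
      using MVT2[of 0 1 "?E (- p)" "\<lambda>u. c * ((- p) * ?E (- p - 1) u + ?v * ?E (- p - 2) u)",
          OF zero_less_one D] by blast
    have r: "norm x0 \<le> R" "\<bar>t0 + u * c\<bar> \<le> R" using R1[of u] u by (auto simp: R_def)
    note b = bounds[OF refl r T, where x = x]
    have "\<bar>(- p) * ?E (- p - 1) u + ?v * ?E (- p - 2) u\<bar> \<le> p * ?E (- p - 1) u + ?v * ?E (- p - 2) u"
      using p b(1) by (intro order_trans[OF abs_triangle_ineq]) (simp add: abs_mult)
    also have "\<dots> \<le> p * (B1 * (T powr (- 1) * m T (x, t))) + B2 * (T powr (- 1) * m T (x, t))"
      using b(4,5) p by (intro add_mono mult_left_mono) auto
    finally have "\<bar>c\<bar> * \<bar>(- p) * ?E (- p - 1) u + ?v * ?E (- p - 2) u\<bar>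
        \<le> \<bar>c\<bar> * (p * (B1 * (T powr (- 1) * m T (x, t))) + B2 * (T powr (- 1) * m T (x, t)))"
      by (intro mult_left_mono) auto
    also have "\<dots> = (\<bar>c\<bar> * (p * B1 + B2)) * (T powr (- 1) * m T z)" by (simp add: z algebra_simps)
    finally have "\<bar>c\<bar> * \<bar>(- p) * ?E (- p - 1) u + ?v * ?E (- p - 2) u\<bar> \<le> \<dots>" .
    moreover have "heat_E x0 (t0 + c) 0 (- p) T z - heat_E x0 t0 0 (- p) T z =
        c * ((- p) * ?E (- p - 1) u + ?v * ?E (- p - 2) u)"
      using u(3) by (simp only: z mult_1 mult_zero_left add_0_right diff_zero)
    ultimately show ?thesis by (simp only: abs_mult)
  qed
  moreover have "\<bar>c\<bar> * (p * B1 + B2) \<ge> 0" using p B1(1) B2(1) by simp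
  ultimately show ?th1 unfolding m_def by blast
  let ?E = "\<lambda>T x t b u. heat_E (x0 + u *\<^sub>R h) t0 0 b T (x, t)"
  have D: "DERIV (?E T x t b) u :> ((x - (x0 + u *\<^sub>R h)) \<bullet> h) / 2 * ?E T x t (b - 1) u"
    if "T \<ge> 1" for T x t b u
    using DERIV_heat_E_center[of T x0 h t0 0 b x t u] that by simp
  have r: "norm (x0 + u *\<^sub>R h) \<le> R" "\<bar>t0\<bar> \<le> R" if "\<bar>u\<bar> \<le> 1" for u
    using R1[OF that] by (auto simp: R_def)
  have "\<bar>heat_E (x0 + h) t0 0 (- p) T z - heat_E x0 t0 0 (- p) T z\<bar>
      \<le> (norm h * B1) * (T powr (- 1 / 2) * m T z)" if T: "T \<ge> 1" for T z
  proof -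
    obtain x t where z: "z = (x, t)" by (cases z)
    obtain u where u: "0 < u" "u < 1"
      "?E T x t (- p) 1 - ?E T x t (- p) 0 = (1 - 0) * (((x - (x0 + u *\<^sub>R h)) \<bullet> h) / 2 * ?E T x t (- p - 1) u)"
      using MVT2[of 0 1 "?E T x t (- p)" "\<lambda>u. ((x - (x0 + u *\<^sub>R h)) \<bullet> h) / 2 * ?E T x t (- p - 1) u",
          OF zero_less_one D[OF T]] by blast
    define v where "v = (norm (x - (x0 + u *\<^sub>R h)))\<^sup>2 / 4 + T"
    have "\<bar>u\<bar> \<le> 1" using u by simp
    note b = bounds[OF v_def r[OF this] T]
    have vp: "v > 0" using b(2) T by linarith
    have "\<bar>(x - (x0 + u *\<^sub>R h)) \<bullet> h\<bar> / 2 * ?E T x t (- p - 1) u \<le> (norm h * sqrt v) * ?E T x t (- p - 1) u"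
      using inner_half_le[of T "x - (x0 + u *\<^sub>R h)" h] T unfolding v_def by (intro mult_right_mono) auto
    also have "\<dots> = norm h * (1 / sqrt v * (v * ?E T x t (- p - 1) u))"
    proof -
      have 1: "v / sqrt v = sqrt v" using vp by (simp add: real_div_sqrt)
      have 2: "1 / sqrt v * (v * X) = (v / sqrt v) * X" for X by simp
      show ?thesis unfolding 2 1 by (simp only: mult.assoc)
    qed
    also have "\<dots> \<le> norm h * (T powr (- 1 / 2) * (B1 * m T (x, t)))"
    proof (rule mult_left_mono, rule mult_mono[OF _ b(3)])
      have "1 / sqrt v \<le> 1 / sqrt T" using b(2) T by (intro divide_left_mono) auto
      also have "1 / sqrt T = T powr (- 1 / 2)"
        using T powr_minus_divide[of T "1 / 2"] by (simp add: powr_half_sqrt)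
      finally show "1 / sqrt v \<le> T powr (- 1 / 2)" .
    qed (use b(1) in auto)
    also have "\<dots> = (norm h * B1) * (T powr (- 1 / 2) * m T z)" by (simp only: z mult_ac)
    finally have "\<bar>(x - (x0 + u *\<^sub>R h)) \<bullet> h\<bar> / 2 * ?E T x t (- p - 1) u \<le> \<dots>" .
    moreover have "heat_E (x0 + h) t0 0 (- p) T z - heat_E x0 t0 0 (- p) T z =
        ((x - (x0 + u *\<^sub>R h)) \<bullet> h) / 2 * ?E T x t (- p - 1) u"
      using u(3) by (simp only: z mult_1 scaleR_one scaleR_zero_left add_0_right diff_zero)
    ultimately show ?thesis by (simp only: abs_mult abs_divide abs_numeral abs_of_nonneg[OF heat_E_nonneg])
  qed
  moreover have "norm h * B1 \<ge> 0" using B1(1) by simp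
  ultimately show ?th2 unfolding m_def by blast
  have "\<bar>heat_E (x0 + h) t0 0 (- p) T z - 2 * heat_E x0 t0 0 (- p) T z + heat_E (x0 - h) t0 0 (- p) T z\<bar>
      \<le> ((norm h)\<^sup>2 * (B1 + B2)) * (T powr (- 1) * m T z)" if T: "T \<ge> 1" for T z
  proof -
    obtain x t where z: "z = (x, t)" by (cases z)
    define F where "F u = ?E T x t (- p) u" for u
    define F' where "F' u = ((x - (x0 + u *\<^sub>R h)) \<bullet> h) / 2 * ?E T x t (- p - 1) u" for u
    define F'' where "F'' u = - (h \<bullet> h) / 2 * ?E T x t (- p - 1) u +
      ((x - (x0 + u *\<^sub>R h)) \<bullet> h) / 2 * (((x - (x0 + u *\<^sub>R h)) \<bullet> h) / 2 * ?E T x t (- p - 2) u)" for u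
    have DF: "DERIV F u :> F' u" for u
      unfolding F_def[abs_def] F'_def by (rule D[OF T])
    have DF': "DERIV F' u :> F'' u" for u
    proof -
      have "DERIV (\<lambda>u. ((x - (x0 + u *\<^sub>R h)) \<bullet> h) / 2) u :> - (h \<bullet> h) / 2"
      proof -
        have "(\<lambda>u. ((x - (x0 + u *\<^sub>R h)) \<bullet> h) / 2) = (\<lambda>u. ((x - x0) \<bullet> h) / 2 - u * ((h \<bullet> h) / 2))"
          by (simp add: fun_eq_iff inner_diff_left inner_add_left field_simps)
        then show ?thesis by (auto intro!: derivative_eq_intros)
      qed
      from DERIV_mult[OF this D[OF T, of "- p - 1" x t u]] show ?thesis
        unfolding F'_def[abs_def] F''_def by (simp add: algebra_simps)
    qed
    \<comment> \<open>The second difference is the increment over [0, 1] of F u - F (u - 1). Two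
      uses of the mean value theorem turn it into F'' at one point between - 1 and 1.\<close>
    have "DERIV (\<lambda>u. F u - F (u - 1)) u :> F' u - F' (u - 1)" for u
    proof -
      have "DERIV (\<lambda>u. F (u - 1)) u :> F' (u - 1) * (1 - 0)"
        by (rule DERIV_chain'[OF DERIV_diff[OF DERIV_ident DERIV_const] DF])
      then show ?thesis using DERIV_diff[OF DF] by simp
    qed
    then obtain u1 where u1: "0 < u1" "u1 < 1"
      "(F 1 - F (1 - 1)) - (F 0 - F (0 - 1)) = (1 - 0) * (F' u1 - F' (u1 - 1))"
      using MVT2[of 0 1 "\<lambda>u. F u - F (u - 1)" "\<lambda>u. F' u - F' (u - 1)"] by auto
    obtain u where u: "u1 - 1 < u" "u < u1" "F' u1 - F' (u1 - 1) = (u1 - (u1 - 1)) * F'' u"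
      using MVT2[of "u1 - 1" u1 F' F''] DF' by auto
    have "F 1 - 2 * F 0 + F (- 1) = F'' u" using u1(3) u(3) by simp
    then have eq: "heat_E (x0 + h) t0 0 (- p) T z - 2 * heat_E x0 t0 0 (- p) T z + heat_E (x0 - h) t0 0 (- p) T z
        = F'' u" by (simp add: F_def z)
    have ua: "\<bar>u\<bar> \<le> 1" using u u1 by simp
    define v where "v = (norm (x - (x0 + u *\<^sub>R h)))\<^sup>2 / 4 + T"
    note b = bounds[OF v_def r[OF ua] T]
    let ?i = "(x - (x0 + u *\<^sub>R h)) \<bullet> h"
    have "?i / 2 * (?i / 2) = (\<bar>?i\<bar> / 2)\<^sup>2" by (simp add: power2_eq_square)
    also have "\<dots> \<le> (norm h * sqrt v)\<^sup>2"
      using inner_half_le[of T "x - (x0 + u *\<^sub>R h)" h] T unfolding v_def by (intro power_mono) auto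
    also have "\<dots> = (norm h)\<^sup>2 * v" using b(1) by (simp add: power_mult_distrib)
    finally have i: "?i / 2 * (?i / 2) \<le> (norm h)\<^sup>2 * v" .
    have "\<bar>F'' u\<bar> \<le> \<bar>- (h \<bullet> h) / 2 * ?E T x t (- p - 1) u\<bar> + \<bar>?i / 2 * (?i / 2 * ?E T x t (- p - 2) u)\<bar>"
      unfolding F''_def by (rule abs_triangle_ineq)
    also have "\<dots> = (norm h)\<^sup>2 / 2 * ?E T x t (- p - 1) u + ?i / 2 * (?i / 2) * ?E T x t (- p - 2) u"
    proof -
      have "\<bar>- H / 2 * a\<bar> + \<bar>i / 2 * (i / 2 * b)\<bar> = H / 2 * a + i / 2 * (i / 2) * b"
        if "H \<ge> 0" "a \<ge> 0" "b \<ge> 0" for H a b i :: real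
      proof -
        have "\<bar>- H / 2 * a\<bar> = H / 2 * a" using that by (simp add: abs_mult)
        moreover have "0 \<le> (i / 2)\<^sup>2 * b" using that by (intro mult_nonneg_nonneg) auto
        then have "0 \<le> i / 2 * (i / 2 * b)" by (simp only: power2_eq_square mult.assoc)
        then have "\<bar>i / 2 * (i / 2 * b)\<bar> = i / 2 * (i / 2 * b)" by (rule abs_of_nonneg)
        ultimately show ?thesis by (simp only: mult.assoc)
      qed
      note abs_eq = this
      show ?thesis unfolding power2_norm_eq_inner by (rule abs_eq) simp_all
    qed
    also have "\<dots> \<le> (norm h)\<^sup>2 * ?E T x t (- p - 1) u + (norm h)\<^sup>2 * v * ?E T x t (- p - 2) u"
      using i by (intro add_mono mult_right_mono) auto
    also have "\<dots> = (norm h)\<^sup>2 * (?E T x t (- p - 1) u + v * ?E T x t (- p - 2) u)" by (simp add: algebra_simps)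
    also have "\<dots> \<le> (norm h)\<^sup>2 * (B1 * (T powr (- 1) * m T (x, t)) + B2 * (T powr (- 1) * m T (x, t)))"
      using b(4,5) by (intro mult_left_mono add_mono) auto
    finally show ?thesis unfolding eq by (simp add: z algebra_simps)
  qed
  moreover have "(norm h)\<^sup>2 * (B1 + B2) \<ge> 0" using B1(1) B2(1) by simp
  ultimately show ?th3 unfolding m_def by blast
qed


text \<open>Even q = 0 is admissible: the factor T powr (- p) gives pointwise convergence and 1 /
  \<open>pweight\<close> the majorant. Hence the borderline s = 1/2 is still reached by first
  differences.\<close>

lemma weighted_kernel_tendsto_0:
  fixes v :: "'a::euclidean_space \<times> real \<Rightarrow> real"
  assumes p: "p > 0" and q: "q \<le> 0" and v [measurable]: "v \<in> borel_measurable borel"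
    and int: "integrable lborel (\<lambda>z. \<bar>v z\<bar> / pweight p z)"
    and k [measurable]: "\<And>T. k T \<in> borel_measurable borel" and B: "B \<ge> 0"
    and le: "\<And>T z. T \<ge> 1 \<Longrightarrow> \<bar>k T z\<bar> \<le> B * (T powr q * min (1 / pweight p z) (T powr (- p)))"
  shows "(\<lambda>i. LINT z|lborel. v z * k (real (Suc i)) z) \<longlonglongrightarrow> 0"
proof -
  have "(\<lambda>i. LINT z|lborel. v z * k (real (Suc i)) z) \<longlonglongrightarrow> (LINT z|lborel. v z * 0)"
  proof (rule tendsto_integral_mult_weighted[OF v int])
    have "filterlim (\<lambda>i. real (Suc i)) at_top sequentially"
      using filterlim_compose[OF filterlim_real_sequentially filterlim_Suc] .
    then have lim: "(\<lambda>i. real (Suc i) powr (- p)) \<longlonglongrightarrow> 0"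
      using p by (intro tendsto_neg_powr) auto
    have q1: "real (Suc i) powr q \<le> 1" for i
      using powr_mono[of q 0 "real (Suc i)"] q by simp
    have le1: "\<bar>k (real (Suc i)) z\<bar> \<le> B * (1 / pweight p z)"
      and le2: "\<bar>k (real (Suc i)) z\<bar> \<le> B * real (Suc i) powr (- p)" for i z
    proof -
      let ?m = "min (1 / pweight p z) (real (Suc i) powr (- p))"
      have "?m \<ge> 0" using pweight_pos[of p z] by (simp add: less_imp_le)
      then have "real (Suc i) powr q * ?m \<le> 1 * ?m" using q1 by (intro mult_right_mono) auto
      then have "B * (real (Suc i) powr q * ?m) \<le> B * ?m" using B by (intro mult_left_mono) auto
      moreover have "B * ?m \<le> B * (1 / pweight p z)" "B * ?m \<le> B * real (Suc i) powr (- p)"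
        using B by (intro mult_left_mono; simp)+
      ultimately show "\<bar>k (real (Suc i)) z\<bar> \<le> B * (1 / pweight p z)"
        "\<bar>k (real (Suc i)) z\<bar> \<le> B * real (Suc i) powr (- p)"
        using le[of "real (Suc i)" z] by auto
    qed
    show "AE z in lborel. (\<lambda>i. k (real (Suc i)) z) \<longlonglongrightarrow> 0"
      by (intro AE_I2 Lim_null_comparison[OF _ tendsto_mult_right_zero[OF lim, of B]])
         (use le2 in \<open>auto intro!: always_eventually\<close>)
    show "\<bar>k (real (Suc i)) z\<bar> \<le> B / pweight p z" for i z
      using le1[of i z] by simp
  qed measurable
  then show ?thesis by simp
qed

text \<open>Since M does not depend on T, a combination of its values equals T^s times the pairing
  of v with the same combination of kernels, for every T >= 1. If that combination gains T^q with s
  + q <= 0, the limit is 0. The gain is q = - 1 in time and for second differences in space, and q =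
  - 1/2 for first differences in space.\<close>

lemma
  fixes v :: "'a::euclidean_space \<times> real \<Rightarrow> real" and p s :: real
  defines "M \<equiv> \<lambda>x0 t0. LINT z|lborel. v z * heat_E x0 t0 0 (- p) 1 z"
  assumes p: "p > 0" and s: "s < 1" and v [measurable]: "v \<in> borel_measurable borel"
    and int: "integrable lborel (\<lambda>z. \<bar>v z\<bar> / pweight p z)"
    and mean: "\<And>x0 t0 T. T \<ge> 1 \<Longrightarrow> M x0 t0 = T powr s * (LINT z|lborel. v z * heat_E x0 t0 0 (- p) T z)"
  shows mean_value_time_invariant: "M x0 (t0 + d) = M x0 t0"
    and mean_value_second_difference: "M (x0 + h) t0 - 2 * M x0 t0 + M (x0 - h) t0 = 0"
    and mean_value_first_difference: "s \<le> 1 / 2 \<Longrightarrow> M (x0 + h) t0 = M x0 t0"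
    and mean_value_continuous: "continuous_on UNIV (\<lambda>z. M (fst z) (snd z))"
proof -
  note iE = integrable_times_heat_E[OF p v int]
  let ?E = "\<lambda>T x0 t0. heat_E x0 t0 0 (- p) T"
  \<comment> \<open>Three terms fit the second difference; the two-term differences are instances
    with third coefficient 0.\<close>
  have comb_0: "c1 * M x1 t1 + c2 * M x2 t2 + c3 * M x3 t3 = 0"
    if B: "B \<ge> 0" "\<forall>T\<ge>1. \<forall>z. \<bar>c1 * ?E T x1 t1 z + c2 * ?E T x2 t2 z + c3 * ?E T x3 t3 z\<bar>
        \<le> B * (T powr q * min (1 / pweight p z) (T powr (- p)))"
      and q: "s + q \<le> 0" for c1 c2 c3 x1 x2 x3 t1 t2 t3 B q
  proof -
    let ?D = "\<lambda>T z. c1 * ?E T x1 t1 z + c2 * ?E T x2 t2 z + c3 * ?E T x3 t3 z"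
    have "(\<lambda>i. LINT z|lborel. v z * (real (Suc i) powr s * ?D (real (Suc i)) z)) \<longlonglongrightarrow> 0"
    proof (rule weighted_kernel_tendsto_0[OF p q v int _ B(1), where k = "\<lambda>T z. T powr s * ?D T z"])
      fix T z assume T1: "(T::real) \<ge> 1"
      then have "T powr s * \<bar>?D T z\<bar> \<le> T powr s * (B * (T powr q * min (1 / pweight p z) (T powr (- p))))"
        by (intro mult_left_mono B(2)[rule_format] T1) auto
      then show "\<bar>T powr s * ?D T z\<bar> \<le> B * (T powr (s + q) * min (1 / pweight p z) (T powr (- p)))"
        by (simp add: abs_mult powr_add mult_ac)
    qed measurable
    moreover have "(LINT z|lborel. v z * (T powr s * ?D T z)) = c1 * M x1 t1 + c2 * M x2 t2 + c3 * M x3 t3"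
      if T: "T \<ge> 1" for T
    proof -
      have i: "integrable lborel (\<lambda>z. c * (T powr s * (v z * ?E T x0 t0 z)))" for c x0 t0
        using T by (intro integrable_mult_right iE) auto
      have "v z * (T powr s * ?D T z) = c1 * (T powr s * (v z * ?E T x1 t1 z)) +
          c2 * (T powr s * (v z * ?E T x2 t2 z)) + c3 * (T powr s * (v z * ?E T x3 t3 z))" for z
        by (simp add: algebra_simps)
      then show ?thesis unfolding mean[OF T]
        by (simp only: Bochner_Integration.integral_add Bochner_Integration.integrable_add i
            integral_mult_right_zero)
    qed
    ultimately show ?thesis using LIMSEQ_unique[OF tendsto_const] by simp
  qed
  show "M x0 (t0 + d) = M x0 t0"
    using comb_0[of _ 1 x0 "t0 + d" "- 1" x0 t0 0 x0 t0 "- 1"] heat_E_differences(1)[OF p] s by force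
  show "M (x0 + h) t0 - 2 * M x0 t0 + M (x0 - h) t0 = 0"
    using comb_0[of _ 1 "x0 + h" t0 "- 2" x0 t0 1 "x0 - h" t0 "- 1"] heat_E_differences(3)[OF p] s by force
  show "M (x0 + h) t0 = M x0 t0" if "s \<le> 1 / 2"
    using comb_0[of _ 1 "x0 + h" t0 "- 1" x0 t0 0 x0 t0 "- 1 / 2"] heat_E_differences(2)[OF p] that by force
  show "continuous_on UNIV (\<lambda>z. M (fst z) (snd z))"
    unfolding continuous_on_sequentially
  proof (intro ballI allI impI)
    fix Z :: "nat \<Rightarrow> 'a \<times> real" and z0
    assume Z: "(\<forall>n. Z n \<in> UNIV) \<and> Z \<longlonglongrightarrow> z0"
    then have Zl: "Z \<longlonglongrightarrow> z0" by simp
    \<comment> \<open>Centres in a bounded set share one weight bound, which is the majorant for the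
      sequence.\<close>
    then have "Bseq Z" by (intro convergent_imp_Bseq) (unfold convergent_def, blast)
    then obtain R where R: "R > 0" "\<And>n. norm (Z n) \<le> R" by (auto elim: BseqE)
    have R': "norm (fst (Z n)) \<le> R" "\<bar>snd (Z n)\<bar> \<le> R" for n
      using R(2)[of n] norm_fst_le[of "fst (Z n)" "snd (Z n)"] norm_snd_le[of "snd (Z n)" "fst (Z n)"]
      by (auto simp: order_trans)
    obtain C where C: "C > 0" "\<And>x0 t0 x t. norm x0 \<le> R \<Longrightarrow> \<bar>t0\<bar> \<le> R \<Longrightarrow>
        ?E 1 x0 t0 (x::'a, t) \<le> C / pweight p (x, t)"
      using heat_E_le_weight[OF p less_imp_le[OF R(1)] zero_less_one, where 'a = 'a] by blast
    have "(\<lambda>n. LINT z|lborel. v z * ?E 1 (fst (Z n)) (snd (Z n)) z) \<longlonglongrightarrow>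
        (LINT z|lborel. v z * ?E 1 (fst z0) (snd z0) z)"
    proof (rule tendsto_integral_mult_weighted[OF v int])
      show "AE z in lborel. (\<lambda>n. ?E 1 (fst (Z n)) (snd (Z n)) z) \<longlonglongrightarrow> ?E 1 (fst z0) (snd z0) z"
      proof (rule AE_I2)
        fix z :: "'a \<times> real"
        have "isCont (?E 1 0 0) (z - z0)"
          using has_derivative_continuous[OF has_derivative_heat_E[of 1 0 0 0 "- p" "fst (z - z0)" "snd (z - z0)"]]
          by (simp del: fst_diff snd_diff)
        moreover have "(\<lambda>n. z - Z n) \<longlonglongrightarrow> z - z0" by (intro tendsto_intros Zl)
        ultimately have "(\<lambda>n. ?E 1 0 0 (z - Z n)) \<longlonglongrightarrow> ?E 1 0 0 (z - z0)"
          by (rule isCont_tendsto_compose)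
        then show "(\<lambda>n. ?E 1 (fst (Z n)) (snd (Z n)) z) \<longlonglongrightarrow> ?E 1 (fst z0) (snd z0) z"
          by (simp only: heat_E_eq_shift_origin)
      qed
      show "\<bar>?E 1 (fst (Z n)) (snd (Z n)) z\<bar> \<le> C / pweight p z" for n z
        using C(2)[OF R'(1)[of n] R'(2)[of n], of "fst z" "snd z"] by simp
    qed measurable
    then show "((\<lambda>z. M (fst z) (snd z)) \<circ> Z) \<longlonglongrightarrow> M (fst z0) (snd z0)"
      by (simp add: o_def M_def)
  qed
qed

section \<open>Identification of the mean values with the function\<close>


text \<open>Integrability is only local, so f is first cut down to one box. Boxes generate the Borel
  sets and are closed under intersection; a Dynkin argument extends the vanishing integrals to all
  Borel sets, and countably many growing boxes exhaust the space.\<close>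

lemma AE_eq_0_if_box_integrals_eq_0:
  fixes f :: "'a::euclidean_space \<Rightarrow> real"
  assumes f [measurable]: "f \<in> borel_measurable borel"
    and i: "\<And>a b. integrable lborel (\<lambda>x. indicator (box a b) x * f x)"
    and z: "\<And>a b. (LINT x|lborel. indicator (box a b) x * f x) = 0"
  shows "AE x in lborel. f x = 0"
proof -
  have "AE x in lborel. indicator (box c d) x * f x = 0" for c d
  proof -
    let ?g = "\<lambda>x. indicator (box c d) x * f x"
    have gA: "integrable lborel (\<lambda>x. indicator A x * ?g x)" if [measurable]: "A \<in> sets borel" for A
      by (rule Bochner_Integration.integrable_bound[OF i[of c d]]) (auto simp: indicator_def)
    have "(LINT x|lborel. indicator A x * ?g x) = 0" if "A \<in> sets borel" for A
    proof -
      have S: "sigma_sets UNIV (range (\<lambda>(a, b). box a b)) = sets (borel :: 'a measure)"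
        by (simp add: borel_eq_box)
      have "Int_stable (range (\<lambda>(a, b). box a b :: 'a set))"
      proof (rule Int_stableI)
        fix A B :: "'a set"
        assume "A \<in> range (\<lambda>(a, b). box a b)" "B \<in> range (\<lambda>(a, b). box a b)"
        then obtain a b a' b' where "A = box a b" "B = box a' b'" by auto
        then have "A \<inter> B = (\<lambda>(a, b). box a b)
            (\<Sum>i\<in>Basis. max (a \<bullet> i) (a' \<bullet> i) *\<^sub>R i, \<Sum>i\<in>Basis. min (b \<bullet> i) (b' \<bullet> i) *\<^sub>R i)"
          by (simp add: box_Int_box)
        then show "A \<inter> B \<in> range (\<lambda>(a, b). box a b)" by blast
      qed
      moreover have "range (\<lambda>(a, b). box a b) \<subseteq> Pow (UNIV :: 'a set)" by simp
      moreover have "A \<in> sigma_sets UNIV (range (\<lambda>(a, b). box a b))" using that S by simp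
      ultimately show ?thesis
      proof (induction rule: sigma_sets_induct_disjoint)
        case (basic A)
        then obtain a b where A: "A = box a b" by auto
        have "indicator A x * ?g x = indicator (box a b \<inter> box c d) x * f x" for x
          by (simp add: A indicator_def)
        then show ?case unfolding box_Int_box using z by (simp only:)
      next
        case empty
        show ?case by simp
      next
        case (compl A)
        then have A: "A \<in> sets borel" using S by simp
        have "(LINT x|lborel. indicator (UNIV - A) x * ?g x) = (LINT x|lborel. ?g x - indicator A x * ?g x)"
          by (intro Bochner_Integration.integral_cong) (auto simp: indicator_def)
        then show ?case using compl.IH gA[OF A] i z by simp
      next
        case (union A)
        then have A [measurable]: "A i \<in> sets borel" for i using S by auto
        have si: "set_integrable lborel (\<Union> (range A)) ?g"
          unfolding set_integrable_def real_scaleR_def by (intro gA) auto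
        have "(LINT x:(\<Union> (range A))|lborel. ?g x) = (\<Sum>i. (LINT x:(A i)|lborel. ?g x))"
          using union.hyps(1) si
          by (intro lebesgue_integral_countable_add) (auto simp: disjoint_family_on_def)
        then show ?case using union.IH by (simp add: set_lebesgue_integral_def)
      qed
    qed
    then show ?thesis
      by (intro density_unique_real[where f' = "\<lambda>_. 0", simplified])
         (use i in \<open>auto simp: set_lebesgue_integral_def\<close>)
  qed
  then have "AE x in lborel. \<forall>k::nat. indicator (box (- (real k *\<^sub>R One)) (real k *\<^sub>R One)) x * f x = 0"
    unfolding AE_all_countable by blast
  then show ?thesis
  proof eventually_elim
    case (elim x)
    have "x \<in> (\<Union>k::nat. box (- (real k *\<^sub>R One)) (real k *\<^sub>R One))" by (simp only: UN_box_eq_UNIV UNIV_I)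
    then obtain k :: nat where "x \<in> box (- (real k *\<^sub>R One)) (real k *\<^sub>R One)" by blast
    then show ?case using elim[rule_format, of k] by simp
  qed
qed

text \<open>Integrating over x first leaves a multiple of r^(-1-s) * exp (- 1/r), which is
  integrable on the half-line. The integral is nonzero because the kernel is strictly positive on
  the open half-space t < 0.\<close>

lemma
  assumes p: "p = real DIM('a) / 2 + 1 + s" and s: "s > 0"
  shows integrable_heat_kernel: "integrable lborel (heat_E (0::'a::euclidean_space) 0 0 (- p) 1)"
    and integral_heat_kernel_pos: "(LINT z|lborel. heat_E (0::'a) 0 0 (- p) 1 z) > 0"
proof -
  let ?k = "heat_E (0::'a) 0 0 (- p) 1"
  let ?c = "2 ^ DIM('a) * gauss_mass TYPE('a)"
  define h where "h r = indicator {0<..} r *\<^sub>R (r powr (- 1 - s) * exp (- (1 / r)))" for r :: real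
  have h: "integrable lborel h"
    using set_integrable_powr_exp_neg_inverse[of "- 1 - s" 1] s unfolding h_def set_integrable_def by simp
  have h': "integrable lborel (\<lambda>t. h (- t))"
    using integrable_lborel_affine[OF h, of "- 1" 0] by simp
  have c: "?c \<ge> 0" using gauss_mass_pos[where 'a = 'a] by simp
  have inner: "(\<integral>\<^sup>+x. ennreal (?k (x, t)) \<partial>lborel) = ennreal (?c * h (- t))" for t
  proof (cases "t < 0")
    case True
    define r where "r = - t"
    have r: "r > 0" using True by (simp add: r_def)
    have k: "?k (x, t) = r powr (- p) * exp (- (1 / r)) * exp (- ((norm (x - 0))\<^sup>2 / (4 * r)))" for x
    proof -
      have "?k (x, t) = r powr (- p) * exp (- (((norm x)\<^sup>2 / 4 + 1) / r))"
        using True by (simp add: heat_E_def r_def)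
      also have "exp (- (((norm x)\<^sup>2 / 4 + 1) / r)) = exp (- (1 / r)) * exp (- ((norm (x - 0))\<^sup>2 / (4 * r)))"
        by (simp add: add_divide_distrib flip: exp_add)
      finally show ?thesis by (simp only: mult.assoc)
    qed
    have r4: "4 * r > 0" using r by simp
    have "(\<integral>\<^sup>+x. ennreal (?k (x, t)) \<partial>lborel) = ennreal (LINT x|lborel. ?k (x, t))"
      unfolding k by (intro nn_integral_eq_integral integrable_mult_right integrable_gaussian[OF r4]) auto
    also have "(LINT x|lborel. ?k (x, t)) = r powr (- p) * exp (- (1 / r)) * (sqrt (4 * r) ^ DIM('a) * gauss_mass TYPE('a))"
      unfolding k integral_mult_right_zero integral_gaussian[OF r4] ..
    also have "sqrt (4 * r) ^ DIM('a) = 2 ^ DIM('a) * r powr (real DIM('a) / 2)"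
      using sqrt_power_eq_powr[OF r, of "DIM('a)"] by (simp add: real_sqrt_mult power_mult_distrib)
    also have "r powr (- p) * exp (- (1 / r)) * (2 ^ DIM('a) * r powr (real DIM('a) / 2) * gauss_mass TYPE('a)) =
        ?c * (r powr (- p) * r powr (real DIM('a) / 2) * exp (- (1 / r)))"
      by (simp only: mult_ac)
    also have "r powr (- p) * r powr (real DIM('a) / 2) = r powr (- 1 - s)"
      unfolding powr_add[symmetric] p by (rule arg_cong[where f = "(powr) r"]) simp
    also have "?c * (r powr (- 1 - s) * exp (- (1 / r))) = ?c * h (- t)"
      using r by (simp add: h_def r_def)
    finally show ?thesis .
  next
    case False
    then show ?thesis by (simp add: heat_E_def h_def)
  qed
  show i: "integrable lborel ?k"
  proof (rule integrableI_nonneg)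
    have "(\<integral>\<^sup>+z. ennreal (?k z) \<partial>lborel) = (\<integral>\<^sup>+z. ennreal (?k z) \<partial>(lborel \<Otimes>\<^sub>M lborel))"
      by (simp add: lborel_prod)
    also have "\<dots> = (\<integral>\<^sup>+t. (\<integral>\<^sup>+x. ennreal (?k (x, t)) \<partial>lborel) \<partial>lborel)"
      by (rule lborel_pair.nn_integral_snd[symmetric])
         (use borel_measurable_heat_E in \<open>simp add: lborel_prod\<close>)
    also have "\<dots> = (\<integral>\<^sup>+t. ennreal (?c * h (- t)) \<partial>lborel)" unfolding inner ..
    also have "\<dots> < \<infinity>"
    proof -
      have "integrable lborel (\<lambda>t. ?c * h (- t))" by (intro integrable_mult_right h')
      then have "(\<integral>\<^sup>+t. ennreal (norm (?c * h (- t))) \<partial>lborel) < \<infinity>"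
        unfolding integrable_iff_bounded by blast
      moreover have "norm (?c * h (- t)) = ?c * h (- t)" for t
        using c by (simp add: h_def)
      ultimately show ?thesis by simp
    qed
    finally show "(\<integral>\<^sup>+z. ennreal (?k z) \<partial>lborel) < \<infinity>" .
  qed auto
  have "(LINT z|lborel. ?k z) \<noteq> 0"
  proof
    assume "(LINT z|lborel. ?k z) = 0"
    then have "AE z in lborel. ?k z = 0"
      using integral_nonneg_eq_0_iff_AE[OF i] by simp
    then have "AE z::'a \<times> real in lborel. z \<notin> UNIV \<times> {..<0}"
      by eventually_elim (auto simp: heat_E_def)
    moreover have "(UNIV \<times> {..<0} :: ('a \<times> real) set) \<in> sets borel"
      by (intro borel_open open_Times) auto
    ultimately have "(UNIV \<times> {..<0} :: ('a \<times> real) set) \<in> null_sets lborel"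
      by (subst AE_iff_null_sets) auto
    then have "negligible (UNIV \<times> {..<0} :: ('a \<times> real) set)"
      by (simp add: negligible_iff_null_sets null_sets_completionI)
    moreover have "(0, - 1) \<in> (UNIV \<times> {..<0} :: ('a \<times> real) set)" by simp
    moreover have "open (UNIV \<times> {..<0} :: ('a \<times> real) set)" by (intro open_Times) auto
    ultimately show False using open_not_negligible by blast
  qed
  moreover have "(LINT z|lborel. ?k z) \<ge> 0" by simp
  ultimately show "(LINT z|lborel. ?k z) > 0" by linarith
qed


text \<open>The Jacobian consists of n factors sqrt T from space and one factor T from time.\<close>

lemma integral_parabolic_scaling:
  fixes f :: "'a::euclidean_space \<times> real \<Rightarrow> real"
  assumes [measurable]: "f \<in> borel_measurable borel" and T: "T > 0"
  shows "(LINT z|lborel. f z) =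
    T powr (real DIM('a) / 2 + 1) * (LINT w|lborel. f (z0 - (sqrt T *\<^sub>R fst w, T * snd w)))"
proof -
  \<comment> \<open>Basis vectors of the product have the form (u, 0) or (0, v); the test on the
    second component singles out the spatial ones. The signs vanish in the absolute values of the
    Jacobian.\<close>
  define c :: "'a \<times> real \<Rightarrow> real" where "c j = (if snd j = 0 then - sqrt T else - T)" for j
  define S where "S w = z0 + (\<Sum>j\<in>Basis. (c j * (w \<bullet> j)) *\<^sub>R j)" for w
  have c: "c j \<noteq> 0" for j using T by (simp add: c_def)
  have S: "S w = z0 - (sqrt T *\<^sub>R fst w, T * snd w)" for w
  proof -
    have "(\<Sum>j\<in>Basis. (c j * (w \<bullet> j)) *\<^sub>R j) = - (sqrt T *\<^sub>R fst w, T * snd w)"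
    proof (rule euclidean_eqI)
      fix b :: "'a \<times> real" assume b: "b \<in> Basis"
      have "(\<Sum>j\<in>Basis. (c j * (w \<bullet> j)) *\<^sub>R j) \<bullet> b = c b * (w \<bullet> b)"
        by (rule inner_sum_left_Basis[OF b])
      also have "\<dots> = - (sqrt T *\<^sub>R fst w, T * snd w) \<bullet> b"
        using b by (cases w) (auto simp: Basis_prod_def c_def inner_Pair)
      finally show "(\<Sum>j\<in>Basis. (c j * (w \<bullet> j)) *\<^sub>R j) \<bullet> b = - (sqrt T *\<^sub>R fst w, T * snd w) \<bullet> b" .
    qed
    then show ?thesis by (simp add: S_def)
  qed
  have P: "(\<Prod>j\<in>Basis. \<bar>c j\<bar>) = T powr (real DIM('a) / 2 + 1)"
  proof -
    have "(\<Prod>j\<in>Basis. \<bar>c j\<bar>) = (\<Prod>j\<in>(\<lambda>u. (u, 0)) ` (Basis :: 'a set). \<bar>c j\<bar>) * (\<Prod>j\<in>(\<lambda>v. (0, v)) ` (Basis :: real set). \<bar>c j\<bar>)"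
      unfolding Basis_prod_def by (rule prod.union_disjoint) auto
    also have "(\<Prod>j\<in>(\<lambda>u. (u, 0)) ` (Basis :: 'a set). \<bar>c j\<bar>) = (\<Prod>j\<in>(Basis :: 'a set). sqrt T)"
      by (subst prod.reindex) (use T in \<open>auto simp: c_def inj_on_def\<close>)
    also have "\<dots> = T powr (real DIM('a) / 2)" using sqrt_power_eq_powr[OF T] by simp
    also have "(\<Prod>j\<in>(\<lambda>v. (0, v)) ` (Basis :: real set). \<bar>c j\<bar>) = T"
      by (subst prod.reindex) (use T in \<open>auto simp: c_def inj_on_def\<close>)
    finally show ?thesis using T by (simp add: powr_add)
  qed
  have S_meas [measurable]: "S \<in> borel_measurable borel"
    unfolding S[abs_def] by (intro borel_measurable_continuous_onI continuous_intros)
  have "lborel = density (distr lborel borel S) (\<lambda>_. ennreal (\<Prod>j\<in>Basis. \<bar>c j\<bar>))"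
    using lborel_affine_euclidean[of c z0] c unfolding S_def[abs_def] by (simp add: prod_ennreal)
  then have "(LINT z|lborel. f z) = (LINT z|density (distr lborel borel S) (\<lambda>_. ennreal (\<Prod>j\<in>Basis. \<bar>c j\<bar>)). f z)"
    by simp
  also have "\<dots> = (\<Prod>j\<in>Basis. \<bar>c j\<bar>) * (LINT w|lborel. f (S w))"
    by (simp add: integral_density integral_distr prod_nonneg)
  finally show ?thesis unfolding S P .
qed

lemma heat_E_parabolic_scaling:
  assumes "T > 0"
  shows "heat_E 0 0 0 (- p) T (sqrt T *\<^sub>R y, T * r) = T powr (- p) * heat_E 0 0 0 (- p) 1 (y, r)"
proof (cases "r < 0")
  case True
  have "((norm (sqrt T *\<^sub>R y))\<^sup>2 / 4 + T) / (- (T * r)) = ((norm y)\<^sup>2 / 4 + 1) / (- r)"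
  proof -
    have "(norm (sqrt T *\<^sub>R y))\<^sup>2 / 4 + T = T * ((norm y)\<^sup>2 / 4 + 1)"
      using assms by (simp add: power_mult_distrib algebra_simps)
    then show ?thesis using assms by simp
  qed
  moreover have "(- (T * r)) powr (- p) = T powr (- p) * (- r) powr (- p)"
    using assms True powr_mult[of T "- r" "- p"] by simp
  ultimately show ?thesis using assms True by (simp add: heat_E_def mult_pos_neg)
next
  case False
  then show ?thesis using assms by (simp add: heat_E_def mult_less_0_iff)
qed

text \<open>The integration runs over the centre z0 with z fixed. This is what becomes of the
  indicator of Q when Fubini moves it from the mean values to the side of u.\<close>

definition kernel_average :: "real \<Rightarrow> real \<Rightarrow> ('a::euclidean_space \<times> real) set \<Rightarrow> real \<Rightarrow> 'a \<times> real \<Rightarrow> real" where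
  "kernel_average p s Q T z = (LINT z0|lborel. indicator Q z0 * (T powr s * heat_E (fst z0) (snd z0) 0 (- p) T z))"

text \<open>After parabolic scaling the powers of T cancel, since n/2 + 1 + s - p = 0. The average
  is then the indicator convolved with one fixed kernel shrunk by T, so T^s is precisely the factor
  that keeps the mass of the kernels constant.\<close>

lemma kernel_average_eq:
  fixes Q :: "('a::euclidean_space \<times> real) set"
  assumes p: "p = real DIM('a) / 2 + 1 + s" and T: "T > 0" and [measurable]: "Q \<in> sets borel"
  shows "kernel_average p s Q T z =
    (LINT w|lborel. indicator Q (z - (sqrt T *\<^sub>R fst w, T * snd w)) * heat_E 0 0 0 (- p) 1 w)"
proof -
  let ?S = "\<lambda>w::'a \<times> real. (sqrt T *\<^sub>R fst w, T * snd w)"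
  have [measurable]: "(\<lambda>z0. z - z0) \<in> borel_measurable borel" by simp
  have "kernel_average p s Q T z = T powr (real DIM('a) / 2 + 1) *
      (LINT w|lborel. indicator Q (z - ?S w) * (T powr s * heat_E 0 0 0 (- p) T (z - (z - ?S w))))"
    unfolding kernel_average_def heat_E_eq_shift_origin
    by (rule integral_parabolic_scaling[OF _ T]) measurable
  also have "(LINT w|lborel. indicator Q (z - ?S w) * (T powr s * heat_E 0 0 0 (- p) T (z - (z - ?S w)))) =
      (LINT w|lborel. (T powr s * T powr (- p)) * (indicator Q (z - ?S w) * heat_E 0 0 0 (- p) 1 w))"
  proof -
    have "heat_E 0 0 0 (- p) T (?S w) = T powr (- p) * heat_E 0 0 0 (- p) 1 w" for w
      using heat_E_parabolic_scaling[OF T, of p "fst w" "snd w"] by simp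
    then show ?thesis by (intro Bochner_Integration.integral_cong refl) simp
  qed
  also have "\<dots> = (T powr s * T powr (- p)) * (LINT w|lborel. indicator Q (z - ?S w) * heat_E 0 0 0 (- p) 1 w)"
    by (rule integral_mult_right_zero)
  also have "T powr (real DIM('a) / 2 + 1) * \<dots> = (T powr (real DIM('a) / 2 + 1) * T powr s * T powr (- p)) *
      (LINT w|lborel. indicator Q (z - ?S w) * heat_E 0 0 0 (- p) 1 w)"
    by (simp only: mult.assoc)
  also have "T powr (real DIM('a) / 2 + 1) * T powr s * T powr (- p) = 1"
    using T by (simp add: p flip: powr_add)
  finally show ?thesis by simp
qed

text \<open>Off the boundary of the box the indicator is locally constant, so for each w the shifted
  argument eventually has the same value as z; the fixed kernel is the majorant.\<close>

lemma kernel_average_tendsto: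
  fixes a b :: "'a::euclidean_space \<times> real"
  assumes p: "p = real DIM('a) / 2 + 1 + s" and s: "s > 0"
    and T: "T \<longlonglongrightarrow> 0" "\<And>i. T i > 0" and z: "z \<notin> cbox a b - box a b"
  shows "(\<lambda>i::nat. kernel_average p s (box a b) (T i) z) \<longlonglongrightarrow>
    indicator (box a b) z * (LINT w|lborel. heat_E (0::'a) 0 0 (- p) 1 w)"
proof -
  let ?k = "heat_E (0::'a) 0 0 (- p) 1"
  let ?S = "\<lambda>i w::'a \<times> real. z - (sqrt (T i) *\<^sub>R fst w, T i * snd w)"
  have "(\<lambda>i. LINT w|lborel. indicator (box a b) (?S i w) * ?k w) \<longlonglongrightarrow>
    (LINT w|lborel. indicator (box a b) z * ?k w)"
  proof (rule integral_dominated_convergence[where w = ?k])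
    have [measurable]: "?S i \<in> borel_measurable borel" for i
      by (intro borel_measurable_continuous_onI continuous_intros)
    show "(\<lambda>w. indicator (box a b) (?S i w) * ?k w) \<in> borel_measurable lborel" for i by measurable
    show "integrable lborel ?k" by (rule integrable_heat_kernel[OF p s])
    show "AE w in lborel. norm (indicator (box a b) (?S i w) * ?k w) \<le> ?k w" for i
      by (intro AE_I2) (auto simp: indicator_def)
    show "AE w in lborel. (\<lambda>i. indicator (box a b) (?S i w) * ?k w) \<longlonglongrightarrow> indicator (box a b) z * ?k w"
    proof (rule AE_I2)
      fix w
      have "(\<lambda>i. ?S i w) \<longlonglongrightarrow> z - (sqrt 0 *\<^sub>R fst w, 0 * snd w)"
        by (intro tendsto_intros T)
      then have lim: "(\<lambda>i. ?S i w) \<longlonglongrightarrow> z" by (simp flip: zero_prod_def)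
      have "\<forall>\<^sub>F i in sequentially. indicator (box a b) (?S i w) = (indicator (box a b) z :: real)"
      proof (cases "z \<in> box a b")
        case True
        show ?thesis using topological_tendstoD[OF lim open_box True] by eventually_elim (use True in simp)
      next
        case False
        then have "z \<in> - cbox a b" using z by auto
        then have "\<forall>\<^sub>F i in sequentially. ?S i w \<in> - cbox a b"
          using topological_tendstoD[OF lim open_Compl[OF closed_cbox]] by blast
        then show ?thesis
        proof eventually_elim
          case (elim i)
          then have "?S i w \<notin> box a b" using box_subset_cbox by blast
          then show ?case using False by simp
        qed
      qed
      then have "\<forall>\<^sub>F i in sequentially. indicator (box a b) (?S i w) * ?k w = indicator (box a b) z * ?k w"
        by eventually_elim simp
      then show "(\<lambda>i. indicator (box a b) (?S i w) * ?k w) \<longlonglongrightarrow> indicator (box a b) z * ?k w"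
        by (rule tendsto_eventually)
    qed
  qed auto
  then show ?thesis by (simp add: kernel_average_eq[OF p T(2)])
qed

lemma kernel_average_nonneg: "kernel_average p s Q T z \<ge> 0"
  unfolding kernel_average_def by (intro integral_nonneg_AE AE_I2) auto

lemma bounded_box_coordinates:
  fixes a b :: "'a::euclidean_space \<times> real"
  shows "\<exists>R>0. \<forall>x t. (x, t) \<in> box a b \<longrightarrow> norm x \<le> R \<and> \<bar>t\<bar> \<le> R"
proof -
  have "bounded (box a b)" by (rule bounded_box)
  then obtain R where R: "R > 0" "\<And>z. z \<in> box a b \<Longrightarrow> norm z \<le> R" unfolding bounded_pos by blast
  have "norm x \<le> R \<and> \<bar>t\<bar> \<le> R" if "(x, t) \<in> box a b" for x t
    using R(2)[OF that] norm_fst_le[of x t] norm_snd_le[of t x] by auto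
  then show ?thesis using R(1) by blast
qed

text \<open>Two regimes, uniform in small T. Near the box the weight is at most W1 and the average
  at most the total mass c0. Away from it z stays at a definite parabolic distance from every centre
  in the box, so the kernel itself obeys the weight bound however small T is.\<close>

lemma kernel_average_bound:
  fixes a b :: "'a::euclidean_space \<times> real"
  assumes p: "p = real DIM('a) / 2 + 1 + s" and s: "s > 0"
  shows "\<exists>C\<ge>0. \<forall>T z. 0 < T \<longrightarrow> T \<le> 1 \<longrightarrow> kernel_average p s (box a b) T z \<le> C / pweight p z"
proof -
  let ?k = "heat_E (0::'a) 0 0 (- p) 1"
  define c0 where "c0 = (LINT w|lborel. ?k w)"
  have ki: "integrable lborel ?k" by (rule integrable_heat_kernel[OF p s])
  have p0: "p > 0" using p s by (simp add: add_nonneg_pos)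
  obtain R where R: "R > 0" "\<And>x t. (x, t) \<in> box a b \<Longrightarrow> norm x \<le> R \<and> \<bar>t\<bar> \<le> R"
    using bounded_box_coordinates by blast
  have R': "norm x \<le> R" "\<bar>t\<bar> \<le> R" if "(x, t) \<in> box a b" for x t using R(2)[OF that] by auto
  define W1 where "W1 = 1 + (R + 2) powr (2 * p) + (R + 2) powr p"
  define V where "V = measure lborel (box a b)"
  obtain C where C: "C \<ge> 0" "\<And>(x0::'a) t0 T x t. T > 0 \<Longrightarrow> t < t0 \<Longrightarrow>
    heat_E x0 t0 0 (- p) T (x, t) \<le> C * ((norm (x - x0))\<^sup>2 / 4 + T + (t0 - t)) powr (- p)"
    using heat_E_le_parabolic[OF less_imp_le[OF p0], where 'a = 'a] by blast
  obtain D where D: "D > 0" "\<And>(x0::'a) t0 x t L. norm x0 \<le> R \<Longrightarrow> \<bar>t0\<bar> \<le> R \<Longrightarrow> L \<ge> 1 \<Longrightarrow>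
     (norm (x - x0))\<^sup>2 / 4 \<le> L \<Longrightarrow> \<bar>t0 - t\<bar> \<le> L \<Longrightarrow> L powr (- p) \<le> D / pweight p (x, t)"
    using pweight_le[OF p0 less_imp_le[OF R(1)] zero_less_one, where 'a = 'a] by blast
  have "kernel_average p s (box a b) T z \<le> (c0 * W1 + V * (C * D)) / pweight p z"
    if T: "0 < T" "T \<le> 1" for T z
  proof -
    obtain x t where z: "z = (x, t)" by (cases z)
    have nn: "0 \<le> c0 * W1" "0 \<le> V * (C * D)" using C(1) D(1) by (auto simp: c0_def W1_def V_def)
    show ?thesis
    proof (cases "norm x \<le> R + 2 \<and> \<bar>t\<bar> \<le> R + 2")
      case True
      have "pweight p z \<le> W1"
        using True p0 by (auto simp: z pweight_def W1_def intro!: add_mono powr_mono2)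
      have [measurable]: "(\<lambda>w::'a \<times> real. z - (sqrt T *\<^sub>R fst w, T * snd w)) \<in> borel_measurable borel"
        by (intro borel_measurable_continuous_onI continuous_intros)
      have "kernel_average p s (box a b) T z \<le> c0"
        unfolding kernel_average_eq[OF p T(1) borel_open[OF open_box]] c0_def
        by (intro integral_mono ki Bochner_Integration.integrable_bound[OF ki])
           (auto simp: indicator_def)
      also have "\<dots> \<le> c0 * (W1 / pweight p z)"
        using \<open>pweight p z \<le> W1\<close> mult_left_mono[of 1 "W1 / pweight p z" c0]
        by (simp add: c0_def)
      also have "\<dots> \<le> (c0 * W1 + V * (C * D)) / pweight p z"
        using nn by (simp add: divide_right_mono less_imp_le)
      finally show ?thesis .
    next
      case False
      have *: "T powr s * heat_E x0 t0 0 (- p) T (x, t) \<le> C * (D / pweight p (x, t))"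
        if z0: "(x0, t0) \<in> box a b" for x0 t0
      proof (cases "t < t0")
        case True
        let ?L = "(norm (x - x0))\<^sup>2 / 4 + T + (t0 - t)"
        have n0: "0 \<le> (norm (x - x0))\<^sup>2 / 4" by simp
        \<comment> \<open>The margin 2 around the box yields |x - x0|^2/4 >= 1 when x is far away,
          and t0 - t >= 2 otherwise.\<close>
        have L: "1 \<le> ?L"
        proof (cases "norm x \<le> R + 2")
          case True
          then have "\<bar>t\<bar> > R + 2" using False by simp
          then have "t0 - t \<ge> 2" using R'(2)[OF z0] \<open>t < t0\<close> by linarith
          then show ?thesis using n0 T by linarith
        next
          case False
          then have "2 \<le> norm (x - x0)" using R'(1)[OF z0] norm_triangle_sub[of x x0] by linarith
          then have "2\<^sup>2 \<le> (norm (x - x0))\<^sup>2" by (intro power_mono) auto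
          then have "1 \<le> (norm (x - x0))\<^sup>2 / 4" by simp
          then show ?thesis using T True by linarith
        qed
        have "T powr s * heat_E x0 t0 0 (- p) T (x, t) \<le> 1 * heat_E x0 t0 0 (- p) T (x, t)"
          using T s powr_mono2[of s T 1] by (intro mult_right_mono) auto
        also have "\<dots> \<le> C * ?L powr (- p)" using C(2)[OF T(1) True, of x0 x] by simp
        also have "\<dots> \<le> C * (D / pweight p (x, t))"
        proof (intro mult_left_mono D(2)[OF R'[OF z0] L] C(1))
          show "(norm (x - x0))\<^sup>2 / 4 \<le> ?L" "\<bar>t0 - t\<bar> \<le> ?L" using n0 T True by linarith+
        qed
        finally show ?thesis .
      next
        case False
        then show ?thesis using C(1) D(1) pweight_pos[of p "(x, t)"]
          by (simp add: heat_E_def less_imp_le)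
      qed
      have "kernel_average p s (box a b) T z \<le> (LINT z0|lborel. indicator (box a b) z0 * (C * (D / pweight p z)))"
        unfolding kernel_average_def
      proof (rule integral_mono')
        show "integrable lborel (\<lambda>z0. indicator (box a b) z0 * (C * (D / pweight p z)))"
          by (intro integrable_mult_left integrable_real_indicator emeasure_bounded_finite bounded_box) auto
        show "indicator (box a b) z0 * (T powr s * heat_E (fst z0) (snd z0) 0 (- p) T z)
            \<le> indicator (box a b) z0 * (C * (D / pweight p z))" for z0
          using *[of "fst z0" "snd z0"] by (auto simp: indicator_def z)
        show "0 \<le> indicator (box a b) z0 * (C * (D / pweight p z))" for z0
          using C(1) D(1) pweight_pos[of p z] by (intro mult_nonneg_nonneg) (auto simp: less_imp_le)
      qed
      also have "\<dots> = V * (C * (D / pweight p z))" by (simp add: V_def)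
      also have "\<dots> \<le> (c0 * W1 + V * (C * D)) / pweight p z"
        using nn by (simp add: divide_right_mono less_imp_le)
      finally show ?thesis .
    qed
  qed
  moreover have "c0 * W1 + V * (C * D) \<ge> 0" using C(1) D(1) by (auto simp: c0_def W1_def V_def intro!: add_nonneg_nonneg mult_nonneg_nonneg)
  ultimately show ?thesis by blast
qed


text \<open>The mean value formula is integrated over a box of centres. By Fubini this pairs v with
  the kernel averages, and these tend to c0 times the indicator as T -> 0, while the integral of m
  does not change. So m and c0 * v have equal integrals over all boxes.\<close>

lemma mean_value_identification:
  fixes v m :: "'a::euclidean_space \<times> real \<Rightarrow> real"
  assumes p: "p = real DIM('a) / 2 + 1 + s" and s: "s > 0"
    and v [measurable]: "v \<in> borel_measurable borel"
    and int: "integrable lborel (\<lambda>z. \<bar>v z\<bar> / pweight p z)"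
    and m: "continuous_on UNIV m"
    and mean: "\<And>z0 T. 0 < T \<Longrightarrow> T \<le> 1 \<Longrightarrow>
      m z0 = T powr s * (LINT z|lborel. v z * heat_E (fst z0) (snd z0) 0 (- p) T z)"
  shows "AE z in lborel. m z = (LINT w|lborel. heat_E (0::'a) 0 0 (- p) 1 w) * v z"
proof -
  define c0 where "c0 = (LINT w|lborel. heat_E (0::'a) 0 0 (- p) 1 w)"
  have p0: "p > 0" using p s by (simp add: add_nonneg_pos)
  have m_meas [measurable]: "m \<in> borel_measurable borel" by (rule borel_measurable_continuous_onI[OF m])
  have mi: "integrable lborel (\<lambda>z. indicator (box a b) z * m z)" for a b
  proof -
    have "compact (m ` cbox a b)"
      using m by (intro compact_continuous_image) (auto intro: continuous_on_subset)
    then obtain B where B: "\<And>z. z \<in> cbox a b \<Longrightarrow> norm (m z) \<le> B"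
      using compact_imp_bounded bounded_iff by (metis imageI)
    show ?thesis
    proof (rule Bochner_Integration.integrable_bound)
      show "integrable lborel (\<lambda>z. indicator (box a b) z * B)"
        by (intro integrable_mult_left integrable_real_indicator emeasure_bounded_finite bounded_box) auto
      show "AE z in lborel. norm (indicator (box a b) z * m z) \<le> norm (indicator (box a b) z * B)"
        using B box_subset_cbox by (intro AE_I2) (fastforce simp: indicator_def)
    qed measurable
  qed
  have vi: "integrable lborel (\<lambda>z. indicator (box a b) z * v z)" for a b
  proof -
    obtain R where R: "R > 0" "\<And>x t. (x, t) \<in> box a b \<Longrightarrow> norm x \<le> R \<and> \<bar>t\<bar> \<le> R"
      using bounded_box_coordinates by blast
    define W where "W = 1 + R powr (2 * p) + R powr p"
    have W: "pweight p z \<le> W" if "z \<in> box a b" for z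
      using R(2)[of "fst z" "snd z"] that p0
      by (cases z) (auto simp: pweight_def W_def intro!: add_mono powr_mono2)
    have "\<bar>indicator (box a b) z\<bar> \<le> W / pweight p z" for z :: "'a \<times> real"
    proof -
      have "0 \<le> W" by (simp add: W_def)
      then show ?thesis using W[of z] by (simp add: indicator_def less_imp_le)
    qed
    from integrable_mult_weighted[OF v int _ this] show ?thesis by (simp add: mult.commute)
  qed
  have km [measurable]: "kernel_average p s (box a b) T \<in> borel_measurable borel" for a b :: "'a \<times> real" and T
    unfolding kernel_average_def heat_E_eq_shift_origin by measurable
  have fubini: "(LINT z0|lborel. indicator (box a b) z0 * m z0) = (LINT z|lborel. v z * kernel_average p s (box a b) T z)"
    if T: "0 < T" "T \<le> 1" for a b T
  proof -
    let ?F = "\<lambda>z0 z. indicator (box a b) z0 * (T powr s * (v z * heat_E 0 0 0 (- p) T (z - z0)))"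
    let ?A = "kernel_average p s (box a b) T"
    obtain C where C: "\<And>z. ?A z \<le> C / pweight p z"
      using kernel_average_bound[OF p s, of a b] T by blast
    obtain D where D: "D > 0" "\<And>z. heat_E (0::'a) 0 0 (- p) T z \<le> D / pweight p z"
      using heat_E_le_weight[OF p0 order_refl T(1), where 'a = 'a] by force
    have hD: "heat_E (0::'a) 0 0 (- p) T z \<le> D" for z
      using D(2)[of z] D(1) pweight_ge_1[of p z] divide_left_mono[of 1 "pweight p z" D] by simp
    have F_eq: "(LINT z0|lborel. c * ?F z0 z) = c * (v z * ?A z)" for c z
      unfolding kernel_average_def heat_E_eq_shift_origin by (simp add: mult_ac flip: integral_mult_right_zero)
    have [measurable]: "(\<lambda>(z, z0). ?F z0 z) \<in> borel_measurable (lborel \<Otimes>\<^sub>M lborel)" by measurable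
    have "integrable (lborel \<Otimes>\<^sub>M lborel) (\<lambda>(z, z0). ?F z0 z)"
    proof (rule lborel_pair.Fubini_integrable)
      have "integrable lborel (\<lambda>z. v z * ?A z)"
        using C by (intro integrable_mult_weighted[OF v int]) (auto simp: kernel_average_nonneg km)
      moreover have "(LINT z0|lborel. norm (?F z0 z)) = \<bar>v z * ?A z\<bar>" for z
      proof -
        have "norm (?F z0 z) = \<bar>v z\<bar> * (indicator (box a b) z0 * (T powr s * heat_E 0 0 0 (- p) T (z - z0)))" for z0
          by (simp add: abs_mult mult_ac)
        \<comment> \<open>With |v z| = sgn (v z) * v z the integral of the norm is
          \<open>F_eq\<close> for the constant c = sgn (v z).\<close>
        then have n: "norm (?F z0 z) = sgn (v z) * ?F z0 z" for z0
          unfolding abs_sgn[of "v z"] by (simp only: mult_ac)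
        show ?thesis
          unfolding n F_eq abs_mult abs_of_nonneg[OF kernel_average_nonneg] abs_sgn[of "v z"]
          by (simp only: mult_ac)
      qed
      ultimately show "integrable lborel (\<lambda>z. LINT z0|lborel. norm (case (z, z0) of (z, z0) \<Rightarrow> ?F z0 z))"
        by simp
      have i: "integrable lborel (\<lambda>z0. indicator (box a b) z0 * (T powr s * (\<bar>v z\<bar> * D)))" for z
        by (intro integrable_mult_left integrable_real_indicator emeasure_bounded_finite bounded_box) auto
      have "integrable lborel (\<lambda>z0. ?F z0 z)" for z
        by (rule Bochner_Integration.integrable_bound[OF i[of z]])
           (use D(1) in \<open>auto simp: abs_mult indicator_def intro!: AE_I2 mult_left_mono hD\<close>)
      then show "AE z in lborel. integrable lborel (\<lambda>z0. case (z, z0) of (z, z0) \<Rightarrow> ?F z0 z)" by simp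
    qed measurable
    then have "(LINT z0|lborel. (LINT z|lborel. ?F z0 z)) = (LINT z|lborel. (LINT z0|lborel. ?F z0 z))"
      by (rule lborel_pair.Fubini_integral)
    moreover have "(LINT z|lborel. ?F z0 z) = indicator (box a b) z0 * m z0" for z0
      unfolding heat_E_eq_shift_origin[symmetric] mean[OF T] by (simp only: integral_mult_right_zero)
    moreover have "(LINT z0|lborel. ?F z0 z) = v z * ?A z" for z using F_eq[of 1 z] by simp
    ultimately show ?thesis by (simp only:)
  qed
  have box_eq: "(LINT z|lborel. indicator (box a b) z * m z) = c0 * (LINT z|lborel. indicator (box a b) z * v z)" for a b
  proof -
    obtain C where C: "C \<ge> 0" "\<And>T z. 0 < T \<Longrightarrow> T \<le> 1 \<Longrightarrow> kernel_average p s (box a b) T z \<le> C / pweight p z"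
      using kernel_average_bound[OF p s, of a b] by blast
    define T where "T i = 1 / real (Suc i)" for i
    have T: "T \<longlonglongrightarrow> 0" "\<And>i. T i > 0" "\<And>i. T i \<le> 1"
      unfolding T_def by (rule LIMSEQ_Suc[OF lim_1_over_n]) auto
    have "(\<lambda>i. LINT z|lborel. v z * kernel_average p s (box a b) (T i) z) \<longlonglongrightarrow>
        (LINT z|lborel. v z * (indicator (box a b) z * c0))"
    proof (rule tendsto_integral_mult_weighted[OF v int])
      have "negligible (cbox a b - box a b)" by (rule negligible_frontier_interval)
      then have "cbox a b - box a b \<in> null_sets lborel"
        by (simp add: negligible_iff_null_sets null_sets_completion_iff)
      then have "AE z in lborel. z \<notin> cbox a b - box a b" by (rule AE_not_in)
      then show "AE z in lborel. (\<lambda>i. kernel_average p s (box a b) (T i) z) \<longlonglongrightarrow> indicator (box a b) z * c0"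
        unfolding c0_def by eventually_elim (rule kernel_average_tendsto[OF p s T(1,2)])
      show "\<bar>kernel_average p s (box a b) (T i) z\<bar> \<le> C / pweight p z" for i z
        using C(2)[OF T(2,3)] by (simp add: kernel_average_nonneg)
    qed measurable
    then have "(LINT z|lborel. indicator (box a b) z * m z) = (LINT z|lborel. v z * (indicator (box a b) z * c0))"
      unfolding fubini[OF T(2,3), symmetric] by (rule LIMSEQ_unique[OF tendsto_const])
    also have "\<dots> = (LINT z|lborel. c0 * (indicator (box a b) z * v z))" by (simp only: mult_ac)
    finally show ?thesis by (simp only: integral_mult_right_zero)
  qed
  have "AE z in lborel. m z - c0 * v z = 0"
  proof (rule AE_eq_0_if_box_integrals_eq_0)
    fix a b :: "'a \<times> real"
    have e: "indicator (box a b) z * (m z - c0 * v z) = indicator (box a b) z * m z - c0 * (indicator (box a b) z * v z)" for z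
      by (simp add: algebra_simps)
    have cvi: "integrable lborel (\<lambda>z. c0 * (indicator (box a b) z * v z))" by (intro integrable_mult_right vi)
    show "integrable lborel (\<lambda>z. indicator (box a b) z * (m z - c0 * v z))"
      unfolding e by (intro Bochner_Integration.integrable_diff mi cvi)
    show "(LINT z|lborel. indicator (box a b) z * (m z - c0 * v z)) = 0"
      unfolding e Bochner_Integration.integral_diff[OF mi cvi] box_eq integral_mult_right_zero by simp
  qed measurable
  then show ?thesis unfolding c0_def[symmetric] by eventually_elim simp
qed

text \<open>Jensen's functional equation: g = f - f 0 is additive, because x and y are c + h and c -
  h for their midpoint c and half difference h. Additivity gives homogeneity over the rationals, and
  continuity extends it to the reals.\<close>

lemma continuous_midpoint_affine:
  fixes f :: "'a::euclidean_space \<Rightarrow> real"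
  assumes cont: "continuous_on UNIV f" and mid: "\<And>x h. f (x + h) - 2 * f x + f (x - h) = 0"
  shows "\<exists>w. \<forall>x. f x = f 0 + w \<bullet> x"
proof -
  define g where "g x = f x - f 0" for x
  have double: "g (x + x) = 2 * g x" for x
    using mid[of x x] by (simp add: g_def)
  have add: "g (x + y) = g x + g y" for x y
  proof -
    define c h where "c = (1 / 2) *\<^sub>R (x + y)" and "h = (1 / 2) *\<^sub>R (x - y)"
    have "c + h = (1 / 2) *\<^sub>R (x + x)" "c - h = (1 / 2) *\<^sub>R (y + y)"
      by (simp_all add: c_def h_def algebra_simps)
    then have "c + h = x" "c - h = y" by (simp_all flip: scaleR_2)
    moreover have "c + c = x + y" by (simp add: c_def flip: scaleR_2)
    ultimately show ?thesis using mid[of c h] double[of c] by (simp add: g_def)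
  qed
  have g0: "g 0 = 0" by (simp add: g_def)
  have neg: "g (- x) = - g x" for x using add[of x "- x"] g0 by simp
  have nat: "g (real n *\<^sub>R x) = real n * g x" for n x
    by (induction n) (simp_all add: g0 add scaleR_add_left distrib_right)
  have int: "g (real_of_int k *\<^sub>R x) = real_of_int k * g x" for k x
    by (cases k rule: int_cases2) (simp_all add: nat neg)
  have rat: "g (c *\<^sub>R x) = c * g x" if "c \<in> \<rat>" for c x
    using that
  proof (cases c rule: Rats_cases')
    case (1 a b)
    have "real_of_int b * g (c *\<^sub>R x) = g (real_of_int b *\<^sub>R (c *\<^sub>R x))" by (rule int[symmetric])
    also have "real_of_int b *\<^sub>R (c *\<^sub>R x) = real_of_int a *\<^sub>R x" using 1 by simp
    also have "g \<dots> = real_of_int a * g x" by (rule int)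
    also have "real_of_int a = c * real_of_int b" using 1 by simp
    finally have "real_of_int b * g (c *\<^sub>R x) = real_of_int b * (c * g x)" by (simp only: mult_ac)
    then show ?thesis using \<open>b > 0\<close> by (simp only: mult_cancel_left) simp
  qed
  have gc: "continuous_on UNIV g" unfolding g_def[abs_def] by (intro continuous_intros cont)
  have scale: "g (c *\<^sub>R x) = c * g x" for c x
  proof -
    have "closed {c. g (c *\<^sub>R x) = c * g x}"
      by (intro closed_Collect_eq continuous_intros continuous_on_compose2[OF gc]) auto
    moreover have "\<rat> \<subseteq> {c. g (c *\<^sub>R x) = c * g x}" using rat by blast
    ultimately have "closure \<rat> \<subseteq> {c. g (c *\<^sub>R x) = c * g x}" by (rule closure_minimal[rotated])
    then show ?thesis using Rats_closure_real by blast
  qed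
  have "linear g" by (rule linearI) (simp_all add: add scale)
  then have "g x = (\<Sum>b\<in>Basis. g b *\<^sub>R b) \<bullet> x" for x
  proof -
    have "g x = g (\<Sum>b\<in>Basis. (x \<bullet> b) *\<^sub>R b)" by (simp add: euclidean_representation)
    also have "\<dots> = (\<Sum>b\<in>Basis. (x \<bullet> b) * g b)" using \<open>linear g\<close> by (simp add: linear_sum scale)
    also have "\<dots> = (\<Sum>b\<in>Basis. g b *\<^sub>R b) \<bullet> x"
      unfolding inner_sum_left by (intro sum.cong refl) (simp add: inner_commute mult.commute)
    finally show ?thesis .
  qed
  then have "f x = f 0 + (\<Sum>b\<in>Basis. g b *\<^sub>R b) \<bullet> x" for x
    using g_def[of x] by (metis add.commute diff_add_cancel)
  then show ?thesis by blast
qed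

text \<open>The growth condition concerns every point, the affine formula only almost every one.
  Fubini supplies one time t at which the formula holds for almost every x. An open cone around - w,
  cut off at a large radius, is not a null set and so contains such an x; there u is below - e *
  |x|, which contradicts the condition as \<gamma> <= 1.\<close>

lemma AE_affine_Liminf_nonneg_imp_eq_0:
  fixes u :: "'a::euclidean_space \<times> real \<Rightarrow> real" and w :: 'a
  assumes ae: "AE z in lebesgue. u z = a + w \<bullet> fst z" and \<gamma>: "0 \<le> \<gamma>" "\<gamma> \<le> 1"
    and L: "\<forall>t. Liminf at_infinity (\<lambda>x. ereal (u (x, t) / norm x powr \<gamma>)) \<ge> 0"
  shows "w = 0"
proof (rule ccontr)
  assume w: "w \<noteq> 0"
  have "AE z in lborel. u z = a + w \<bullet> fst z" using ae by (simp add: AE_completion_iff)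
  then obtain N where N: "N \<in> null_sets lborel" "{z. u z \<noteq> a + w \<bullet> fst z} \<subseteq> N"
    unfolding eventually_ae_filter by auto
  have [measurable]: "N \<in> sets (borel :: ('a \<times> real) measure)" using N(1) by auto
  have "AE z in lborel \<Otimes>\<^sub>M lborel. z \<notin> N" unfolding lborel_prod by (rule AE_not_in[OF N(1)])
  then have ae_xt: "AE x in lborel. AE t in lborel. (x, t) \<notin> N" by (rule lborel_pair.AE_pair)
  have sets_N: "{z \<in> space ((lborel :: 'a measure) \<Otimes>\<^sub>M (lborel :: real measure)). (fst z, snd z) \<notin> N}
      \<in> sets (lborel \<Otimes>\<^sub>M lborel)"
    unfolding prod.collapse lborel_prod by measurable
  have "AE t in lborel. AE x in lborel. (x, t) \<notin> N"
    using lborel_pair.AE_commute[of "\<lambda>x t. (x, t) \<notin> N", OF sets_N] ae_xt by blast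
  then have ae_tx: "AE t in lborel. AE x in lborel. (x, t) \<notin> N" .
  have "\<exists>t. AE x in lborel. (x, t) \<notin> N"
  proof (rule ccontr)
    assume no: "\<nexists>t. AE x in lborel. (x, t) \<notin> N"
    have "AE t::real in lborel. False"
      using ae_tx by (rule eventually_mono) (use no in blast)
    then show False by (simp add: AE_iff_null null_sets_def)
  qed
  then obtain t where t: "AE x in lborel. (x, t) \<notin> N" by blast
  \<comment> \<open>On the cone w . x is below - |w| |x| / 2, and beyond the radius
    \<open>R'\<close> the constant |a| is at most |w| |x| / 4; the sum is below - |w| |x| /
    4.\<close>
  define e where "e = norm w / 4"
  have e: "e > 0" using w by (simp add: e_def)
  have "ereal (- e) < 0" using e by simp
  also have "0 \<le> Liminf at_infinity (\<lambda>x. ereal (u (x, t) / norm x powr \<gamma>))" using L by blast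
  finally have "\<forall>\<^sub>F x in at_infinity. ereal (- e) < ereal (u (x, t) / norm x powr \<gamma>)"
    by (rule less_LiminfD)
  then have "\<forall>\<^sub>F x in at_infinity. - e < u (x, t) / norm x powr \<gamma>"
    by (simp only: less_ereal.simps)
  then obtain R where R: "\<And>x. norm x \<ge> R \<Longrightarrow> - e < u (x, t) / norm x powr \<gamma>"
    unfolding eventually_at_infinity by blast
  define R' where "R' = max 1 (max R (4 * \<bar>a\<bar> / norm w))"
  define S where "S = {x. R' < norm x} \<inter> {x. w \<bullet> x < - (norm w * norm x / 2)}"
  have "open S" unfolding S_def by (intro open_Int open_Collect_less continuous_intros) auto
  moreover have "- ((R' + 1) / norm w) *\<^sub>R w \<in> S"
  proof -
    have R'0: "R' \<ge> 1" by (simp add: R'_def)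
    have "w \<bullet> (- ((R' + 1) / norm w) *\<^sub>R w) = - ((R' + 1) * norm w)"
      using w by (simp add: power2_norm_eq_inner[symmetric] power2_eq_square)
    moreover have "norm (- ((R' + 1) / norm w) *\<^sub>R w) = R' + 1" using w R'0 by simp
    moreover have "(R' + 1) * norm w > norm w * (R' + 1) / 2" using w R'0 by simp
    ultimately show ?thesis unfolding S_def by simp
  qed
  ultimately have "\<not> negligible S" using open_not_negligible by blast
  moreover have "{x. (x, t) \<in> N} \<in> null_sets lborel"
    using t by (subst AE_iff_null_sets) auto
  then have "negligible {x. (x, t) \<in> N}"
    by (simp add: negligible_iff_null_sets null_sets_completionI)
  ultimately obtain x where x: "x \<in> S" "(x, t) \<notin> N"
    using negligible_subset by blast
  have n: "norm x \<ge> 1" "norm x \<ge> R" "norm x \<ge> 4 * \<bar>a\<bar> / norm w" "w \<bullet> x < - (norm w * norm x / 2)"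
    using x(1) by (auto simp: S_def R'_def)
  have "u (x, t) = a + w \<bullet> x" using N(2) x(2) by force
  moreover have "\<bar>a\<bar> \<le> norm w * norm x / 4" using n(3) w by (simp add: field_simps)
  ultimately have "u (x, t) < - (e * norm x)" using n(4) by (simp add: e_def)
  also have "\<dots> \<le> - (e * norm x powr \<gamma>)"
    using n(1) \<gamma> e powr_mono[of \<gamma> 1 "norm x"] by simp
  finally have "u (x, t) < - e * norm x powr \<gamma>" by simp
  moreover have "- e * norm x powr \<gamma> < u (x, t)"
  proof -
    have "x \<noteq> 0" using n(1) by auto
    then have "norm x powr \<gamma> > 0" by simp
    then show ?thesis using R[OF n(2)] by (simp add: pos_less_divide_eq)
  qed
  ultimately show False by simp
qed

section \<open>The Liouville theorem\<close>


text \<open>The function is the pointwise limit of its truncations to balls, and each truncation is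
  integrable.\<close>

lemma borel_measurable_L1_loc:
  assumes "u \<in> L1_loc"
  shows "u \<in> borel_measurable lebesgue"
proof (rule borel_measurable_LIMSEQ_real)
  fix x :: 'a
  obtain k :: nat where k: "norm x \<le> real k" using real_arch_simple by blast
  have "\<forall>\<^sub>F n in sequentially. indicator (cball 0 (real n)) x *\<^sub>R u x = u x"
    using eventually_ge_at_top[of k] by eventually_elim (use k in auto)
  then show "(\<lambda>n. indicator (cball 0 (real n)) x *\<^sub>R u x) \<longlonglongrightarrow> u x" by (rule tendsto_eventually)
next
  fix n :: nat
  have "set_integrable lebesgue (cball 0 (real n)) u" using assms by (auto simp: L1_loc_def)
  then show "(\<lambda>x. indicator (cball 0 (real n)) x *\<^sub>R u x) \<in> borel_measurable lebesgue"
    unfolding set_integrable_def by (rule borel_measurable_integrable)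
qed

theorem theorem1p1:
  fixes s :: real and u :: "(real ^ 'n::finite) \<times> real \<Rightarrow> real"
  assumes "0 < s" and "s < 1"
    and "CARD('n) \<ge> 2"
    and "u \<in> L_frac_heat s"
    and "frac_heat_distr_solution s u"
    and "1 / 2 < s \<Longrightarrow> \<exists>\<gamma>::real. 0 \<le> \<gamma> \<and> \<gamma> \<le> 1 \<and>
           ((\<forall>t. Liminf at_infinity (\<lambda>x. ereal (u (x, t) / norm x powr \<gamma>)) \<ge> 0) \<or>
            (\<forall>t. Limsup at_infinity (\<lambda>x. ereal (u (x, t) / norm x powr \<gamma>)) \<le> 0))"
  shows "\<exists>c. AE z in lebesgue. u z = c"
proof -
  define p where "p = real CARD('n) / 2 + 1 + s"
  have p: "p > 0" "p = real DIM(real ^ 'n) / 2 + 1 + s" using assms(1) by (auto simp: p_def add_nonneg_pos)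
  have "(\<lambda>(x, t). \<bar>u (x, t)\<bar> / (1 + norm x powr (real CARD('n) + 2 + 2 * s)
      + \<bar>t\<bar> powr (real CARD('n) / 2 + 1 + s))) = (\<lambda>z. \<bar>u z\<bar> / pweight p z)"
    by (auto simp: fun_eq_iff pweight_def p_def algebra_simps)
  then have loc: "u \<in> L1_loc" and int_u: "integrable lebesgue (\<lambda>z. \<bar>u z\<bar> / pweight p z)"
    using assms(4) unfolding L_frac_heat_def by auto
  have um: "u \<in> borel_measurable lebesgue" using loc by (rule borel_measurable_L1_loc)
  \<comment> \<open>A Borel representative, because the convolution, scaling and Fubini arguments
    are carried out over \<open>lborel\<close>.\<close>
  obtain v where v: "v \<in> borel_measurable borel" and uv: "AE z in lborel. u z = v z"
    using completion_ex_borel_measurable_real[OF um] by auto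
  have uv': "AE z in lebesgue. u z = v z" using uv by (simp add: AE_completion_iff)
  have int: "integrable lborel (\<lambda>z. \<bar>v z\<bar> / pweight p z)"
  proof -
    have vm: "(\<lambda>z. \<bar>v z\<bar> / pweight p z) \<in> borel_measurable borel" using v by measurable
    then have "(\<lambda>z. \<bar>v z\<bar> / pweight p z) \<in> borel_measurable lebesgue"
      using measurable_completion[of _ lborel borel] by simp
    then have "integrable lebesgue (\<lambda>z. \<bar>v z\<bar> / pweight p z)"
      by (rule integrable_cong_AE_imp[OF int_u]) (use uv' in eventually_elim, simp)
    then show ?thesis using vm by (simp add: integrable_completion)
  qed
  define M where "M x0 t0 = (LINT z|lborel. v z * heat_E x0 t0 0 (- p) 1 z)" for x0 t0
  have mean: "M x0 t0 = T powr s * (LINT z|lborel. v z * heat_E x0 t0 0 (- p) T z)" if "T > 0" for x0 t0 T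
  proof -
    \<comment> \<open>The identity requires T1 < T2, so T is compared with the reference value 1
      from either side.\<close>
    note I = mean_value_identity[OF assms(1,2) _ _ assms(5) um v uv' int[unfolded p_def], folded p_def]
    show ?thesis using I[of 1 T x0 t0] I[of T 1 x0 t0] that by (cases T "1 :: real" rule: linorder_cases) (auto simp: M_def)
  qed
  have mean1: "M x0 t0 = T powr s * (LINT z|lborel. v z * heat_E x0 t0 0 (- p) T z)" if "T \<ge> 1" for x0 t0 T
    using that by (intro mean) simp
  note M_facts = mean_value_time_invariant mean_value_second_difference mean_value_first_difference
    mean_value_continuous
  note M_facts = M_facts[OF p(1) assms(2) v int, folded M_def, OF mean1]
  have time: "M x t = M x 0" for x t using M_facts(1)[of x 0 t] by simp
  have mid: "M (x + h) 0 - 2 * M x 0 + M (x - h) 0 = 0" for x h by (rule M_facts(2))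
  have cont: "continuous_on UNIV (\<lambda>z. M (fst z) (snd z))" by (rule M_facts(4))
  define c0 where "c0 = (LINT w|lborel. heat_E (0 :: real ^ 'n) 0 0 (- p) 1 w)"
  have c0: "c0 > 0" unfolding c0_def by (rule integral_heat_kernel_pos[OF p(2) assms(1)])
  have "AE z in lborel. M (fst z) (snd z) = c0 * v z"
    unfolding c0_def by (rule mean_value_identification[OF p(2) assms(1) v int cont mean])
  then have uM: "AE z in lborel. u z = M (fst z) 0 / c0"
    using uv
  proof eventually_elim
    case (elim z)
    then show ?case using c0 time[of "fst z" "snd z"] by simp
  qed
  have contM: "continuous_on UNIV (\<lambda>x. M x 0)"
    by (rule continuous_on_compose2[OF cont, of UNIV "\<lambda>x. (x, 0)", simplified]) (intro continuous_intros)
  obtain w where w: "\<And>x. M x 0 = M 0 0 + w \<bullet> x"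
    using continuous_midpoint_affine[OF contM mid] by blast
  have aff: "AE z in lebesgue. u z = M 0 0 / c0 + (w /\<^sub>R c0) \<bullet> fst z"
    unfolding AE_completion_iff using uM
  proof eventually_elim
    case (elim z)
    have "(w /\<^sub>R c0) \<bullet> fst z = (w \<bullet> fst z) / c0" using c0 by (simp add: field_simps)
    then show ?case using elim w[of "fst z"] by (simp only: add_divide_distrib)
  qed
  have "w = 0"
  proof (cases "s \<le> 1 / 2")
    case True
    \<comment> \<open>Translation by w itself changes the affine function by w . w, which must
      therefore be 0.\<close>
    then have "M w 0 = M 0 0" using M_facts(3)[of 0 w 0] by simp
    then show ?thesis using w[of w] by simp
  next
    case False
    then obtain \<gamma> where \<gamma>: "0 \<le> \<gamma>" "\<gamma> \<le> 1"
      "(\<forall>t. Liminf at_infinity (\<lambda>x. ereal (u (x, t) / norm x powr \<gamma>)) \<ge> 0) \<or>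
       (\<forall>t. Limsup at_infinity (\<lambda>x. ereal (u (x, t) / norm x powr \<gamma>)) \<le> 0)"
      using assms(6) by auto
    from \<gamma>(3) have "w /\<^sub>R c0 = 0"
    proof
      assume "\<forall>t. Liminf at_infinity (\<lambda>x. ereal (u (x, t) / norm x powr \<gamma>)) \<ge> 0"
      then show ?thesis by (rule AE_affine_Liminf_nonneg_imp_eq_0[OF aff \<gamma>(1,2)])
    next
      assume L: "\<forall>t. Limsup at_infinity (\<lambda>x. ereal (u (x, t) / norm x powr \<gamma>)) \<le> 0"
      \<comment> \<open>The upper condition on u is the lower condition on - u, whose linear part is
        - w / c0.\<close>
      have "\<forall>t. Liminf at_infinity (\<lambda>x. ereal (- u (x, t) / norm x powr \<gamma>)) \<ge> 0"
      proof
        fix t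
        have "Liminf at_infinity (\<lambda>x. - ereal (u (x, t) / norm x powr \<gamma>))
            = - Limsup at_infinity (\<lambda>x. ereal (u (x, t) / norm x powr \<gamma>))"
          by (rule ereal_Liminf_uminus)
        then show "Liminf at_infinity (\<lambda>x. ereal (- u (x, t) / norm x powr \<gamma>)) \<ge> 0"
          using L by simp
      qed
      moreover have "AE z in lebesgue. - u z = - (M 0 0 / c0) + (- (w /\<^sub>R c0)) \<bullet> fst z"
        using aff by eventually_elim simp
      ultimately have "- (w /\<^sub>R c0) = 0"
        by (intro AE_affine_Liminf_nonneg_imp_eq_0[OF _ \<gamma>(1,2), of "\<lambda>z. - u z"]) auto
      then show ?thesis by simp
    qed
    then show ?thesis using c0 by simp
  qed
  then show ?thesis using aff by auto
qed

end
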